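(* If two torus graphs $\Gamma_1$ and $\Gamma_2$ are related by a contraction/expansion of a degree $2$ vertex, a spider move, a diagonal spider move, or a $\lambda$-move, then $$P_1(z,w)=c_0\,P_2(z,w),$$ where $P_1(z,w)$ (resp. $P_2(z,w)$) is the characteristic polynomial of $\Gamma_1$ (resp. $\Gamma_2$) and $c_0$ is a constant.
   Context: Torus graphs. A torus graph is a finite graph $\Gamma$ (multiple edges allowed, no self-loops) embedded in the torus $\mathbb T=\mathbb R^2/\mathbb Z^2$ such that every connected component of the complement of $\Gamma$ is a topological disk. It is always assumed that $\Gamma$ has a perfect matching and that edge weights $\mathrm{wt}(e)$ are positive reals. Characteristic polynomial. The edges are given a Kasteleyn orientation: each face has an odd number of boundary edges oriented clockwise around it. For an edge $e$ between $u$ and $v$, traversed from $u$ to $v$, let $\kappa(e)=+1$ if $e$ is oriented from $u$ to $v$ and $-1$ otherwise, and let $\chi(e;z,w)=z^{\alpha(e)}w^{\beta(e)}$, where $\alpha(e)$ is the signed number of crossings of $e$ with the vertical boundary of the fundamental domain (positive left to right) and $\beta(e)$ that with the horizontal boundary (positive bottom to top). Let $K(z,w)_{u,v}=\sum_{e}\kappa(e)\,\mathrm{wt}(e)\,\chi(e;z,w)$, the sum over all edges $e$ between $u$ and $v$. The characteristic polynomial is $P(z,w)=\det K(z,w)$. Local moves. Each move changes the graph only inside a disk, the rest of the graph being unchanged; the vertices $v_i$ may be connected to the rest of the graph (except $v_2$ in (i), which has degree $2$). (i) Expansion of a degree $2$ vertex (the reverse is contraction): a vertex $v$ is replaced by a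 path $v_1,v_2,v_3$ with $\deg(v_2)=2$, $\mathrm{wt}(v_1v_2)=\mathrm{wt}(v_2v_3)=1$, and the edges at $v$ are distributed between $v_1$ and $v_3$ in two sets of cyclically consecutive edges. (ii) Diagonal spider move: $\Gamma_1$ contains vertices $v_1,v_2,v_3,v_4$ (in cyclic order around the disk) and inner vertices $u_1,u_3$, where the edges at $u_1$ are exactly $u_1v_1$ (weight $1$), $u_1v_2$ (weight $b$), $u_1v_4$ (weight $a$), $u_1u_3$ (weight $e$), and those at $u_3$ are exactly $u_3v_3$ (weight $1$), $u_3v_2$ (weight $c$), $u_3v_4$ (weight $d$), $u_1u_3$ (weight $e$). With $\Delta=ac+bd$, in $\Gamma_2$ the vertices $u_1,u_3$ are replaced by inner vertices $u_2,u_4$ with edges $u_2v_2$, $u_4v_4$ of weight $1$, $v_1u_2$ of weight $d/\Delta$, $u_2v_3$ of weight $a/\Delta$, $v_3u_4$ of weight $b/\Delta$, $u_4v_1$ of weight $c/\Delta$, $u_2u_4$ of weight $e/\Delta$. (iii) Spider move: the same as (ii) without the edges $u_1u_3$ and $u_2u_4$ (i.e. $e=0$). (iv) $\lambda$-move: $\Gamma_1$ contains a vertex $u$ of degree $3$ with edges $uv_1,uv_2,uv_3$ of weights $c,b,d$ and an edge $v_1v_2$ of weight $a$ forming a triangle with $u$; in $\Gamma_2$ the edge $v_1v_2$ is deleted and an edge $v_1v_3$ of weight $ad/b$, forming a triangle with $u$, is added. *)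

theory Defs
  imports
    "Graph_Theory.Graph_Theory"
    "HOL-Combinatorics.Orbits"
    "HOL-Library.Poly_Mapping"
    "HOL-Library.Product_Plus"
begin

section \<open>Graphs on the torus\<close>

text \<open>
  A finite connected graph embedded in an oriented closed surface so that all faces are
  topological disks is, up to orientation preserving homeomorphism, the same thing as a
  combinatorial map: every edge is a pair of opposite darts (half-edges, the arcs of a
  bidirected multidigraph), and \<open>rot\<close> sends a dart to the next dart out of the same vertex
  in counterclockwise order. The surface is a torus iff \<open>V - E + F = 0\<close>.

  \<open>crossing d\<close> is the pair \<open>(\<alpha>, \<beta>)\<close> of signed numbers of crossings of the dart \<open>d\<close> with the
  vertical and the horizontal boundary of the fundamental domain.
\<close>

record ('v, 'd) emb_graph =
  dg :: "('v, 'd) pre_digraph"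
  opp :: "'d \<Rightarrow> 'd"
  rot :: "'d \<Rightarrow> 'd"
  wt :: "'d \<Rightarrow> real"
  crossing :: "'d \<Rightarrow> int \<times> int"

abbreviation verts_of :: "('v, 'd) emb_graph \<Rightarrow> 'v set" where
  "verts_of G \<equiv> verts (dg G)"

abbreviation darts_of :: "('v, 'd) emb_graph \<Rightarrow> 'd set" where
  "darts_of G \<equiv> arcs (dg G)"

text \<open>
  Turning counterclockwise at the far end of every dart goes around the face to the right of
  the darts. So a face is the set of darts which run clockwise around it; an edge with the same
  face on both sides contributes both of its darts.
\<close>

definition faces :: "('v, 'd) emb_graph \<Rightarrow> 'd set set" where
  "faces G = (\<lambda>d. orbit (rot G \<circ> opp G) d) ` darts_of G"

text \<open>
  The last two assumptions on \<open>crossing\<close> say that it is a closed cochain and that it maps the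
  first homology of the surface onto \<open>\<int>\<^sup>2\<close>, hence isomorphically for a torus: the
  identification of the surface with \<open>\<real>\<^sup>2/\<int>\<^sup>2\<close>. It is not required to preserve the
  orientation; reversing it only replaces, say, \<open>z\<close> by \<open>1/z\<close>.
\<close>

locale torus_graph =
  bidirected_digraph "dg G" "opp G" + fin_digraph "dg G" + loopfree_digraph "dg G"
  for G :: "('v, 'd) emb_graph" +
  assumes connected_dg: "connected (dg G)"
    and rot_permutes: "rot G permutes darts_of G"
    and rot_cyclic: "\<And>v. v \<in> verts_of G \<Longrightarrow> out_arcs (dg G) v \<noteq> {} \<Longrightarrow>
      cyclic_on (rot G) (out_arcs (dg G) v)"
    and euler_char_zero: "2 * (card (verts_of G) + card (faces G)) = card (darts_of G)"
    and wt_pos: "\<And>d. d \<in> darts_of G \<Longrightarrow> wt G d > 0"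
    and wt_opp: "\<And>d. d \<in> darts_of G \<Longrightarrow> wt G (opp G d) = wt G d"
    and perfect_matching: "\<exists>M \<subseteq> darts_of G. (\<forall>d \<in> M. opp G d \<in> M) \<and>
      (\<forall>v \<in> verts_of G. \<exists>!d. d \<in> M \<and> tail (dg G) d = v)"
    and crossing_opp: "\<And>d. d \<in> darts_of G \<Longrightarrow> crossing G (opp G d) = - crossing G d"
    and crossing_closed: "\<And>F. F \<in> faces G \<Longrightarrow> (\<Sum>d\<in>F. crossing G d) = 0"
    and crossing_onto: "\<And>x. \<exists>u p. pre_digraph.awalk (dg G) u p u \<and> (\<Sum>d\<leftarrow>p. crossing G d) = x"


section \<open>Kasteleyn orientations and the characteristic polynomial\<close>

text \<open>An orientation is given by the set of darts pointing in the chosen directions.\<close>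

definition orientation :: "('v, 'd) emb_graph \<Rightarrow> 'd set \<Rightarrow> bool" where
  "orientation G K \<longleftrightarrow> K \<subseteq> darts_of G \<and> (\<forall>d \<in> darts_of G. d \<in> K \<longleftrightarrow> opp G d \<notin> K)"

definition kasteleyn :: "('v, 'd) emb_graph \<Rightarrow> 'd set \<Rightarrow> bool" where
  "kasteleyn G K \<longleftrightarrow> orientation G K \<and> (\<forall>F \<in> faces G. odd (card (F \<inter> K)))"

text \<open>
  Laurent polynomials in two variables are the group algebra of \<open>\<int>\<^sup>2\<close>:
  \<open>Poly_Mapping.single (i, j) x\<close> is the monomial \<open>x z\<^sup>i w\<^sup>j\<close>.
\<close>

type_synonym laurent2 = "(int \<times> int) \<Rightarrow>\<^sub>0 real"

definition kasteleyn_matrix :: "('v, 'd) emb_graph \<Rightarrow> 'd set \<Rightarrow> 'v \<Rightarrow> 'v \<Rightarrow> laurent2" where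
  "kasteleyn_matrix G K u v =
    (\<Sum>d | d \<in> darts_of G \<and> tail (dg G) d = u \<and> head (dg G) d = v.
      Poly_Mapping.single (crossing G d) ((if d \<in> K then 1 else - 1) * wt G d))"

text \<open>The determinant of a matrix indexed by the finite set of vertices.\<close>

definition charpoly :: "('v, 'd) emb_graph \<Rightarrow> 'd set \<Rightarrow> laurent2" where
  "charpoly G K =
    (\<Sum>\<pi> | \<pi> permutes verts_of G.
      of_int (sign \<pi>) * (\<Prod>v \<in> verts_of G. kasteleyn_matrix G K v (\<pi> v)))"


section \<open>Local moves\<close>

text \<open>\<open>ds\<close> lists all darts out of \<open>v\<close> in counterclockwise order.\<close>

definition ccw :: "('v, 'd) emb_graph \<Rightarrow> 'v \<Rightarrow> 'd list \<Rightarrow> bool" where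
  "ccw G v ds \<longleftrightarrow> v \<in> verts_of G \<and> distinct ds \<and> set ds = out_arcs (dg G) v \<and>
    (\<forall>i < length ds. rot G (ds ! i) = ds ! (Suc i mod length ds))"

definition link :: "('v, 'd) emb_graph \<Rightarrow> 'd \<Rightarrow> 'v \<Rightarrow> 'v \<Rightarrow> real \<Rightarrow> bool" where
  "link G d u v x \<longleftrightarrow>
    d \<in> darts_of G \<and> tail (dg G) d = u \<and> head (dg G) d = v \<and> wt G d = x"

text \<open>
  In each move the darts and vertices which are not affected have the same names in both graphs.
  The part of the graphs inside the disk is described by the counterclockwise orders at the
  vertices of the disk. A function \<open>t\<close> on the vertices describes a lift of the disk to the
  universal cover \<open>\<real>\<^sup>2\<close>: the lift of \<open>x\<close> lies in the translate by \<open>t x\<close> of the fundamental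
  domain, so an edge inside the disk from \<open>x\<close> to \<open>y\<close> has crossing numbers \<open>t y - t x\<close>.
\<close>

text \<open>
  \<open>G\<^sub>2\<close> arises from \<open>G\<^sub>1\<close> by expanding \<open>v\<close> into the path \<open>v\<^sub>1 v\<^sub>2 v\<^sub>3\<close>. The new vertices
  need not lie at the position of \<open>v\<close>, whose lift is taken to be in the fundamental domain
  itself; this shifts the crossing numbers of the edges at \<open>v\<close>.
\<close>

definition expansion :: "('v, 'd) emb_graph \<Rightarrow> ('v, 'd) emb_graph \<Rightarrow> bool" where
  "expansion G\<^sub>1 G\<^sub>2 \<longleftrightarrow>
    (\<exists>v v\<^sub>1 v\<^sub>2 v\<^sub>3 p q xs ys t.
      distinct [v\<^sub>1, v\<^sub>2, v\<^sub>3] \<and> {v\<^sub>1, v\<^sub>2, v\<^sub>3} \<inter> (verts_of G\<^sub>1 - {v}) = {} \<and>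
      verts_of G\<^sub>2 = (verts_of G\<^sub>1 - {v}) \<union> {v\<^sub>1, v\<^sub>2, v\<^sub>3} \<and>
      {p, opp G\<^sub>2 p, q, opp G\<^sub>2 q} \<inter> darts_of G\<^sub>1 = {} \<and>
      darts_of G\<^sub>2 = darts_of G\<^sub>1 \<union> {p, opp G\<^sub>2 p, q, opp G\<^sub>2 q} \<and>
      link G\<^sub>2 p v\<^sub>1 v\<^sub>2 1 \<and> link G\<^sub>2 q v\<^sub>2 v\<^sub>3 1 \<and>
      ccw G\<^sub>1 v (xs @ ys) \<and>
      ccw G\<^sub>2 v\<^sub>1 (xs @ [p]) \<and> ccw G\<^sub>2 v\<^sub>2 [opp G\<^sub>2 p, q] \<and> ccw G\<^sub>2 v\<^sub>3 (ys @ [opp G\<^sub>2 q]) \<and>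
      (\<forall>d \<in> darts_of G\<^sub>1. opp G\<^sub>2 d = opp G\<^sub>1 d \<and> wt G\<^sub>2 d = wt G\<^sub>1 d \<and>
        (tail (dg G\<^sub>1) d \<noteq> v \<longrightarrow>
          tail (dg G\<^sub>2) d = tail (dg G\<^sub>1) d \<and> rot G\<^sub>2 d = rot G\<^sub>1 d)) \<and>
      (\<forall>x. x \<notin> {v\<^sub>1, v\<^sub>2, v\<^sub>3} \<longrightarrow> t x = 0) \<and>
      (\<forall>d \<in> darts_of G\<^sub>1.
        crossing G\<^sub>2 d = crossing G\<^sub>1 d + t (head (dg G\<^sub>2) d) - t (tail (dg G\<^sub>2) d)) \<and>
      crossing G\<^sub>2 p = t v\<^sub>2 - t v\<^sub>1 \<and> crossing G\<^sub>2 q = t v\<^sub>3 - t v\<^sub>2)"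

text \<open>The common part of the two graphs in the moves below, with \<open>B\<close> the vertices on the disk.\<close>

definition same_outside ::
  "('v, 'd) emb_graph \<Rightarrow> ('v, 'd) emb_graph \<Rightarrow> 'v set \<Rightarrow> bool" where
  "same_outside G\<^sub>1 G\<^sub>2 B \<longleftrightarrow>
    (\<forall>d \<in> darts_of G\<^sub>1 \<inter> darts_of G\<^sub>2.
      tail (dg G\<^sub>2) d = tail (dg G\<^sub>1) d \<and> opp G\<^sub>2 d = opp G\<^sub>1 d \<and>
      wt G\<^sub>2 d = wt G\<^sub>1 d \<and> crossing G\<^sub>2 d = crossing G\<^sub>1 d \<and>
      (tail (dg G\<^sub>1) d \<notin> B \<longrightarrow> rot G\<^sub>2 d = rot G\<^sub>1 d))"

text \<open>
  The disk of a (diagonal) spider move: \<open>x, y, x', y'\<close> lie counterclockwise around the disk,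
  \<open>u\<close> is joined to \<open>x, y, y'\<close> and \<open>u'\<close> to \<open>x', y, y'\<close> inside the disk, and to each other
  iff \<open>e \<noteq> 0\<close>; \<open>X, Y, X', Y'\<close> are the darts going to the rest of the graph.
\<close>

definition spider_disk ::
  "('v, 'd) emb_graph \<Rightarrow> 'v \<times> 'v \<times> 'v \<times> 'v \<Rightarrow> 'v \<times> 'v \<Rightarrow>
    real \<times> real \<times> real \<times> real \<times> real \<Rightarrow>
    'd list \<times> 'd list \<times> 'd list \<times> 'd list \<Rightarrow> ('v \<Rightarrow> int \<times> int) \<Rightarrow> bool" where
  "spider_disk G = (\<lambda>(x, y, x', y') (u, u') (a, b, c, d, e) (X, Y, X', Y') t.
    distinct [x, y, x', y', u, u'] \<and>
    (\<exists>ux uy uy' u'x' u'y u'y' uu'.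
      link G ux u x 1 \<and> link G uy u y b \<and> link G uy' u y' a \<and>
      link G u'x' u' x' 1 \<and> link G u'y u' y c \<and> link G u'y' u' y' d \<and>
      (e \<noteq> 0 \<longrightarrow> link G uu' u u' e) \<and>
      ccw G u ([ux, uy] @ (if e = 0 then [] else [uu']) @ [uy']) \<and>
      ccw G u' ([u'x', u'y'] @ (if e = 0 then [] else [opp G uu']) @ [u'y]) \<and>
      ccw G x (opp G ux # X) \<and> ccw G y (opp G u'y # opp G uy # Y) \<and>
      ccw G x' (opp G u'x' # X') \<and> ccw G y' (opp G uy' # opp G u'y' # Y')) \<and>
    (\<forall>k \<in> darts_of G. tail (dg G) k \<in> {u, u'} \<longrightarrow>
      crossing G k = t (head (dg G) k) - t (tail (dg G) k)))"

text \<open>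
  The disk in \<open>G\<^sub>2\<close> is that in \<open>G\<^sub>1\<close>, rotated by one step and with other weights.
  The same \<open>t\<close> for both graphs ensures that the paths between the \<open>v\<^sub>i\<close> through the disk
  are homotopic.
\<close>

definition spider_with_diagonal ::
  "real \<Rightarrow> ('v, 'd) emb_graph \<Rightarrow> ('v, 'd) emb_graph \<Rightarrow> bool" where
  "spider_with_diagonal e G\<^sub>1 G\<^sub>2 \<longleftrightarrow>
    (\<exists>v\<^sub>1 v\<^sub>2 v\<^sub>3 v\<^sub>4 u\<^sub>1 u\<^sub>2 u\<^sub>3 u\<^sub>4 a b c d D\<^sub>1 D\<^sub>2 D\<^sub>3 D\<^sub>4 t.
      {u\<^sub>1, u\<^sub>3} \<inter> verts_of G\<^sub>2 = {} \<and> {u\<^sub>2, u\<^sub>4} \<inter> verts_of G\<^sub>1 = {} \<and>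
      verts_of G\<^sub>1 - {u\<^sub>1, u\<^sub>3} = verts_of G\<^sub>2 - {u\<^sub>2, u\<^sub>4} \<and>
      darts_of G\<^sub>1 \<inter> darts_of G\<^sub>2 =
        {k \<in> darts_of G\<^sub>1. tail (dg G\<^sub>1) k \<notin> {u\<^sub>1, u\<^sub>3} \<and> head (dg G\<^sub>1) k \<notin> {u\<^sub>1, u\<^sub>3}} \<and>
      darts_of G\<^sub>1 \<inter> darts_of G\<^sub>2 =
        {k \<in> darts_of G\<^sub>2. tail (dg G\<^sub>2) k \<notin> {u\<^sub>2, u\<^sub>4} \<and> head (dg G\<^sub>2) k \<notin> {u\<^sub>2, u\<^sub>4}} \<and>
      same_outside G\<^sub>1 G\<^sub>2 {v\<^sub>1, v\<^sub>2, v\<^sub>3, v\<^sub>4} \<and>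
      spider_disk G\<^sub>1 (v\<^sub>1, v\<^sub>2, v\<^sub>3, v\<^sub>4) (u\<^sub>1, u\<^sub>3) (a, b, c, d, e) (D\<^sub>1, D\<^sub>2, D\<^sub>3, D\<^sub>4) t \<and>
      (let \<Delta> = a * c + b * d in
        spider_disk G\<^sub>2 (v\<^sub>2, v\<^sub>3, v\<^sub>4, v\<^sub>1) (u\<^sub>2, u\<^sub>4)
          (d / \<Delta>, a / \<Delta>, b / \<Delta>, c / \<Delta>, e / \<Delta>) (D\<^sub>2, D\<^sub>3, D\<^sub>4, D\<^sub>1) t))"

definition spider_move :: "('v, 'd) emb_graph \<Rightarrow> ('v, 'd) emb_graph \<Rightarrow> bool" where
  "spider_move G\<^sub>1 G\<^sub>2 \<longleftrightarrow> spider_with_diagonal 0 G\<^sub>1 G\<^sub>2"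

definition diagonal_spider_move :: "('v, 'd) emb_graph \<Rightarrow> ('v, 'd) emb_graph \<Rightarrow> bool" where
  "diagonal_spider_move G\<^sub>1 G\<^sub>2 \<longleftrightarrow> (\<exists>e > 0. spider_with_diagonal e G\<^sub>1 G\<^sub>2)"

text \<open>
  Here \<open>v\<^sub>1, v\<^sub>2, v\<^sub>3\<close> are in counterclockwise order around \<open>u\<close>. The mirror images of these
  moves are their inverses, with \<open>v\<^sub>2\<close> and \<open>v\<^sub>3\<close> exchanged. The triangles being faces, the
  crossing numbers of \<open>m\<close> and \<open>n\<close> are determined by those of the edges at \<open>u\<close>.
\<close>

definition lambda_move :: "('v, 'd) emb_graph \<Rightarrow> ('v, 'd) emb_graph \<Rightarrow> bool" where
  "lambda_move G\<^sub>1 G\<^sub>2 \<longleftrightarrow>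
    (\<exists>u v\<^sub>1 v\<^sub>2 v\<^sub>3 a b c d uv\<^sub>1 uv\<^sub>2 uv\<^sub>3 m n D\<^sub>1 D\<^sub>2 D\<^sub>3.
      distinct [u, v\<^sub>1, v\<^sub>2, v\<^sub>3] \<and> verts_of G\<^sub>1 = verts_of G\<^sub>2 \<and>
      darts_of G\<^sub>1 \<inter> darts_of G\<^sub>2 = darts_of G\<^sub>1 - {m, opp G\<^sub>1 m} \<and>
      darts_of G\<^sub>1 \<inter> darts_of G\<^sub>2 = darts_of G\<^sub>2 - {n, opp G\<^sub>2 n} \<and>
      same_outside G\<^sub>1 G\<^sub>2 {v\<^sub>1, v\<^sub>2, v\<^sub>3} \<and>
      link G\<^sub>1 uv\<^sub>1 u v\<^sub>1 c \<and> link G\<^sub>1 uv\<^sub>2 u v\<^sub>2 b \<and> link G\<^sub>1 uv\<^sub>3 u v\<^sub>3 d \<and>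
      link G\<^sub>1 m v\<^sub>1 v\<^sub>2 a \<and> link G\<^sub>2 n v\<^sub>1 v\<^sub>3 (a * d / b) \<and>
      ccw G\<^sub>1 u [uv\<^sub>1, uv\<^sub>2, uv\<^sub>3] \<and>
      ccw G\<^sub>1 v\<^sub>1 ([m, opp G\<^sub>1 uv\<^sub>1] @ D\<^sub>1) \<and> ccw G\<^sub>2 v\<^sub>1 ([opp G\<^sub>1 uv\<^sub>1, n] @ D\<^sub>1) \<and>
      ccw G\<^sub>1 v\<^sub>2 ([opp G\<^sub>1 uv\<^sub>2, opp G\<^sub>1 m] @ D\<^sub>2) \<and> ccw G\<^sub>2 v\<^sub>2 (opp G\<^sub>1 uv\<^sub>2 # D\<^sub>2) \<and>
      ccw G\<^sub>1 v\<^sub>3 (opp G\<^sub>1 uv\<^sub>3 # D\<^sub>3) \<and> ccw G\<^sub>2 v\<^sub>3 ([opp G\<^sub>2 n, opp G\<^sub>1 uv\<^sub>3] @ D\<^sub>3))"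

definition elementary_move :: "('v, 'd) emb_graph \<Rightarrow> ('v, 'd) emb_graph \<Rightarrow> bool" where
  "elementary_move G\<^sub>1 G\<^sub>2 \<longleftrightarrow> expansion G\<^sub>1 G\<^sub>2 \<or> spider_move G\<^sub>1 G\<^sub>2 \<or>
    diagonal_spider_move G\<^sub>1 G\<^sub>2 \<or> lambda_move G\<^sub>1 G\<^sub>2"

text \<open>
  A Kasteleyn orientation is not unique, so those of two graphs related by a move have to be
  chosen to agree outside the disk. For a contraction this is only possible after reversing all
  edges at the vertices in a set \<open>S\<close> (those joining two vertices of \<open>S\<close> are reversed twice);
  this changes the signs of a row and a column per vertex, so not the determinant.
\<close>

definition orientations_agree ::
  "('v, 'd) emb_graph \<Rightarrow> 'd set \<Rightarrow> ('v, 'd) emb_graph \<Rightarrow> 'd set \<Rightarrow> bool" where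
  "orientations_agree G\<^sub>1 K\<^sub>1 G\<^sub>2 K\<^sub>2 \<longleftrightarrow>
    (\<exists>S. \<forall>d \<in> darts_of G\<^sub>1 \<inter> darts_of G\<^sub>2.
      (d \<in> K\<^sub>2 \<longleftrightarrow> d \<in> K\<^sub>1) \<longleftrightarrow> (tail (dg G\<^sub>1) d \<in> S \<longleftrightarrow> head (dg G\<^sub>1) d \<in> S))"

end

theory Submission
  imports Defs
begin

text \<open>The two matrices differ only in the entries that belong to edges in the disk of the move, provided
  that the signs are chosen well; a few row and column operations relate these entries.

  Signs. Let the sign of a dart be \<open>- 1\<close> if it points in the chosen direction of its edge and
  \<open>1\<close> otherwise. An orientation is Kasteleyn iff the product of the signs around every face is
  \<open>- 1\<close>. The faces are the orbits of the permutation \<open>rot \<circ> opp\<close>; comparing the first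
  returns of the two permutations to the part that the graphs have in common shows that a face of
  one graph and the corresponding face of the other differ only by the stretches on which they cross
  the disk, and that these stretches join the same corners of the disk. So an
  orientation of the new edges is good as soon as every stretch has the same sign in both graphs
  and the faces inside the disk have the right sign (\<open>kasteleyn_transfer\<close>). This is a small system of
  equations for signs, solvable since the signs of the given graph satisfy the equations of the
  faces inside its own disk.

  Determinants. If necessary, conjugation by a diagonal matrix of monomials with signs moves the
  vertices of the disk to the fundamental domain and reverses the edges at some vertices. After that the two matrices are related
  by a product with one matrix that only mixes two rows, and one that mixes the same two columns
  (\<open>det_on_combine_two_rows_columns\<close>):
  \<^item> for an expansion, adding \<open>v\<^sub>1\<close> to \<open>v\<^sub>3\<close> splits off the rows and columns of \<open>v\<^sub>1\<close> and
    \<open>v\<^sub>2\<close> as a block of determinant \<open>1\<close> and leaves the matrix of the contracted graph;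
  \<^item> for a \<open>\<lambda>\<close>-move, adding a multiple of \<open>u\<close> to \<open>v\<^sub>1\<close> deletes the edge \<open>v\<^sub>1 v\<^sub>2\<close> and creates
    \<open>v\<^sub>1 v\<^sub>3\<close>;
  \<^item> for the spider moves, with or without diagonal, the rows of \<open>u\<^sub>2\<close> and \<open>u\<^sub>4\<close> are the
    combinations of those of \<open>u\<^sub>1\<close> and \<open>u\<^sub>3\<close> that vanish at \<open>v\<^sub>4\<close> and at \<open>v\<^sub>2\<close>.

  Hence \<open>c\<^sub>0 = 1\<close> for the first two kinds of moves, while for the spider moves, where the \<open>2 \<times> 2\<close>
  matrix of coefficients has the determinant \<open>\<plusminus>1/\<Delta>\<close>, it is \<open>\<Delta>\<^sup>2\<close>. The inverse
  of a spider move is again a spider move.\<close>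

section \<open>Determinants indexed by finite sets\<close>

definition det_on :: "'a set \<Rightarrow> ('a \<Rightarrow> 'a \<Rightarrow> 'b::comm_ring_1) \<Rightarrow> 'b" where
  "det_on V M = (\<Sum>\<pi> | \<pi> permutes V. of_int (sign \<pi>) * (\<Prod>v\<in>V. M v (\<pi> v)))"

lemma det_on_cong:
  assumes "\<And>x y. x \<in> V \<Longrightarrow> y \<in> V \<Longrightarrow> M x y = N x y"
  shows "det_on V M = det_on V N"
  unfolding det_on_def using assms
  by (intro sum.cong arg_cong2[where f = "(*)"] prod.cong) (auto simp: permutes_in_image)

lemma det_on_transpose:
  assumes "finite V"
  shows "det_on V (\<lambda>x y. M y x) = det_on V M"
proof -
  have "(\<Prod>v\<in>V. M (inv \<pi> v) v) = (\<Prod>v\<in>V. M v (\<pi> v))" if "\<pi> permutes V" for \<pi>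
    by (subst prod.permute[OF that]) (simp add: o_def permutes_inverses[OF that])
  then show ?thesis
    unfolding det_on_def
    by (subst sum_permutations_inverse)
       (auto intro!: sum.cong simp: sign_inverse permutes_imp_permutation[OF assms])
qed

lemma det_on_scale_rows_columns:
  assumes "finite V"
  shows "det_on V (\<lambda>x y. r x * M x y * c y) = (\<Prod>v\<in>V. r v * c v) * det_on V M"
proof -
  have "(\<Prod>v\<in>V. r v * M v (\<pi> v) * c (\<pi> v)) = (\<Prod>v\<in>V. r v * c v) * (\<Prod>v\<in>V. M v (\<pi> v))"
    if "\<pi> permutes V" for \<pi>
    using prod.permute[OF that, of c] by (simp add: prod.distrib o_def mult_ac)
  then show ?thesis
    by (simp add: det_on_def sum_distrib_left mult.left_commute)
qed

lemma det_on_reindex: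
  assumes "inj_on f V" "finite V"
  shows "det_on (f ` V) M = det_on V (\<lambda>x y. M (f x) (f y))"
proof -
  have bij: "bij_betw f V (f ` V)" using assms by (simp add: bij_betw_imageI)
  have "det_on (f ` V) M =
    (\<Sum>\<pi> | \<pi> permutes V. of_int (sign (map_permutation V f \<pi>)) *
      (\<Prod>v\<in>f ` V. M v (map_permutation V f \<pi> v)))"
    unfolding det_on_def
    by (rule sum.reindex_bij_betw[symmetric])
       (use bij_betw_permutations[OF bij] in \<open>simp add: map_permutation_def restrict_id_def [abs_def] o_def\<close>)
  also have "\<dots> = det_on V (\<lambda>x y. M (f x) (f y))"
    unfolding det_on_def
    by (intro sum.cong refl arg_cong2[where f = "(*)"])
       (auto simp: sign_map_permutation assms prod.reindex map_permutation_apply)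
  finally show ?thesis .
qed

lemma det_on_row_linear:
  assumes "finite V" "i \<in> V"
  shows "det_on V (M(i := \<lambda>y. a * r y + b * s y)) =
    a * det_on V (M(i := r)) + b * det_on V (M(i := s))"
proof -
  have *: "(\<Prod>v\<in>V. (M(i := t)) v (\<pi> v)) = t (\<pi> i) * (\<Prod>v\<in>V - {i}. M v (\<pi> v))" for t \<pi>
    using assms by (subst prod.remove[of V i]) auto
  show ?thesis
    unfolding det_on_def * by (simp add: sum_distrib_left algebra_simps sum.distrib)
qed

text \<open>Composition with the transposition of \<open>i\<close> and \<open>j\<close> matches the even permutations with the odd ones, and matched terms cancel.\<close>

lemma det_on_equal_rows:
  assumes "finite V" "i \<in> V" "j \<in> V" "i \<noteq> j" "M i = M j"
  shows "det_on V M = 0"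
proof -
  let ?t = "transpose i j"
  let ?f = "\<lambda>\<pi>. of_int (sign \<pi>) * (\<Prod>v\<in>V. M v (\<pi> v))"
  have t: "?t permutes V" using assms by (simp add: permutes_swap_id)
  have Mt: "M (?t v) = M v" for v
    using \<open>M i = M j\<close> by (auto simp: transpose_def)
  have perm: "\<pi> \<circ> ?t permutes V" if "\<pi> permutes V" for \<pi>
    using permutes_compose[OF t that] .
  have f: "?f (\<pi> \<circ> ?t) = - ?f \<pi>" if "\<pi> permutes V" for \<pi>
  proof -
    have "(\<Prod>v\<in>V. M v (\<pi> (?t v))) = (\<Prod>v\<in>V. M v (\<pi> v))"
      using prod.permute[OF t, of "\<lambda>v. M v (\<pi> v)"] by (simp add: o_def Mt)
    moreover have "sign (\<pi> \<circ> ?t) = - sign \<pi>"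
      using assms
      by (simp add: sign_compose permutes_imp_permutation[OF \<open>finite V\<close> that]
          permutation_swap_id sign_swap_id)
    ultimately show ?thesis by simp
  qed
  have even: "evenperm (\<pi> \<circ> ?t) \<longleftrightarrow> \<not> evenperm \<pi>" if "\<pi> permutes V" for \<pi>
    using assms
    by (simp add: evenperm_comp permutes_imp_permutation[OF \<open>finite V\<close> that]
        permutation_swap_id evenperm_swap)
  have "det_on V M = sum ?f {\<pi>. \<pi> permutes V \<and> evenperm \<pi>} +
      sum ?f {\<pi>. \<pi> permutes V \<and> \<not> evenperm \<pi>}"
    unfolding det_on_def
    by (subst sum.union_disjoint[symmetric])
       (use finite_permutations[OF \<open>finite V\<close>] in \<open>auto intro!: sum.cong\<close>)
  also have "sum ?f {\<pi>. \<pi> permutes V \<and> \<not> evenperm \<pi>} =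
      sum (\<lambda>\<pi>. ?f (\<pi> \<circ> ?t)) {\<pi>. \<pi> permutes V \<and> evenperm \<pi>}"
    by (rule sum.reindex_bij_witness[where i = "\<lambda>\<pi>. \<pi> \<circ> ?t" and j = "\<lambda>\<pi>. \<pi> \<circ> ?t"])
       (use perm even in \<open>auto simp: comp_assoc\<close>)
  also have "\<dots> = - sum ?f {\<pi>. \<pi> permutes V \<and> evenperm \<pi>}"
    by (subst sum_negf[symmetric]) (use f in \<open>auto intro!: sum.cong\<close>)
  finally show ?thesis by simp
qed

text \<open>Expand the determinant with \<open>r + s\<close> in both rows, which is zero.\<close>

lemma det_on_swap_rows:
  assumes "finite V" "i \<in> V" "j \<in> V" "i \<noteq> j"
  shows "det_on V (M(i := s, j := r)) = - det_on V (M(i := r, j := s))"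
proof -
  have lin: "det_on V (M(i := \<lambda>y. a y + b y, j := c)) =
      det_on V (M(i := a, j := c)) + det_on V (M(i := b, j := c))"
    "det_on V (M(i := c, j := \<lambda>y. a y + b y)) =
      det_on V (M(i := c, j := a)) + det_on V (M(i := c, j := b))" for a b c
    using det_on_row_linear[OF assms(1,2), of "M(j := c)" 1 a 1 b]
      det_on_row_linear[OF assms(1,3), of "M(i := c)" 1 a 1 b] \<open>i \<noteq> j\<close>
    by (simp_all add: fun_upd_twist)
  have alt: "det_on V (M(i := a, j := a)) = 0" for a
    by (rule det_on_equal_rows[OF assms]) (use \<open>i \<noteq> j\<close> in auto)
  have "det_on V (M(i := \<lambda>y. r y + s y, j := \<lambda>y. r y + s y)) = 0"
    by (rule alt)
  then have "det_on V (M(i := r, j := s)) + det_on V (M(i := s, j := r)) = 0"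
    unfolding lin by (simp add: alt)
  then show ?thesis by (simp add: eq_neg_iff_add_eq_0 add.commute)
qed

lemma det_on_combine_two_rows:
  assumes "finite V" "i \<in> V" "j \<in> V" "i \<noteq> j"
  shows "det_on V (M(i := \<lambda>y. a * M i y + b * M j y, j := \<lambda>y. c * M i y + d * M j y)) =
    (a * d - b * c) * det_on V M"
proof -
  have lin: "det_on V (M(i := \<lambda>y. a * r y + b * s y, j := t)) =
      a * det_on V (M(i := r, j := t)) + b * det_on V (M(i := s, j := t))"
    "det_on V (M(i := t, j := \<lambda>y. c * r y + d * s y)) =
      c * det_on V (M(i := t, j := r)) + d * det_on V (M(i := t, j := s))" for r s t
    using det_on_row_linear[OF assms(1,2), of "M(j := t)" a r b s]
      det_on_row_linear[OF assms(1,3), of "M(i := t)" c r d s] \<open>i \<noteq> j\<close>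
    by (simp_all add: fun_upd_twist)
  have alt: "det_on V (M(i := a, j := a)) = 0" for a
    by (rule det_on_equal_rows[OF assms]) (use \<open>i \<noteq> j\<close> in auto)
  show ?thesis
    unfolding lin alt det_on_swap_rows[OF assms, of M "M j" "M i"]
    by (simp add: algebra_simps)
qed

text \<open>The matrix is multiplied from both sides by matrices that differ from the identity only in the
  rows and columns of \<open>i\<close> and \<open>j\<close>; \<open>R\<close> is the result of the multiplication from the left.\<close>

lemma det_on_combine_two_rows_columns:
  fixes M :: "'a \<Rightarrow> 'a \<Rightarrow> 'b::comm_ring_1" and a b c d :: 'b
  assumes "finite V" "i \<in> V" "j \<in> V" "i \<noteq> j"
  defines "R \<equiv> M(i := \<lambda>y. a * M i y + b * M j y, j := \<lambda>y. c * M i y + d * M j y)"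
  assumes N: "\<And>x. x \<in> V \<Longrightarrow> N x i = a' * R x i + b' * R x j"
    "\<And>x. x \<in> V \<Longrightarrow> N x j = c' * R x i + d' * R x j"
    "\<And>x y. x \<in> V \<Longrightarrow> y \<in> V \<Longrightarrow> y \<noteq> i \<Longrightarrow> y \<noteq> j \<Longrightarrow> N x y = R x y"
  shows "det_on V N = (a * d - b * c) * (a' * d' - b' * c') * det_on V M"
proof -
  define T where "T = (\<lambda>x y. R y x)"
  have "det_on V N = det_on V (\<lambda>x y. N y x)"
    by (rule det_on_transpose[OF assms(1), symmetric])
  also have "\<dots> = det_on V (T(i := \<lambda>y. a' * T i y + b' * T j y, j := \<lambda>y. c' * T i y + d' * T j y))"
    by (rule det_on_cong) (use N \<open>i \<noteq> j\<close> in \<open>auto simp: T_def\<close>)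
  also have "\<dots> = (a' * d' - b' * c') * det_on V T"
    by (rule det_on_combine_two_rows[OF assms(1-4)])
  also have "det_on V T = det_on V R"
    unfolding T_def by (rule det_on_transpose[OF assms(1)])
  also have "\<dots> = (a * d - b * c) * det_on V M"
    unfolding R_def by (rule det_on_combine_two_rows[OF assms(1-4)])
  finally show ?thesis by (simp add: mult_ac)
qed

text \<open>Only the permutations fixing \<open>i\<close> contribute.\<close>

lemma det_on_remove_row:
  assumes "finite V" "i \<in> V" "\<And>y. y \<in> V \<Longrightarrow> y \<noteq> i \<Longrightarrow> M i y = 0"
  shows "det_on V M = M i i * det_on (V - {i}) M"
proof -
  let ?f = "\<lambda>\<pi>. of_int (sign \<pi>) * (\<Prod>v\<in>V. M v (\<pi> v))"
  have "det_on V M = (\<Sum>\<pi> | \<pi> permutes (V - {i}). ?f \<pi>)"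
    unfolding det_on_def
  proof (rule sum.mono_neutral_right)
    show "finite {\<pi>. \<pi> permutes V}" using assms by (simp add: finite_permutations)
    show "{\<pi>. \<pi> permutes (V - {i})} \<subseteq> {\<pi>. \<pi> permutes V}"
      by (auto intro: permutes_subset)
    show "\<forall>\<pi>\<in>{\<pi>. \<pi> permutes V} - {\<pi>. \<pi> permutes (V - {i})}. ?f \<pi> = 0"
    proof
      fix \<pi> assume "\<pi> \<in> {\<pi>. \<pi> permutes V} - {\<pi>. \<pi> permutes (V - {i})}"
      then have \<pi>: "\<pi> permutes V" "\<not> \<pi> permutes (V - {i})" by auto
      then have "\<pi> i \<noteq> i"
        using permutes_superset[OF \<pi>(1), of "V - {i}"] by auto
      then have "M i (\<pi> i) = 0"
        using assms \<pi>(1) by (auto simp: permutes_in_image)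
      then show "?f \<pi> = 0" using assms by (simp add: prod_zero[of V] bexI[of _ i])
    qed
  qed
  also have "\<dots> = M i i * det_on (V - {i}) M"
    unfolding det_on_def sum_distrib_left
  proof (rule sum.cong)
    fix \<pi> assume "\<pi> \<in> {\<pi>. \<pi> permutes (V - {i})}"
    then have "\<pi> i = i" by (auto simp: permutes_def)
    then show "?f \<pi> = M i i * (of_int (sign \<pi>) * (\<Prod>v\<in>V - {i}. M v (\<pi> v)))"
      using assms by (subst prod.remove[of V i]) (auto simp: mult_ac)
  qed simp
  finally show ?thesis .
qed

text \<open>Exchanging the rows of \<open>i\<close> and \<open>j\<close> moves the two entries to the diagonal, where they can be removed one after the other.\<close>

lemma det_on_remove_pair:
  assumes "finite V" "i \<in> V" "j \<in> V" "i \<noteq> j"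
    and row: "\<And>y. y \<in> V \<Longrightarrow> y \<noteq> j \<Longrightarrow> M i y = 0"
    and col: "\<And>x. x \<in> V \<Longrightarrow> x \<noteq> j \<Longrightarrow> M x i = 0"
  shows "det_on V M = - (M i j * M j i) * det_on (V - {i, j}) M"
proof -
  define N where "N = M(i := M j, j := M i)"
  have "det_on V M = - det_on V N"
    using det_on_swap_rows[OF assms(1-4), of M "M i" "M j"] by (simp add: N_def)
  also have "det_on V N = N j j * det_on (V - {j}) N"
    by (rule det_on_remove_row) (use assms in \<open>auto simp: N_def\<close>)
  also have "det_on (V - {j}) N = det_on (V - {j}) (\<lambda>x y. N y x)"
    by (rule det_on_transpose[symmetric]) (use assms in auto)
  also have "\<dots> = N i i * det_on (V - {j} - {i}) (\<lambda>x y. N y x)"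
    by (rule det_on_remove_row) (use assms in \<open>auto simp: N_def\<close>)
  also have "det_on (V - {j} - {i}) (\<lambda>x y. N y x) = det_on (V - {j} - {i}) N"
    by (rule det_on_transpose) (use assms in auto)
  also have "\<dots> = det_on (V - {i, j}) M"
    unfolding Diff_insert[symmetric] by (rule det_on_cong) (auto simp: N_def)
  finally show ?thesis using \<open>i \<noteq> j\<close> by (simp add: N_def mult_ac)
qed

section \<open>Orbits and first returns of permutations\<close>

text \<open>The points \<open>j t\<close> form a section of the permutation \<open>f\<close>, and \<open>s t\<close> lists the points visited
  from \<open>j t\<close> until just before the next visit to the section, which takes place at \<open>j (g t)\<close>.
  The section is indexed by a set \<open>T\<close> of its own so that two permutations can be compared whose
  first returns are the same map \<open>g\<close> of \<open>T\<close>.\<close>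

locale first_return =
  fixes f :: "'a \<Rightarrow> 'a" and A :: "'a set" and T :: "'c set" and j :: "'c \<Rightarrow> 'a"
    and s :: "'c \<Rightarrow> 'a list" and g :: "'c \<Rightarrow> 'c"
  assumes finite_A: "finite A" and f_permutes: "f permutes A" and finite_T: "finite T"
    and inj_j: "inj_on j T"
    and j_in: "\<And>t. t \<in> T \<Longrightarrow> j t \<in> A"
    and s_start: "\<And>t. t \<in> T \<Longrightarrow> s t \<noteq> [] \<and> hd (s t) = j t"
    and s_steps: "\<And>t. t \<in> T \<Longrightarrow> successively (\<lambda>x y. f x = y) (s t)"
    and s_avoids: "\<And>t. t \<in> T \<Longrightarrow> set (tl (s t)) \<inter> j ` T = {}"
    and s_end: "\<And>t. t \<in> T \<Longrightarrow> f (last (s t)) = j (g t)"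
    and g_in: "\<And>t. t \<in> T \<Longrightarrow> g t \<in> T"
    and g_outside: "\<And>t. t \<notin> T \<Longrightarrow> g t = t"
begin

lemma permutation_f: "permutation f"
  using finite_A f_permutes by (rule permutes_imp_permutation)

lemma s_nth: "t \<in> T \<Longrightarrow> i < length (s t) \<Longrightarrow> s t ! i = (f ^^ i) (j t)"
proof (induction i)
  case 0
  then show ?case using s_start[of t] by (auto dest: hd_conv_nth)
next
  case (Suc i)
  then show ?case
    using s_steps[of t] by (auto simp: successively_conv_nth)
qed

text \<open>Following two excursions backwards from a common point, one arrives at the start of one of them,
  which the other one can only meet at its own start.\<close>

lemma s_nth_eq:
  assumes "t \<in> T" "t' \<in> T" "i < length (s t)" "k < length (s t')" "s t ! i = s t' ! k" "i \<le> k"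
  shows "t = t' \<and> i = k"
proof -
  have inj: "inj (f ^^ i)" using permutes_inj[OF f_permutes] by (simp add: inj_fn)
  have "(f ^^ i) (j t) = (f ^^ i) ((f ^^ (k - i)) (j t'))"
    using assms by (simp add: s_nth flip: comp_apply[of "f ^^ i" "f ^^ (k - i)"] funpow_add)
  then have *: "j t = s t' ! (k - i)"
    using inj assms by (simp add: inj_eq s_nth)
  have "k - i = 0"
  proof (rule ccontr)
    assume "k - i \<noteq> 0"
    then obtain m where "k - i = Suc m" using not0_implies_Suc by blast
    then have "j t \<in> set (tl (s t'))"
      using * assms by (auto simp: nth_tl[symmetric] intro!: nth_mem)
    then show False using s_avoids assms by blast
  qed
  then show ?thesis
    using * assms inj_onD[OF inj_j, of t t'] s_nth[of t' 0] s_start[of t'] by auto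
qed

lemma s_disjoint:
  assumes "t \<in> T" "t' \<in> T" "x \<in> set (s t)" "x \<in> set (s t')"
  shows "t = t'"
proof -
  obtain i k where "i < length (s t)" "s t ! i = x" "k < length (s t')" "s t' ! k = x"
    using assms by (auto simp: in_set_conv_nth)
  then show ?thesis
    using s_nth_eq[of t t' i k] s_nth_eq[of t' t k i] assms by (cases "i \<le> k") auto
qed

lemma s_distinct: "t \<in> T \<Longrightarrow> distinct (s t)"
  unfolding distinct_conv_nth using s_nth_eq by (metis linear)

lemma g_permutes: "g permutes T"
proof (rule bij_imp_permutes)
  have "inj_on g T"
  proof (rule inj_onI)
    fix t t' assume *: "t \<in> T" "t' \<in> T" "g t = g t'"
    then have "f (last (s t)) = f (last (s t'))" by (simp add: s_end)
    then have "last (s t) = last (s t')" using permutes_inj[OF f_permutes] by (simp add: inj_eq)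
    then show "t = t'" using s_disjoint[of t t' "last (s t)"] * s_start
      by (metis last_in_set)
  qed
  then show "bij_betw g T T"
    using g_in finite_T unfolding bij_betw_def by (auto simp: endo_inj_surj image_subset_iff)
qed (fact g_outside)

lemma set_s_subset_orbit:
  assumes "t \<in> T" "x \<in> set (s t)"
  shows "x \<in> orbit f (j t)"
  using assms permutation_self_in_orbit[OF permutation_f, of "j t"]
  by (auto simp: in_set_conv_nth s_nth intro: funpow_in_orbit)

lemma orbit_eq_excursions:
  assumes "t \<in> T"
  shows "orbit f (j t) = (\<Union>t'\<in>orbit g t. set (s t'))"
proof
  have T: "t' \<in> T" if "t' \<in> orbit g t" for t'
    using permutes_orbit_subset[OF g_permutes assms] that by blast
  have next_in: "j (g t') \<in> orbit f (j t')" if "t' \<in> T" for t'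
  proof -
    have "f (last (s t')) \<in> orbit f (j t')"
      using that s_start[OF that] set_s_subset_orbit[OF that last_in_set] by (auto intro: orbit.step)
    then show ?thesis by (simp add: s_end that)
  qed
  have "j t' \<in> orbit f (j t)" if "t' \<in> orbit g t" for t'
    using that
  proof induction
    case base
    then show ?case by (rule next_in[OF assms])
  next
    case (step t')
    then show ?case using next_in[OF T[OF step.hyps]] orbit_trans by metis
  qed
  then show "(\<Union>t'\<in>orbit g t. set (s t')) \<subseteq> orbit f (j t)"
    by (blast intro: orbit_trans[OF set_s_subset_orbit[OF T]])
  have closed: "f x \<in> (\<Union>t'\<in>orbit g t. set (s t'))" if t': "t' \<in> orbit g t" "x \<in> set (s t')" for t' x
  proof -
    obtain i where i: "i < length (s t')" "s t' ! i = x"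
      using t'(2) by (metis in_set_conv_nth)
    show ?thesis
    proof (cases "Suc i < length (s t')")
      case True
      then have "f x = s t' ! Suc i"
        using s_steps[OF T[OF t'(1)]] i by (auto simp: successively_conv_nth)
      then show ?thesis using True t' by (metis UN_I nth_mem)
    next
      case False
      then have "x = last (s t')" using i by (metis Suc_lessI last_conv_nth diff_Suc_1 length_0_conv less_nat_zero_code)
      then have "f x = j (g t')" using s_end T t' by simp
      moreover have "g t' \<in> orbit g t" using t' by (auto intro: orbit.step)
      ultimately show ?thesis using s_start[OF T[OF \<open>g t' \<in> orbit g t\<close>]] by (metis UN_I hd_in_set)
    qed
  qed
  have self: "t \<in> orbit g t"
    using permutation_self_in_orbit permutes_imp_permutation[OF finite_T g_permutes] by metis
  show "orbit f (j t) \<subseteq> (\<Union>t'\<in>orbit g t. set (s t'))"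
  proof
    fix x assume "x \<in> orbit f (j t)"
    then show "x \<in> (\<Union>t'\<in>orbit g t. set (s t'))"
    proof induction
      case base
      then show ?case using closed[OF self] s_start[OF assms] by (metis hd_in_set)
    next
      case (step y)
      then show ?case using closed by blast
    qed
  qed
qed

text \<open>The excursions are disjoint and exhaust the orbit.\<close>

lemma prod_orbit:
  fixes w :: "'a \<Rightarrow> 'b::comm_monoid_mult"
  assumes "t \<in> T"
  shows "prod w (orbit f (j t)) = (\<Prod>t'\<in>orbit g t. prod_list (map w (s t')))"
proof -
  have sub: "orbit g t \<subseteq> T" by (rule permutes_orbit_subset[OF g_permutes assms])
  have "prod w (orbit f (j t)) = (\<Prod>t'\<in>orbit g t. prod w (set (s t')))"
    unfolding orbit_eq_excursions[OF assms]
    by (rule prod.UNION_disjoint)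
       (use sub finite_T s_disjoint in \<open>auto intro: finite_subset, blast\<close>)
  also have "\<dots> = (\<Prod>t'\<in>orbit g t. prod_list (map w (s t')))"
    using sub s_distinct by (intro prod.cong refl prod.distinct_set_conv_list) auto
  finally show ?thesis .
qed

end


lemma orbit_three_cycle:
  assumes "f x = y" "f y = z" "f z = x"
  shows "orbit f x = {x, y, z}"
proof
  show "orbit f x \<subseteq> {x, y, z}"
  proof
    fix k assume "k \<in> orbit f x"
    then show "k \<in> {x, y, z}" by induction (use assms in auto)
  qed
  have "y \<in> orbit f x" using orbit.base[of f x] assms by simp
  moreover from orbit.step[OF this] have "z \<in> orbit f x" using assms by simp
  moreover from orbit.step[OF this] have "x \<in> orbit f x" using assms by simp
  ultimately show "{x, y, z} \<subseteq> orbit f x" by blast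
qed

lemma orbit_four_cycle:
  assumes "f x = y" "f y = z" "f z = w" "f w = x"
  shows "orbit f x = {x, y, z, w}"
proof
  show "orbit f x \<subseteq> {x, y, z, w}"
  proof
    fix k assume "k \<in> orbit f x"
    then show "k \<in> {x, y, z, w}" by induction (use assms in auto)
  qed
  have "y \<in> orbit f x" using orbit.base[of f x] assms by simp
  moreover from orbit.step[OF this] have "z \<in> orbit f x" using assms by simp
  moreover from orbit.step[OF this] have "w \<in> orbit f x" using assms by simp
  moreover from orbit.step[OF this] have "x \<in> orbit f x" using assms by simp
  ultimately show "{x, y, z, w} \<subseteq> orbit f x" by blast
qed

section \<open>Face permutations and Kasteleyn signs\<close>

text \<open>Its orbits on the darts are the faces.\<close>

definition face_succ :: "('v, 'd) emb_graph \<Rightarrow> 'd \<Rightarrow> 'd" where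
  "face_succ G = rot G \<circ> opp G"

text \<open>The sign is opposite to that in the Kasteleyn matrix. With this choice a face has an odd number
  of clockwise edges iff the product of the signs of its darts is \<open>- 1\<close>, whatever its
  length is.\<close>

definition dart_sign :: "'d set \<Rightarrow> 'd \<Rightarrow> int" where
  "dart_sign K d = (if d \<in> K then - 1 else 1)"

lemma dart_sign_cases: "dart_sign K d = 1 \<or> dart_sign K d = - 1"
  by (simp add: dart_sign_def)

lemma dart_sign_square [simp]: "dart_sign K d * dart_sign K d = 1"
  by (simp add: dart_sign_def)

lemma prod_dart_sign: "finite F \<Longrightarrow> prod (dart_sign K) F = (- 1) ^ card (F \<inter> K)"
  unfolding dart_sign_def by (subst prod.If_cases) (auto simp: Int_def)

lemma orientation_opp:
  "orientation G K \<Longrightarrow> d \<in> darts_of G \<Longrightarrow> dart_sign K (opp G d) = - dart_sign K d"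
  by (auto simp: orientation_def dart_sign_def)

lemma orientation_with_signs:
  assumes "\<And>d. d \<in> darts_of G \<Longrightarrow> \<tau> d = 1 \<or> \<tau> d = - 1"
    and "\<And>d. d \<in> darts_of G \<Longrightarrow> opp G d \<in> darts_of G"
    and "\<And>d. d \<in> darts_of G \<Longrightarrow> \<tau> (opp G d) = - \<tau> d"
  obtains K where "orientation G K" and "\<And>d. d \<in> darts_of G \<Longrightarrow> dart_sign K d = \<tau> d"
proof
  let ?K = "{d \<in> darts_of G. \<tau> d = - (1 :: int)}"
  show "orientation G ?K"
    using assms by (fastforce simp: orientation_def)
  show "dart_sign ?K d = \<tau> d" if "d \<in> darts_of G" for d
    using assms(1)[OF that] that by (auto simp: dart_sign_def)
qed

context torus_graph
begin

lemma face_succ_permutes: "face_succ G permutes darts_of G"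
  unfolding face_succ_def by (rule permutes_compose[OF arev_permutes_arcs rot_permutes])

lemma rot_in_darts [simp]: "d \<in> darts_of G \<Longrightarrow> rot G d \<in> darts_of G"
  using rot_permutes by (simp add: permutes_in_image)

lemma tail_rot [simp]: "d \<in> darts_of G \<Longrightarrow> tail (dg G) (rot G d) = tail (dg G) d"
  using cyclic_on_inI[OF rot_cyclic[of "tail (dg G) d"], of d] by fastforce

lemma orbit_face_succ_subset: "d \<in> darts_of G \<Longrightarrow> orbit (face_succ G) d \<subseteq> darts_of G"
  by (rule permutes_orbit_subset[OF face_succ_permutes])

lemma face_succ_in_darts [simp]: "d \<in> darts_of G \<Longrightarrow> face_succ G d \<in> darts_of G"
  by (simp add: face_succ_def)

lemma face_succ_outside: "d \<notin> darts_of G \<Longrightarrow> face_succ G d = d"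
  by (rule permutes_not_in[OF face_succ_permutes])

lemma kasteleyn_iff:
  "kasteleyn G K \<longleftrightarrow> orientation G K \<and>
    (\<forall>d \<in> darts_of G. prod (dart_sign K) (orbit (face_succ G) d) = - 1)"
proof -
  have "odd (card (orbit (face_succ G) d \<inter> K)) \<longleftrightarrow>
      prod (dart_sign K) (orbit (face_succ G) d) = - 1" if "d \<in> darts_of G" for d
  proof -
    have "finite (orbit (face_succ G) d)"
      using orbit_face_succ_subset[OF that] by (rule finite_subset) simp
    then show ?thesis
      by (simp add: prod_dart_sign minus_one_power_iff)
  qed
  then show ?thesis
    by (auto simp: kasteleyn_def faces_def face_succ_def)
qed

text \<open>A face is a closed walk, so that it leaves every vertex as often as it enters it. Reversing all
  edges at the vertices with \<open>g v = - 1\<close> therefore preserves the product.\<close>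

lemma prod_gauge_orbit:
  fixes \<tau> :: "'d \<Rightarrow> int"
  assumes d: "d \<in> darts_of G" and g: "\<And>v. g v * g v = 1"
  shows "(\<Prod>x\<in>orbit (face_succ G) d. \<tau> x * g (tail (dg G) x) * g (head (dg G) x)) =
    prod \<tau> (orbit (face_succ G) d)"
proof -
  let ?F = "orbit (face_succ G) d"
  have F: "?F \<subseteq> darts_of G" by (rule orbit_face_succ_subset[OF d])
  have inj: "inj_on (face_succ G) ?F"
    using permutes_inj[OF face_succ_permutes] by (rule inj_on_subset) simp
  have img: "face_succ G ` ?F = ?F"
    by (rule endo_inj_surj) (use F inj in \<open>auto intro: finite_subset orbit.step\<close>)
  have "(\<Prod>x\<in>?F. g (tail (dg G) x)) = (\<Prod>x\<in>face_succ G ` ?F. g (tail (dg G) x))"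
    by (simp add: img)
  also have "\<dots> = (\<Prod>x\<in>?F. g (tail (dg G) (face_succ G x)))"
    by (subst prod.reindex[OF inj]) (simp add: o_def)
  also have "\<dots> = (\<Prod>x\<in>?F. g (head (dg G) x))"
    using F by (intro prod.cong) (auto simp: face_succ_def)
  finally have "(\<Prod>x\<in>?F. g (tail (dg G) x)) * (\<Prod>x\<in>?F. g (head (dg G) x)) = 1"
    by (simp add: g prod.distrib[symmetric])
  then show ?thesis
    by (simp add: prod.distrib mult.assoc)
qed

end

text \<open>Faces of \<open>G\<close> and \<open>H\<close> passing through the common section \<open>T\<close> correspond to each other, since
  the first returns are the same; by the assumption on the excursions, corresponding faces have the
  same sign. All other darts of \<open>H\<close> belong to faces inside the disk, the set \<open>I\<close>. The factors
  \<open>b\<close> and \<open>c\<close> allow to reverse all edges at some vertices before comparing.\<close>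

lemma kasteleyn_transfer:
  assumes "torus_graph G" "torus_graph H" "orientation H L"
    and G: "first_return (face_succ G) (darts_of G) T i r g"
    and H: "first_return (face_succ H) (darts_of H) T j s g"
    and b: "\<And>v. b v * b v = (1 :: int)" and c: "\<And>v. c v * c v = (1 :: int)"
    and weights: "\<And>t. t \<in> T \<Longrightarrow> 
      prod_list (map (\<lambda>d. dart_sign K d * b (tail (dg G) d) * b (head (dg G) d)) (r t)) =
      prod_list (map (\<lambda>d. dart_sign L d * c (tail (dg H) d) * c (head (dg H) d)) (s t))"
    and cover: "\<And>d. d \<in> darts_of H \<Longrightarrow> d \<in> I \<or> (\<exists>t\<in>T. d \<in> set (s t))"
    and inner: "\<And>d. d \<in> I \<Longrightarrow> prod (dart_sign L) (orbit (face_succ H) d) = - 1"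
    and K: "kasteleyn G K"
  shows "kasteleyn H L"
proof -
  interpret G: torus_graph G by fact
  interpret H: torus_graph H by fact
  interpret rG: first_return "face_succ G" "darts_of G" T i r g by fact
  interpret rH: first_return "face_succ H" "darts_of H" T j s g by fact
  have "prod (dart_sign L) (orbit (face_succ H) d) = - 1" if d: "d \<in> darts_of H" for d
  proof (cases "d \<in> I")
    case True
    then show ?thesis by (rule inner)
  next
    case False
    then obtain t where t: "t \<in> T" "d \<in> set (s t)" using cover d by blast
    have "orbit (face_succ H) d = orbit (face_succ H) (j t)"
      using rH.set_s_subset_orbit[OF t] rH.permutation_f
      by (metis orbit_cyclic_eq3 cyclic_on_orbit')
    then have "prod (dart_sign L) (orbit (face_succ H) d) =
        prod (dart_sign L) (orbit (face_succ H) (j t))" by simp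
    also have "\<dots> = (\<Prod>d\<in>orbit (face_succ H) (j t).
        dart_sign L d * c (tail (dg H) d) * c (head (dg H) d))"
      by (rule H.prod_gauge_orbit[symmetric]) (use rH.j_in t c in auto)
    also have "\<dots> = (\<Prod>d\<in>orbit (face_succ G) (i t).
        dart_sign K d * b (tail (dg G) d) * b (head (dg G) d))"
      unfolding rH.prod_orbit[OF t(1)] rG.prod_orbit[OF t(1)]
      using permutes_orbit_subset[OF rG.g_permutes t(1)] weights by (intro prod.cong) auto
    also have "\<dots> = prod (dart_sign K) (orbit (face_succ G) (i t))"
      by (rule G.prod_gauge_orbit) (use rG.j_in t b in auto)
    also have "\<dots> = - 1"
      using K rG.j_in[OF t(1)] by (auto simp: G.kasteleyn_iff)
    finally show ?thesis .
  qed
  then show ?thesis using \<open>orientation H L\<close> by (simp add: H.kasteleyn_iff)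
qed

section \<open>Counterclockwise orders\<close>

lemma ccw_set: "ccw G v ds \<Longrightarrow> set ds = {d \<in> darts_of G. tail (dg G) d = v}"
  unfolding ccw_def out_arcs_def by blast

lemma ccw_distinct: "ccw G v ds \<Longrightarrow> distinct ds"
  unfolding ccw_def by blast

lemma ccw_vertex: "ccw G v ds \<Longrightarrow> v \<in> verts_of G"
  unfolding ccw_def by blast

lemma split_before_last:
  assumes "x \<in> set zs" "x \<noteq> last zs"
  obtains as b bs where "zs = as @ x # b # bs"
proof -
  obtain as cs where "zs = as @ x # cs" using assms(1) by (meson split_list)
  with assms(2) that show thesis by (cases cs) auto
qed


lemma rot_ccw_step: "ccw G v (xs @ d # d' # ys) \<Longrightarrow> rot G d = d'"
  unfolding ccw_def
  by (elim conjE allE[where x = "length xs"]) (auto simp: nth_append)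

lemma rot_ccw_last: "ccw G v (xs @ [d]) \<Longrightarrow> rot G d = hd (xs @ [d])"
  unfolding ccw_def
  by (elim conjE allE[where x = "length xs"]) (auto simp: nth_append hd_conv_nth)

text \<open>At a vertex on the boundary of the disk, let \<open>D\<close> list the darts outside the disk, \<open>P\<close> and
  \<open>Q\<close> those inside it before and after the move. A face that turns at the vertex, coming from
  outside or from the last dart inside, goes on to the same dart outside in both graphs or enters the
  disk in both; this includes the case that \<open>D\<close> is empty.\<close>

lemma rot_ccw_replace_prefix:
  assumes G: "ccw G v (P @ D)" and H: "ccw H w (Q @ D)" and "P \<noteq> []" "Q \<noteq> []"
    and d: "d = last P \<and> d' = last Q \<or> d = d' \<and> d \<in> set D"
  shows "rot G d = hd P \<and> rot H d' = hd Q \<or> rot G d = rot H d' \<and> rot G d \<in> set D"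
proof -
  obtain ps qs where PQ: "P = ps @ [last P]" "Q = qs @ [last Q]"
    using assms by (metis append_butlast_last_id)
  obtain xs ys ds where split: "P @ D = xs @ d # ds" "Q @ D = ys @ d' # ds" "set ds \<subseteq> set D"
    using d
  proof
    assume "d = last P \<and> d' = last Q"
    then show thesis using that[of ps D qs] PQ by (metis append.assoc append_Cons append_Nil order_refl)
  next
    assume "d = d' \<and> d \<in> set D"
    then obtain D1 D2 where "D = D1 @ d # D2" "d = d'" by (meson split_list)
    then show thesis using that[of "P @ D1" D2 "Q @ D1"] by auto
  qed
  show ?thesis
  proof (cases ds)
    case Nil
    then show ?thesis
      using rot_ccw_last[of G v xs d] rot_ccw_last[of H w ys d'] G H split assms(3,4)
      by (metis hd_append2)
  next
    case (Cons b bs)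
    then show ?thesis
      using rot_ccw_step[of G v xs d b bs] rot_ccw_step[of H w ys d' b bs] G H split by auto
  qed
qed

section \<open>Matrix entries\<close>

definition dart_entry :: "('v, 'd) emb_graph \<Rightarrow> 'd set \<Rightarrow> 'd \<Rightarrow> laurent2" where
  "dart_entry G K d =
    Poly_Mapping.single (crossing G d) (- of_int (dart_sign K d) * wt G d)"

definition dart_matrix :: "('v, 'd) emb_graph \<Rightarrow> 'd set \<Rightarrow> 'd set \<Rightarrow> 'v \<Rightarrow> 'v \<Rightarrow> laurent2" where
  "dart_matrix G K D u v =
    (\<Sum>d\<in>D. if tail (dg G) d = u \<and> head (dg G) d = v then dart_entry G K d else 0)"

lemma kasteleyn_matrix_eq_dart_matrix:
  assumes "finite (darts_of G)"
  shows "kasteleyn_matrix G K u v = dart_matrix G K (darts_of G) u v"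
  unfolding kasteleyn_matrix_def dart_matrix_def dart_entry_def dart_sign_def using assms
  by (subst sum.inter_filter[symmetric]) (auto intro!: sum.cong)

lemma dart_matrix_Un:
  "finite D \<Longrightarrow> finite E \<Longrightarrow> D \<inter> E = {} \<Longrightarrow>
    dart_matrix G K (D \<union> E) u v = dart_matrix G K D u v + dart_matrix G K E u v"
  unfolding dart_matrix_def by (rule sum.union_disjoint)

lemma dart_matrix_insert:
  "finite D \<Longrightarrow> d \<notin> D \<Longrightarrow> dart_matrix G K (insert d D) u v =
    (if tail (dg G) d = u \<and> head (dg G) d = v then dart_entry G K d else 0) + dart_matrix G K D u v"
  unfolding dart_matrix_def by (rule sum.insert)

lemma (in torus_graph) charpoly_eq_det_on:
  "charpoly G K = det_on (verts_of G) (dart_matrix G K (darts_of G))"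
  unfolding charpoly_def det_on_def by (simp add: kasteleyn_matrix_eq_dart_matrix)

lemma dart_matrix_empty: "dart_matrix G K {} u v = 0"
  unfolding dart_matrix_def by simp

section \<open>Expansion of a vertex\<close>

text \<open>\<open>G\<close> is the graph with the vertex \<open>v\<close>, \<open>H\<close> that with the path \<open>v\<^sub>1 v\<^sub>2 v\<^sub>3\<close>.\<close>

locale vertex_expansion =
  G: torus_graph G + H: torus_graph H
  for G H :: "('v, 'd) emb_graph" +
  fixes v v\<^sub>1 v\<^sub>2 v\<^sub>3 :: 'v and p q :: 'd and xs ys :: "'d list" and t :: "'v \<Rightarrow> int \<times> int"
  assumes distinct_path: "distinct [v\<^sub>1, v\<^sub>2, v\<^sub>3]"
    and path_new: "{v\<^sub>1, v\<^sub>2, v\<^sub>3} \<inter> (verts_of G - {v}) = {}"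
    and verts_H: "verts_of H = (verts_of G - {v}) \<union> {v\<^sub>1, v\<^sub>2, v\<^sub>3}"
    and new_darts: "{p, opp H p, q, opp H q} \<inter> darts_of G = {}"
    and darts_H: "darts_of H = darts_of G \<union> {p, opp H p, q, opp H q}"
    and link_p: "link H p v\<^sub>1 v\<^sub>2 1" and link_q: "link H q v\<^sub>2 v\<^sub>3 1"
    and ccw_v: "ccw G v (xs @ ys)"
    and ccw_v1: "ccw H v\<^sub>1 (xs @ [p])" and ccw_v2: "ccw H v\<^sub>2 [opp H p, q]"
    and ccw_v3: "ccw H v\<^sub>3 (ys @ [opp H q])"
    and same: "\<And>d. d \<in> darts_of G \<Longrightarrow> opp H d = opp G d \<and> wt H d = wt G d \<and>
        (tail (dg G) d \<noteq> v \<longrightarrow>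
          tail (dg H) d = tail (dg G) d \<and> rot H d = rot G d)"
    and crossing_H: "\<And>d. d \<in> darts_of G \<Longrightarrow>
        crossing H d = crossing G d + t (head (dg H) d) - t (tail (dg H) d)"
    and crossing_p: "crossing H p = t v\<^sub>2 - t v\<^sub>1" and crossing_q: "crossing H q = t v\<^sub>3 - t v\<^sub>2"
begin

lemma dart_ends:
  "p \<in> darts_of H" "q \<in> darts_of H" "tail (dg H) p = v\<^sub>1" "head (dg H) p = v\<^sub>2"
  "tail (dg H) q = v\<^sub>2" "head (dg H) q = v\<^sub>3" "wt H p = 1" "wt H q = 1"
  using link_p link_q by (auto simp: link_def)

lemma distinct_new: "distinct [p, opp H p, q, opp H q]"
proof -
  have "tail (dg H) (opp H p) = v\<^sub>2" "tail (dg H) (opp H q) = v\<^sub>3" "opp H p \<noteq> q"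
    using dart_ends ccw_distinct[OF ccw_v2] by auto
  moreover from this have "p \<noteq> opp H p" "p \<noteq> q" "p \<noteq> opp H q" "opp H p \<noteq> opp H q" "q \<noteq> opp H q"
    using dart_ends distinct_path by (metis distinct_length_2_or_more)+
  ultimately show ?thesis by simp
qed

lemma v_in: "v \<in> verts_of G"
  by (rule ccw_vertex[OF ccw_v])

lemma out_v: "set xs \<union> set ys = {d \<in> darts_of G. tail (dg G) d = v}"
  using ccw_set[OF ccw_v] by simp

lemma tail_cases:
  assumes d: "d \<in> darts_of G"
  shows "tail (dg G) d = v \<and> tail (dg H) d \<in> {v\<^sub>1, v\<^sub>3} \<or>
    tail (dg G) d \<noteq> v \<and> tail (dg H) d = tail (dg G) d \<and> tail (dg H) d \<notin> {v\<^sub>1, v\<^sub>2, v\<^sub>3}"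
proof (cases "tail (dg G) d = v")
  case True
  then have "d \<in> set xs \<union> set ys" using d out_v by blast
  moreover have "set (xs @ [p]) \<subseteq> {d. tail (dg H) d = v\<^sub>1}"
    "set (ys @ [opp H q]) \<subseteq> {d. tail (dg H) d = v\<^sub>3}"
    using ccw_set[OF ccw_v1] ccw_set[OF ccw_v3] by blast+
  ultimately show ?thesis using True by auto
next
  case False
  then show ?thesis using same[OF d] path_new G.tail_in_verts[OF d] by auto
qed

lemma tail_G:
  assumes "d \<in> darts_of G" "x \<in> verts_of G"
  shows "tail (dg G) d = x \<longleftrightarrow>
    (if x = v then tail (dg H) d = v\<^sub>1 \<or> tail (dg H) d = v\<^sub>3 else tail (dg H) d = x)"
proof -
  have "x \<noteq> v \<Longrightarrow> x \<notin> {v\<^sub>1, v\<^sub>2, v\<^sub>3}" using assms path_new by blast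
  then show ?thesis using tail_cases[OF assms(1)] by (cases "x = v") auto
qed

lemma tail_not_v2: "d \<in> darts_of G \<Longrightarrow> tail (dg H) d \<noteq> v\<^sub>2"
  using tail_cases[of d] distinct_path by auto

lemma head_conv: "d \<in> darts_of G \<Longrightarrow> head (dg G) d = tail (dg G) (opp G d)"
    "d \<in> darts_of G \<Longrightarrow> head (dg H) d = tail (dg H) (opp G d)"
  using same[of d] darts_H H.tail_arev[of d] by auto

lemma head_G:
  assumes "d \<in> darts_of G" "x \<in> verts_of G"
  shows "head (dg G) d = x \<longleftrightarrow>
    (if x = v then head (dg H) d = v\<^sub>1 \<or> head (dg H) d = v\<^sub>3 else head (dg H) d = x)"
  using tail_G[of "opp G d" x] assms by (simp only: head_conv[symmetric] G.arev_in_arcs)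

lemma head_not_v2: "d \<in> darts_of G \<Longrightarrow> head (dg H) d \<noteq> v\<^sub>2"
  using tail_not_v2[of "opp G d"] by (metis head_conv(2) G.arev_in_arcs)

text \<open>The path \<open>v\<^sub>1 v\<^sub>2 v\<^sub>3\<close> is passed by the faces between the last edge of one of the
  two bundles and the first edge of the other; if this bundle is empty, then the face runs back
  along the path at once.\<close>

definition excursion :: "'d \<Rightarrow> 'd list" where
  "excursion d =
    (if xs \<noteq> [] \<and> opp G d = last xs then [p, q] @ (if ys = [] then [opp H q, opp H p] else [])
     else if ys \<noteq> [] \<and> opp G d = last ys then [opp H q, opp H p] @ (if xs = [] then [p, q] else [])
     else [])"

text \<open>An isolated vertex could not be matched.\<close>

lemma bundles_nonempty: "xs \<noteq> [] \<or> ys \<noteq> []"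
proof -
  obtain d where "d \<in> darts_of G" "tail (dg G) d = v"
    using G.perfect_matching v_in by blast
  then show ?thesis using out_v by auto
qed

lemma rot_path: "rot H (opp H p) = q" "rot H q = opp H p"
    "rot H p = hd (xs @ [p])" "rot H (opp H q) = hd (ys @ [opp H q])"
  using rot_ccw_step[of H v\<^sub>2 "[]"] rot_ccw_last[of H v\<^sub>2 "[opp H p]"] ccw_v2
    rot_ccw_last[OF ccw_v1] rot_ccw_last[OF ccw_v3] by auto

lemma excursion_steps:
  assumes d: "d \<in> darts_of G"
  shows "successively (\<lambda>x y. face_succ H x = y) (d # excursion d)"
    and "face_succ H (last (d # excursion d)) = face_succ G d"
proof -
  let ?o = "opp G d"
  have o: "?o \<in> darts_of G" using d by simp
  have succ_d: "face_succ H d = rot H ?o" using same d by (simp add: face_succ_def)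
  have dist: "set xs \<inter> set ys = {}" using ccw_distinct[OF ccw_v] by simp
  have xs: "rot G (last xs) = hd (ys @ xs)" "rot H (last xs) = p" if "xs \<noteq> []"
  proof -
    obtain as a where as: "xs = as @ [a]" using \<open>xs \<noteq> []\<close> by (metis append_butlast_last_id)
    show "rot H (last xs) = p"
      using rot_ccw_step[of H v\<^sub>1 as a p "[]"] ccw_v1 as by simp
    show "rot G (last xs) = hd (ys @ xs)"
      using rot_ccw_step[of G v as a "hd ys" "tl ys"] rot_ccw_last[of G v as a] ccw_v as
      by (cases ys) auto
  qed
  have ys: "rot G (last ys) = hd (xs @ ys)" "rot H (last ys) = opp H q" if "ys \<noteq> []"
  proof -
    obtain as a where as: "ys = as @ [a]" using \<open>ys \<noteq> []\<close> by (metis append_butlast_last_id)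
    show "rot H (last ys) = opp H q"
      using rot_ccw_step[of H v\<^sub>3 as a "opp H q" "[]"] ccw_v3 as by simp
    show "rot G (last ys) = hd (xs @ ys)"
      using rot_ccw_last[of G v "xs @ as" a] ccw_v as by simp
  qed
  have other: "rot H ?o = rot G ?o" if not_last: "\<not> (xs \<noteq> [] \<and> ?o = last xs)" "\<not> (ys \<noteq> [] \<and> ?o = last ys)"
  proof (cases "tail (dg G) ?o = v")
    case True
    then consider "?o \<in> set xs" | "?o \<in> set ys" using o out_v by blast
    then show ?thesis
    proof cases
      case 1
      then have "xs \<noteq> []" by auto
      with not_last have "?o \<noteq> last xs" by simp
      with \<open>?o \<in> set xs\<close> obtain as b bs where "xs = as @ ?o # b # bs"
        by (rule split_before_last)
      then show ?thesis
        using rot_ccw_step[of G v as ?o b "bs @ ys"] rot_ccw_step[of H v\<^sub>1 as ?o b "bs @ [p]"]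
          ccw_v ccw_v1 by simp
    next
      case 2
      then have "ys \<noteq> []" by auto
      with not_last have "?o \<noteq> last ys" by simp
      with \<open>?o \<in> set ys\<close> obtain as b bs where "ys = as @ ?o # b # bs"
        by (rule split_before_last)
      then show ?thesis
        using rot_ccw_step[of G v "xs @ as" ?o b bs] rot_ccw_step[of H v\<^sub>3 as ?o b "bs @ [opp H q]"]
          ccw_v ccw_v3 by simp
    qed
  qed (use same[OF o] in simp)
  have last: "last xs \<noteq> last ys" if "xs \<noteq> []" "ys \<noteq> []"
    using dist that by (metis disjoint_iff last_in_set)
  have path: "face_succ H p = q" "face_succ H q = hd (ys @ [opp H q])"
      "face_succ H (opp H q) = opp H p" "face_succ H (opp H p) = hd (xs @ [p])"
    using rot_path by (simp_all add: face_succ_def)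
  show "successively (\<lambda>x y. face_succ H x = y) (d # excursion d)"
    using xs ys succ_d path by (auto simp: excursion_def)
  show "face_succ H (last (d # excursion d)) = face_succ G d"
  proof (cases "(xs \<noteq> [] \<and> ?o = last xs) \<or> (ys \<noteq> [] \<and> ?o = last ys)")
    case True
    then show ?thesis using xs ys last path succ_d
      by (auto simp: excursion_def face_succ_def[of G] hd_append)
  next
    case False
    then show ?thesis using other succ_d by (auto simp: excursion_def face_succ_def[of G])
  qed
qed

lemma first_return_G:
  "first_return (face_succ G) (darts_of G) (darts_of G) id (\<lambda>d. [d]) (face_succ G)"
proof
qed (simp_all add: G.face_succ_permutes G.face_succ_outside)

lemma first_return_H:
  "first_return (face_succ H) (darts_of H) (darts_of G) id (\<lambda>d. d # excursion d) (face_succ G)"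
proof
  show "set (tl (d # excursion d)) \<inter> id ` darts_of G = {}" if "d \<in> darts_of G" for d
    using new_darts by (auto simp: excursion_def)
  show "successively (\<lambda>x y. face_succ H x = y) (d # excursion d)"
    "face_succ H (last (d # excursion d)) = id (face_succ G d)" if "d \<in> darts_of G" for d
    using excursion_steps[OF that] by simp_all
qed (use H.face_succ_permutes darts_H in \<open>simp_all add: G.face_succ_outside\<close>)

lemma cover_H:
  assumes "d \<in> darts_of H"
  shows "\<exists>e\<in>darts_of G. d \<in> set (e # excursion e)"
proof (cases "d \<in> darts_of G")
  case False
  have out: "set xs \<union> set ys \<subseteq> darts_of G" using out_v by blast
  have ends: "opp G (last xs) \<in> darts_of G" if "xs \<noteq> []"
    using that out last_in_set[of xs] G.arev_in_arcs by blast
  have ends': "opp G (last ys) \<in> darts_of G" if "ys \<noteq> []"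
    using that out last_in_set[of ys] G.arev_in_arcs by blast
  have last: "last xs \<noteq> last ys" if "xs \<noteq> []" "ys \<noteq> []"
    using ccw_distinct[OF ccw_v] that by (metis disjoint_iff distinct_append last_in_set)
  have d: "d \<in> {p, opp H p, q, opp H q}" using False assms darts_H by auto
  show ?thesis
  proof (cases "xs \<noteq> [] \<and> (ys = [] \<or> d \<in> {p, q})")
    case True
    then have "d \<in> set (excursion (opp G (last xs)))" using d by (auto simp: excursion_def)
    then show ?thesis using ends True by (auto intro: bexI[of _ "opp G (last xs)"])
  next
    case False
    then have "ys \<noteq> []" "xs = [] \<or> d \<in> {opp H q, opp H p}"
      using d bundles_nonempty by auto
    then have "d \<in> set (excursion (opp G (last ys)))"
      using d last by (auto simp: excursion_def)
    then show ?thesis using ends'[OF \<open>ys \<noteq> []\<close>] by (auto intro: bexI[of _ "opp G (last ys)"])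
  qed
qed (auto intro: bexI[of _ d])

text \<open>The edges at the vertices with \<open>c x = - 1\<close> are reversed. By the last assumption this turns
  \<open>v\<^sub>1 v\<^sub>2 v\<^sub>3\<close> into a directed path, so that walking along it contributes the sign \<open>1\<close> in
  either direction.\<close>

lemma kasteleyn_iff_expanded:
  assumes or: "orientation G K" "orientation H L"
    and c: "\<And>x. c x * c x = (1 :: int)"
    and old: "\<And>d. d \<in> darts_of G \<Longrightarrow>
      dart_sign L d = dart_sign K d * c (tail (dg H) d) * c (head (dg H) d)"
    and path: "dart_sign L p * dart_sign L q = c v\<^sub>1 * c v\<^sub>3"
  shows "kasteleyn G K \<longleftrightarrow> kasteleyn H L"
proof -
  let ?w = "\<lambda>d. dart_sign L d * c (tail (dg H) d) * c (head (dg H) d)"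
  have cc: "c x * (c x * i) = i" for x i
    using c[of x] by (simp add: mult.assoc[symmetric])
  have old': "?w d = dart_sign K d" if "d \<in> darts_of G" for d
    by (simp add: old that c cc mult_ac)
  have "?w p * ?w q = (dart_sign L p * dart_sign L q) * (c v\<^sub>1 * c v\<^sub>3)"
    using dart_ends by (simp add: cc mult_ac)
  also have "\<dots> = 1"
    using path c[of v\<^sub>1] c[of v\<^sub>3] by (simp add: cc mult_ac)
  finally have pq: "?w p * ?w q = 1" .
  have "?w (opp H p) = - ?w p" "?w (opp H q) = - ?w q"
    using dart_ends by (simp_all add: orientation_opp[OF or(2)])
  then have qp: "?w (opp H q) * ?w (opp H p) = 1"
    using pq by (simp add: mult.commute)
  have weights: "prod_list (map ?w (d # excursion d)) = dart_sign K d" if "d \<in> darts_of G" for d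
    using pq qp old'[OF that] by (auto simp: excursion_def mult.assoc)
  show ?thesis
  proof
    assume K: "kasteleyn G K"
    show "kasteleyn H L"
      by (rule kasteleyn_transfer[where b = "\<lambda>_. 1" and c = c and I = "{}" and K = K,
            OF G.torus_graph_axioms H.torus_graph_axioms or(2) first_return_G first_return_H])
        (use weights cover_H K c in simp_all)
  next
    assume L: "kasteleyn H L"
    show "kasteleyn G K"
      by (rule kasteleyn_transfer[where b = c and c = "\<lambda>_. 1" and I = "{}" and K = L,
            OF H.torus_graph_axioms G.torus_graph_axioms or(1) first_return_H first_return_G])
        (use weights L c in auto)
  qed
qed

text \<open>\<open>N\<close> is the matrix of \<open>H\<close> after undoing the shifts \<open>t\<close> and the reversals \<open>c\<close>. Its entries
  at \<open>v\<^sub>2\<close> are \<open>- s\<close> towards \<open>v\<^sub>1\<close> and \<open>s\<close> towards \<open>v\<^sub>3\<close>, where \<open>s = \<plusminus>1\<close>. Adding the row and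
  column of \<open>v\<^sub>1\<close> to those of \<open>v\<^sub>3\<close> gives the matrix \<open>P\<close>, in which \<open>v\<^sub>2\<close> is joined to \<open>v\<^sub>1\<close> only and
  \<open>v\<^sub>3\<close> has all the neighbours that \<open>v\<close> has in \<open>G\<close>.\<close>

lemma charpoly_expanded:
  assumes or: "orientation H L"
    and c: "\<And>x. c x * c x = (1 :: int)"
    and old: "\<And>d. d \<in> darts_of G \<Longrightarrow>
      dart_sign L d = dart_sign K d * c (tail (dg H) d) * c (head (dg H) d)"
    and path: "dart_sign L p * dart_sign L q = c v\<^sub>1 * c v\<^sub>3"
  shows "charpoly H L = charpoly G K"
proof -
  define m where "m x = (Poly_Mapping.single (t x) (of_int (c x)) :: laurent2)" for x
  define m' where "m' x = (Poly_Mapping.single (- t x) (of_int (c x)) :: laurent2)" for x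
  define s where "s = (Poly_Mapping.single 0 (- of_int (dart_sign L p * c v\<^sub>1 * c v\<^sub>2)) :: laurent2)"
  define N0 where "N0 x y = (\<Sum>d\<in>darts_of G.
    if tail (dg H) d = x \<and> head (dg H) d = y then dart_entry G K d else 0)" for x y
  define N where "N x y = N0 x y + (if x = v\<^sub>1 \<and> y = v\<^sub>2 then s else 0)
    + (if x = v\<^sub>2 \<and> y = v\<^sub>1 then - s else 0) + (if x = v\<^sub>2 \<and> y = v\<^sub>3 then s else 0)
    + (if x = v\<^sub>3 \<and> y = v\<^sub>2 then - s else 0)" for x y
  define P where "P x y =
    (let R = N(v\<^sub>3 := \<lambda>y. N v\<^sub>3 y + N v\<^sub>1 y) in if y = v\<^sub>3 then R x v\<^sub>3 + R x v\<^sub>1 else R x y)" for x y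
  have cc: "c x * (c x * i) = i" for x i
    using c[of x] by (simp add: mult.assoc[symmetric])
  have c_real: "real_of_int (c x) * real_of_int (c x) = 1" for x
    using c[of x] by (metis of_int_1 of_int_mult)
  have cc_real: "real_of_int (c x) * (real_of_int (c x) * r) = r" for x r
    using c_real[of x] by (simp add: mult.assoc[symmetric])
  have sign_real: "real_of_int (dart_sign A d) * (real_of_int (dart_sign A d) * r) = r" for A d r
    by (simp add: dart_sign_def)
  have mm: "m' x * m x = 1" for x
    by (simp add: m_def m'_def mult_single c_real)
  have ss: "s * s = 1"
    by (simp add: s_def mult_single cc_real c_real sign_real mult_ac)
      (simp add: dart_sign_def)
  have "dart_sign L q = dart_sign L p * (dart_sign L p * dart_sign L q)"
    by (simp add: dart_sign_def)
  then have q_sign: "dart_sign L q = dart_sign L p * c v\<^sub>1 * c v\<^sub>3"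
    by (simp add: path mult_ac)
  have entries: "dart_entry H L p = m' v\<^sub>1 * s * m v\<^sub>2" "dart_entry H L (opp H p) = m' v\<^sub>2 * (- s) * m v\<^sub>1"
    "dart_entry H L q = m' v\<^sub>2 * s * m v\<^sub>3" "dart_entry H L (opp H q) = m' v\<^sub>3 * (- s) * m v\<^sub>2"
    by (simp_all add: dart_entry_def m_def m'_def s_def mult_single crossing_p crossing_q
        H.crossing_opp orientation_opp[OF or] dart_ends H.wt_opp cc_real q_sign single_uminus mult_ac)
  have entry_old: "dart_entry H L d = m' (tail (dg H) d) * dart_entry G K d * m (head (dg H) d)"
    if "d \<in> darts_of G" for d
    by (simp add: dart_entry_def m_def m'_def mult_single crossing_H[OF that] old[OF that]
        same[OF that] add_ac diff_conv_add_uminus mult_ac del: add_uminus_conv_diff)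
  have matrix_H: "dart_matrix H L (darts_of H) x y = m' x * N x y * m y" for x y
  proof -
    have "dart_matrix H L (darts_of G) x y = m' x * N0 x y * m y"
      unfolding dart_matrix_def N0_def sum_distrib_left sum_distrib_right
      by (rule sum.cong) (auto simp: entry_old)
    moreover have "dart_matrix H L (darts_of H) x y = dart_matrix H L (darts_of G) x y +
        dart_matrix H L {p, opp H p, q, opp H q} x y"
      unfolding darts_H by (rule dart_matrix_Un) (use new_darts in auto)
    moreover have "dart_matrix H L {p, opp H p, q, opp H q} x y =
        m' x * (if x = v\<^sub>1 \<and> y = v\<^sub>2 then s else 0) * m y +
        (m' x * (if x = v\<^sub>2 \<and> y = v\<^sub>1 then - s else 0) * m y +
        (m' x * (if x = v\<^sub>2 \<and> y = v\<^sub>3 then s else 0) * m y +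
        m' x * (if x = v\<^sub>3 \<and> y = v\<^sub>2 then - s else 0) * m y))"
    proof -
      have "dart_matrix H L {p, opp H p, q, opp H q} x y =
        (if v\<^sub>1 = x \<and> v\<^sub>2 = y then dart_entry H L p else 0) +
        ((if v\<^sub>2 = x \<and> v\<^sub>1 = y then dart_entry H L (opp H p) else 0) +
        ((if v\<^sub>2 = x \<and> v\<^sub>3 = y then dart_entry H L q else 0) +
        (if v\<^sub>3 = x \<and> v\<^sub>2 = y then dart_entry H L (opp H q) else 0)))"
        using distinct_new by (simp add: dart_matrix_insert dart_matrix_empty dart_ends)
      then show ?thesis
        unfolding entries by (simp only:) (intro arg_cong2[where f = "(+)"]; auto)
    qed
    ultimately show ?thesis by (simp only: N_def distrib_left distrib_right add.assoc)
  qed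
  have N0_path: "N0 v\<^sub>2 y = 0" "N0 x v\<^sub>2 = 0" for x y
    using tail_not_v2 head_not_v2 by (auto simp: N0_def intro!: sum.neutral)
  have in_H: "v\<^sub>1 \<in> verts_of H" "v\<^sub>2 \<in> verts_of H" "v\<^sub>3 \<in> verts_of H"
    using verts_H by auto
  have "charpoly H L = det_on (verts_of H) N"
    unfolding H.charpoly_eq_det_on matrix_H by (simp add: det_on_scale_rows_columns mm)
  also have "\<dots> = det_on (verts_of H) P"
  proof -
    have "det_on (verts_of H) P = (1 * 1 - 1 * 0) * (1 * 1 - 1 * 0) * det_on (verts_of H) N"
      by (rule det_on_combine_two_rows_columns[where i = "v\<^sub>3" and j = "v\<^sub>1"])
        (use in_H distinct_path in \<open>auto simp: P_def Let_def\<close>)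
    then show ?thesis by simp
  qed
  also have "\<dots> = - (P v\<^sub>2 v\<^sub>1 * P v\<^sub>1 v\<^sub>2) * det_on (verts_of H - {v\<^sub>2, v\<^sub>1}) P"
    by (rule det_on_remove_pair)
      (use in_H distinct_path in \<open>auto simp: P_def N_def N0_path Let_def\<close>)
  also have "- (P v\<^sub>2 v\<^sub>1 * P v\<^sub>1 v\<^sub>2) = 1"
    using distinct_path by (auto simp: P_def N_def N0_path Let_def ss)
  also have "verts_of H - {v\<^sub>2, v\<^sub>1} = (\<lambda>x. if x = v then v\<^sub>3 else x) ` verts_of G"
    using verts_H path_new distinct_path v_in by auto
  also have "det_on \<dots> P =
      det_on (verts_of G) (\<lambda>x y. P (if x = v then v\<^sub>3 else x) (if y = v then v\<^sub>3 else y))"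
    by (rule det_on_reindex) (use path_new in \<open>auto simp: inj_on_def split: if_splits\<close>)
  also have "\<dots> = charpoly G K"
    unfolding G.charpoly_eq_det_on
  proof (rule det_on_cong)
    fix x y assume xy: "x \<in> verts_of G" "y \<in> verts_of G"
    let ?f = "\<lambda>x. if x = v then v\<^sub>3 else x"
    have "P (?f x) (?f y) =
      (N0 (?f x) (?f y) + (if x = v then N0 v\<^sub>1 (?f y) else 0)) +
      (if y = v then N0 (?f x) v\<^sub>1 + (if x = v then N0 v\<^sub>1 v\<^sub>1 else 0) else 0)"
    proof -
      have "x \<noteq> v \<Longrightarrow> x \<noteq> v\<^sub>1 \<and> x \<noteq> v\<^sub>2 \<and> x \<noteq> v\<^sub>3" "y \<noteq> v \<Longrightarrow> y \<noteq> v\<^sub>1 \<and> y \<noteq> v\<^sub>2 \<and> y \<noteq> v\<^sub>3"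
        using xy path_new by auto
      then show ?thesis
        using distinct_path by (cases "x = v"; cases "y = v") (simp_all add: P_def N_def Let_def)
    qed
    also have "\<dots> = dart_matrix G K (darts_of G) x y"
      using xy path_new distinct_path
      unfolding N0_def dart_matrix_def
      by (cases "x = v"; cases "y = v")
        (auto simp: tail_G head_G simp flip: sum.distrib intro!: sum.cong)
    finally show "P (?f x) (?f y) = dart_matrix G K (darts_of G) x y" .
  qed
  finally show ?thesis by simp
qed

lemma transfer_to_expanded:
  assumes K: "kasteleyn G K"
  shows "\<exists>L. kasteleyn H L \<and> orientations_agree G K H L \<and> charpoly H L = charpoly G K"
proof -
  have or: "orientation G K" using K by (simp add: kasteleyn_def)
  \<comment> \<open>Equal signs of \<open>p\<close> and \<open>q\<close> direct the new path.\<close>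
  define \<tau> where "\<tau> d = (if d \<in> darts_of G then dart_sign K d else if d = p \<or> d = q then 1 else - 1)" for d
  obtain L where L: "orientation H L" "\<And>d. d \<in> darts_of H \<Longrightarrow> dart_sign L d = \<tau> d"
  proof (rule orientation_with_signs[of H \<tau>])
    show "\<tau> d = 1 \<or> \<tau> d = - 1" if "d \<in> darts_of H" for d
      by (simp add: \<tau>_def dart_sign_def)
    show "\<tau> (opp H d) = - \<tau> d" if "d \<in> darts_of H" for d
    proof (cases "d \<in> darts_of G")
      case True
      then show ?thesis using same[OF True] orientation_opp[OF or] by (simp add: \<tau>_def)
    next
      case False
      then have "d \<in> {p, opp H p, q, opp H q}" using that darts_H by auto
      then show ?thesis using new_darts distinct_new by (auto simp: \<tau>_def)
    qed
  qed auto
  have old: "dart_sign L d = dart_sign K d" if "d \<in> darts_of G" for d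
    using L(2)[of d] that darts_H by (simp add: \<tau>_def)
  have path: "dart_sign L p * dart_sign L q = 1"
    using L(2) new_darts dart_ends by (simp add: \<tau>_def)
  have "orientations_agree G K H L"
    unfolding orientations_agree_def
  proof (intro exI[of _ "{}"] ballI)
    fix d assume "d \<in> darts_of G \<inter> darts_of H"
    then have "dart_sign L d = dart_sign K d" using old by simp
    then show "((d \<in> L) = (d \<in> K)) = ((tail (dg G) d \<in> {}) = (head (dg G) d \<in> {}))"
      by (simp add: dart_sign_def split: if_splits)
  qed
  moreover have "kasteleyn H L"
    using kasteleyn_iff_expanded[OF or L(1), of "\<lambda>_. 1"] old path K by simp
  moreover have "charpoly H L = charpoly G K"
    by (rule charpoly_expanded[OF L(1), of "\<lambda>_. 1"]) (use old path in simp_all)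
  ultimately show ?thesis by blast
qed

lemma transfer_to_contracted:
  assumes L: "kasteleyn H L"
  shows "\<exists>K. kasteleyn G K \<and> orientations_agree H L G K \<and> charpoly H L = charpoly G K"
proof -
  have or: "orientation H L" using L by (simp add: kasteleyn_def)
  \<comment> \<open>If the path \<open>v\<^sub>1 v\<^sub>2 v\<^sub>3\<close> is not directed, all edges at \<open>v\<^sub>3\<close> are reversed.\<close>
  define c where "c x = (if x = v\<^sub>3 then dart_sign L p * dart_sign L q else 1)" for x
  have c: "c x * c x = 1" for x
    by (simp add: c_def dart_sign_def)
  have cc: "c x * (c x * i) = i" for x i
    using c[of x] by (simp add: mult.assoc[symmetric])
  define \<tau> where "\<tau> d = dart_sign L d * c (tail (dg H) d) * c (head (dg H) d)" for d
  obtain K where K: "orientation G K" "\<And>d. d \<in> darts_of G \<Longrightarrow> dart_sign K d = \<tau> d"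
  proof (rule orientation_with_signs[of G \<tau>])
    show "\<tau> d = 1 \<or> \<tau> d = - 1" if "d \<in> darts_of G" for d
      by (simp add: \<tau>_def c_def dart_sign_def)
    show "\<tau> (opp G d) = - \<tau> d" if "d \<in> darts_of G" for d
      using orientation_opp[OF or, of d] same[OF that] that darts_H
        H.tail_arev[of d] H.head_arev[of d]
      by (simp add: \<tau>_def mult_ac)
  qed auto
  have old: "dart_sign L d = dart_sign K d * c (tail (dg H) d) * c (head (dg H) d)"
    if "d \<in> darts_of G" for d
    using K(2)[OF that] by (simp add: \<tau>_def mult_ac cc c)
  have path: "dart_sign L p * dart_sign L q = c v\<^sub>1 * c v\<^sub>3"
    using distinct_path by (simp add: c_def)
  have "orientations_agree H L G K"
    unfolding orientations_agree_def
  proof (intro exI[of _ "{x. c x = - 1}"] ballI)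
    fix d assume "d \<in> darts_of H \<inter> darts_of G"
    then have "dart_sign L d = dart_sign K d * c (tail (dg H) d) * c (head (dg H) d)"
      using old by simp
    moreover have "c (tail (dg H) d) = 1 \<or> c (tail (dg H) d) = - 1"
      "c (head (dg H) d) = 1 \<or> c (head (dg H) d) = - 1" by (auto simp: c_def dart_sign_def)
    ultimately show "((d \<in> K) = (d \<in> L)) =
        ((tail (dg H) d \<in> {x. c x = - 1}) = (head (dg H) d \<in> {x. c x = - 1}))"
      by (auto simp: dart_sign_def split: if_splits)
  qed
  moreover have "kasteleyn G K"
    using kasteleyn_iff_expanded[OF K(1) or c old path] L by simp
  moreover have "charpoly H L = charpoly G K"
    by (rule charpoly_expanded[OF or c old path])
  ultimately show ?thesis by blast
qed

end

lemma expansion_imp_vertex_expansion: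
  assumes "torus_graph G" "torus_graph H" "expansion G H"
  obtains v v\<^sub>1 v\<^sub>2 v\<^sub>3 p q xs ys t where "vertex_expansion G H v v\<^sub>1 v\<^sub>2 v\<^sub>3 p q xs ys t"
proof -
  show thesis
    using \<open>expansion G H\<close> unfolding expansion_def
  proof (elim exE conjE, goal_cases)
    case (1 v v\<^sub>1 v\<^sub>2 v\<^sub>3 p q xs ys t)
    have "vertex_expansion_axioms G H v v\<^sub>1 v\<^sub>2 v\<^sub>3 p q xs ys t"
      by (rule vertex_expansion_axioms.intro; (rule 1 | erule bspec[rotated], rule 1))
    then show thesis
      using that assms by (simp add: vertex_expansion_def)
  qed
qed

section \<open>The \<open>\<lambda>\<close>-move\<close>

locale lambda_graphs =
  G: torus_graph G + H: torus_graph H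
  for G H :: "('v, 'd) emb_graph" +
  fixes u v\<^sub>1 v\<^sub>2 v\<^sub>3 :: 'v and a b c d :: real and uv\<^sub>1 uv\<^sub>2 uv\<^sub>3 m n :: 'd and D\<^sub>1 D\<^sub>2 D\<^sub>3 :: "'d list"
  assumes distinct_vertices: "distinct [u, v\<^sub>1, v\<^sub>2, v\<^sub>3]"
    and same_vertices: "verts_of G = verts_of H"
    and common_G: "darts_of G \<inter> darts_of H = darts_of G - {m, opp G m}"
    and common_H: "darts_of G \<inter> darts_of H = darts_of H - {n, opp H n}"
    and same: "same_outside G H {v\<^sub>1, v\<^sub>2, v\<^sub>3}"
    and links: "link G uv\<^sub>1 u v\<^sub>1 c" "link G uv\<^sub>2 u v\<^sub>2 b" "link G uv\<^sub>3 u v\<^sub>3 d"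
    and link_m: "link G m v\<^sub>1 v\<^sub>2 a" and link_n: "link H n v\<^sub>1 v\<^sub>3 (a * d / b)"
    and ccw_u: "ccw G u [uv\<^sub>1, uv\<^sub>2, uv\<^sub>3]"
    and ccw_v1: "ccw G v\<^sub>1 ([m, opp G uv\<^sub>1] @ D\<^sub>1)" "ccw H v\<^sub>1 ([opp G uv\<^sub>1, n] @ D\<^sub>1)"
    and ccw_v2: "ccw G v\<^sub>2 ([opp G uv\<^sub>2, opp G m] @ D\<^sub>2)" "ccw H v\<^sub>2 (opp G uv\<^sub>2 # D\<^sub>2)"
    and ccw_v3: "ccw G v\<^sub>3 (opp G uv\<^sub>3 # D\<^sub>3)" "ccw H v\<^sub>3 ([opp H n, opp G uv\<^sub>3] @ D\<^sub>3)"
begin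

definition C :: "'d set" where "C = darts_of G \<inter> darts_of H"

abbreviation "w\<^sub>1 \<equiv> opp G uv\<^sub>1"
abbreviation "w\<^sub>2 \<equiv> opp G uv\<^sub>2"
abbreviation "w\<^sub>3 \<equiv> opp G uv\<^sub>3"

lemma ends:
  "uv\<^sub>1 \<in> darts_of G" "tail (dg G) uv\<^sub>1 = u" "head (dg G) uv\<^sub>1 = v\<^sub>1" "wt G uv\<^sub>1 = c"
  "uv\<^sub>2 \<in> darts_of G" "tail (dg G) uv\<^sub>2 = u" "head (dg G) uv\<^sub>2 = v\<^sub>2" "wt G uv\<^sub>2 = b"
  "uv\<^sub>3 \<in> darts_of G" "tail (dg G) uv\<^sub>3 = u" "head (dg G) uv\<^sub>3 = v\<^sub>3" "wt G uv\<^sub>3 = d"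
  "m \<in> darts_of G" "tail (dg G) m = v\<^sub>1" "head (dg G) m = v\<^sub>2" "wt G m = a"
  "n \<in> darts_of H" "tail (dg H) n = v\<^sub>1" "head (dg H) n = v\<^sub>3" "wt H n = a * d / b"
  using links link_m link_n by (simp_all add: link_def)

lemma vertices_distinct: "u \<noteq> v\<^sub>1" "u \<noteq> v\<^sub>2" "u \<noteq> v\<^sub>3" "v\<^sub>1 \<noteq> v\<^sub>2" "v\<^sub>1 \<noteq> v\<^sub>3" "v\<^sub>2 \<noteq> v\<^sub>3"
  using distinct_vertices by auto

lemmas vertices_distinct' = vertices_distinct vertices_distinct[symmetric]

lemma darts: "darts_of G = C \<union> {m, opp G m}" "m \<notin> C" "opp G m \<notin> C"
    "darts_of H = C \<union> {n, opp H n}" "n \<notin> C" "opp H n \<notin> C"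
  using common_G common_H ends G.arev_in_arcs[of m] H.arev_in_arcs[of n] unfolding C_def by blast+

lemma C_cases: "k \<in> C \<Longrightarrow> k \<in> darts_of G \<and> k \<in> darts_of H"
  by (simp add: C_def)

lemma finite_C: "finite C"
  by (simp add: C_def)

lemma C_opp: "k \<in> C \<Longrightarrow> opp G k \<in> C"
proof -
  assume "k \<in> C"
  then have "k \<in> darts_of G" "k \<noteq> m" "k \<noteq> opp G m" using darts by auto
  then have "opp G k \<in> darts_of G" "opp G k \<noteq> m" "opp G k \<noteq> opp G m"
    by (auto simp: G.arev_eq_iff)
  then show "opp G k \<in> C" using darts by auto
qed

lemma C_same:
  assumes "k \<in> C"
  shows "opp H k = opp G k" "tail (dg H) k = tail (dg G) k" "head (dg H) k = head (dg G) k"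
    "wt H k = wt G k" "crossing H k = crossing G k"
    "tail (dg G) k \<notin> {v\<^sub>1, v\<^sub>2, v\<^sub>3} \<Longrightarrow> rot H k = rot G k"
proof -
  have *: "tail (dg H) k = tail (dg G) k \<and> opp H k = opp G k \<and> wt H k = wt G k \<and>
      crossing H k = crossing G k \<and> (tail (dg G) k \<notin> {v\<^sub>1, v\<^sub>2, v\<^sub>3} \<longrightarrow> rot H k = rot G k)"
    if "k \<in> C" for k
    using same that unfolding same_outside_def C_def by blast
  then show "opp H k = opp G k" "tail (dg H) k = tail (dg G) k"
    "wt H k = wt G k" "crossing H k = crossing G k"
    "tail (dg G) k \<notin> {v\<^sub>1, v\<^sub>2, v\<^sub>3} \<Longrightarrow> rot H k = rot G k" using assms by blast+
  have "head (dg H) k = tail (dg H) (opp H k)" "head (dg G) k = tail (dg G) (opp G k)"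
    using C_cases[OF assms] by simp_all
  then show "head (dg H) k = head (dg G) k"
    using *[OF assms] *[OF C_opp[OF assms]] by simp
qed

lemma uv_in_C: "uv\<^sub>1 \<in> C" "uv\<^sub>2 \<in> C" "uv\<^sub>3 \<in> C" "w\<^sub>1 \<in> C" "w\<^sub>2 \<in> C" "w\<^sub>3 \<in> C"
proof -
  have "k \<in> C" if "k \<in> darts_of G" "tail (dg G) k = u" for k
  proof -
    have "k \<noteq> m" "k \<noteq> opp G m" using that ends vertices_distinct' G.tail_arev[of m] by metis+
    then show ?thesis using darts that by auto
  qed
  then show "uv\<^sub>1 \<in> C" "uv\<^sub>2 \<in> C" "uv\<^sub>3 \<in> C" using ends by auto
  then show "w\<^sub>1 \<in> C" "w\<^sub>2 \<in> C" "w\<^sub>3 \<in> C" by (auto intro: C_opp)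
qed

lemma opp_ends: "tail (dg G) w\<^sub>1 = v\<^sub>1" "tail (dg G) w\<^sub>2 = v\<^sub>2" "tail (dg G) w\<^sub>3 = v\<^sub>3"
  "head (dg G) w\<^sub>1 = u" "head (dg G) w\<^sub>2 = u" "head (dg G) w\<^sub>3 = u"
  "tail (dg G) (opp G m) = v\<^sub>2" "head (dg G) (opp G m) = v\<^sub>1"
  "tail (dg H) (opp H n) = v\<^sub>3" "head (dg H) (opp H n) = v\<^sub>1"
  using ends by simp_all

lemma opp_H: "opp H uv\<^sub>1 = w\<^sub>1" "opp H uv\<^sub>2 = w\<^sub>2" "opp H uv\<^sub>3 = w\<^sub>3"
  "opp H w\<^sub>1 = uv\<^sub>1" "opp H w\<^sub>2 = uv\<^sub>2" "opp H w\<^sub>3 = uv\<^sub>3"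
  using uv_in_C by (simp_all add: C_same)

lemma dart_neq:
  "uv\<^sub>1 \<noteq> uv\<^sub>2" "uv\<^sub>1 \<noteq> uv\<^sub>3" "uv\<^sub>2 \<noteq> uv\<^sub>3" "w\<^sub>1 \<noteq> w\<^sub>2" "w\<^sub>1 \<noteq> w\<^sub>3" "w\<^sub>2 \<noteq> w\<^sub>3"
  "uv\<^sub>1 \<noteq> w\<^sub>1" "uv\<^sub>1 \<noteq> w\<^sub>2" "uv\<^sub>1 \<noteq> w\<^sub>3" "uv\<^sub>2 \<noteq> w\<^sub>1" "uv\<^sub>2 \<noteq> w\<^sub>2" "uv\<^sub>2 \<noteq> w\<^sub>3" "uv\<^sub>3 \<noteq> w\<^sub>1" "uv\<^sub>3 \<noteq> w\<^sub>2" "uv\<^sub>3 \<noteq> w\<^sub>3"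
  "m \<noteq> uv\<^sub>1" "m \<noteq> uv\<^sub>2" "m \<noteq> uv\<^sub>3" "m \<noteq> w\<^sub>1" "m \<noteq> w\<^sub>2" "m \<noteq> w\<^sub>3"
  "opp G m \<noteq> uv\<^sub>1" "opp G m \<noteq> uv\<^sub>2" "opp G m \<noteq> uv\<^sub>3" "opp G m \<noteq> w\<^sub>1" "opp G m \<noteq> w\<^sub>2" "opp G m \<noteq> w\<^sub>3"
  "n \<noteq> uv\<^sub>1" "n \<noteq> uv\<^sub>2" "n \<noteq> uv\<^sub>3" "n \<noteq> w\<^sub>1" "n \<noteq> w\<^sub>2" "n \<noteq> w\<^sub>3"
  "opp H n \<noteq> uv\<^sub>1" "opp H n \<noteq> uv\<^sub>2" "opp H n \<noteq> uv\<^sub>3" "opp H n \<noteq> w\<^sub>1" "opp H n \<noteq> w\<^sub>2" "opp H n \<noteq> w\<^sub>3"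
  "m \<noteq> opp G m" "n \<noteq> opp H n"
  using ends(3,7,11) opp_ends ends(2,6,10,14,18) vertices_distinct' uv_in_C darts by metis+

lemmas dart_neq' = dart_neq dart_neq[symmetric]

lemma rot_triangle:
  "rot G uv\<^sub>1 = uv\<^sub>2" "rot G uv\<^sub>2 = uv\<^sub>3" "rot G uv\<^sub>3 = uv\<^sub>1"
  "rot H uv\<^sub>1 = uv\<^sub>2" "rot H uv\<^sub>2 = uv\<^sub>3" "rot H uv\<^sub>3 = uv\<^sub>1"
  "rot G m = w\<^sub>1" "rot G w\<^sub>2 = opp G m" "rot H w\<^sub>1 = n" "rot H (opp H n) = w\<^sub>3"
proof -
  show *: "rot G uv\<^sub>1 = uv\<^sub>2" "rot G uv\<^sub>2 = uv\<^sub>3" "rot G uv\<^sub>3 = uv\<^sub>1"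
    using rot_ccw_step[of G u "[]" uv\<^sub>1] rot_ccw_step[of G u "[uv\<^sub>1]" uv\<^sub>2]
      rot_ccw_last[of G u "[uv\<^sub>1, uv\<^sub>2]"] ccw_u by auto
  show "rot H uv\<^sub>1 = uv\<^sub>2" "rot H uv\<^sub>2 = uv\<^sub>3" "rot H uv\<^sub>3 = uv\<^sub>1"
    using * C_same(6) uv_in_C ends vertices_distinct' by simp_all
  show "rot G m = w\<^sub>1" "rot G w\<^sub>2 = opp G m" "rot H w\<^sub>1 = n" "rot H (opp H n) = w\<^sub>3"
    using rot_ccw_step[of G v\<^sub>1 "[]" m] ccw_v1 rot_ccw_step[of H v\<^sub>1 "[]" w\<^sub>1]
      rot_ccw_step[of G v\<^sub>2 "[]" w\<^sub>2] ccw_v2 rot_ccw_step[of H v\<^sub>3 "[]" "opp H n"] ccw_v3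
    by auto
qed

lemma triangle_G:
  "orbit (face_succ G) (opp G m) = {opp G m, w\<^sub>1, uv\<^sub>2}"
  "orbit (face_succ G) w\<^sub>1 = {opp G m, w\<^sub>1, uv\<^sub>2}"
  "orbit (face_succ G) uv\<^sub>2 = {opp G m, w\<^sub>1, uv\<^sub>2}"
proof -
  have "face_succ G (opp G m) = w\<^sub>1" "face_succ G w\<^sub>1 = uv\<^sub>2" "face_succ G uv\<^sub>2 = opp G m"
    by (simp_all add: face_succ_def rot_triangle)
  then show "orbit (face_succ G) (opp G m) = {opp G m, w\<^sub>1, uv\<^sub>2}"
    "orbit (face_succ G) w\<^sub>1 = {opp G m, w\<^sub>1, uv\<^sub>2}" "orbit (face_succ G) uv\<^sub>2 = {opp G m, w\<^sub>1, uv\<^sub>2}"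
    by (auto simp: orbit_three_cycle)
qed

lemma triangle_H:
  "orbit (face_succ H) n = {n, w\<^sub>3, uv\<^sub>1}" "orbit (face_succ H) w\<^sub>3 = {n, w\<^sub>3, uv\<^sub>1}"
  "orbit (face_succ H) uv\<^sub>1 = {n, w\<^sub>3, uv\<^sub>1}"
proof -
  have "face_succ H n = w\<^sub>3" "face_succ H w\<^sub>3 = uv\<^sub>1" "face_succ H uv\<^sub>1 = n"
    by (simp_all add: face_succ_def rot_triangle opp_H)
  then show "orbit (face_succ H) n = {n, w\<^sub>3, uv\<^sub>1}" "orbit (face_succ H) w\<^sub>3 = {n, w\<^sub>3, uv\<^sub>1}"
    "orbit (face_succ H) uv\<^sub>1 = {n, w\<^sub>3, uv\<^sub>1}"
    by (auto simp: orbit_three_cycle)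
qed

lemma triangle_sign_G:
  assumes "orientation G K"
  shows "prod (dart_sign K) {opp G m, w\<^sub>1, uv\<^sub>2} = dart_sign K m * dart_sign K uv\<^sub>1 * dart_sign K uv\<^sub>2"
  using assms ends dart_neq by (simp add: orientation_opp)

lemma triangle_sign_H:
  assumes "orientation H L"
  shows "prod (dart_sign L) {n, w\<^sub>3, uv\<^sub>1} = - (dart_sign L n * dart_sign L uv\<^sub>3 * dart_sign L uv\<^sub>1)"
  using orientation_opp[OF assms, of uv\<^sub>3] uv_in_C C_cases dart_neq' by (simp add: opp_H)

lemma crossing_m: "crossing G m = crossing G uv\<^sub>2 - crossing G uv\<^sub>1"
proof -
  have "{opp G m, w\<^sub>1, uv\<^sub>2} \<in> faces G"
    unfolding faces_def using triangle_G(3) ends(5) by (auto simp: face_succ_def intro!: image_eqI)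
  from G.crossing_closed[OF this] show ?thesis
    using ends dart_neq' by (simp add: G.crossing_opp algebra_simps)
qed

lemma crossing_n: "crossing H n = crossing G uv\<^sub>3 - crossing G uv\<^sub>1"
proof -
  have "{n, w\<^sub>3, uv\<^sub>1} \<in> faces H"
    unfolding faces_def using triangle_H(1) ends(17) by (auto simp: face_succ_def intro!: image_eqI)
  from H.crossing_closed[OF this] have "crossing H n + (crossing H w\<^sub>3 + crossing H uv\<^sub>1) = 0"
    using dart_neq' by simp
  moreover have "crossing H w\<^sub>3 = - crossing G uv\<^sub>3" "crossing H uv\<^sub>1 = crossing G uv\<^sub>1"
    using uv_in_C ends by (simp_all add: C_same G.crossing_opp)
  ultimately show ?thesis by (simp add: algebra_simps)
qed

text \<open>Outside the triangles, a face of \<open>G\<close> becomes one of \<open>H\<close> when \<open>v\<^sub>1 v\<^sub>2\<close> is replaced by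
  the path \<open>v\<^sub>1 u v\<^sub>2\<close> and the path \<open>v\<^sub>3 u v\<^sub>1\<close> by \<open>v\<^sub>3 v\<^sub>1\<close>.\<close>

definition T :: "'d set" where "T = darts_of G - {opp G m, w\<^sub>1, uv\<^sub>2, uv\<^sub>1}"

definition start_H :: "'d \<Rightarrow> 'd" where
  "start_H k = (if k = m then w\<^sub>1 else if k = w\<^sub>3 then opp H n else k)"

definition path_G :: "'d \<Rightarrow> 'd list" where "path_G k = (if k = w\<^sub>3 then [w\<^sub>3, uv\<^sub>1] else [k])"

definition path_H :: "'d \<Rightarrow> 'd list" where
  "path_H k = (if k = m then [w\<^sub>1, uv\<^sub>2] else [start_H k])"

definition next_T :: "'d \<Rightarrow> 'd" where
  "next_T k = (if k \<in> T then face_succ G (last (path_G k)) else k)"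

lemma outer_in_T:
  assumes "k \<in> set D\<^sub>1 \<union> set D\<^sub>2 \<union> set D\<^sub>3"
  shows "k \<in> T \<and> start_H k = k"
proof -
  consider "k \<in> set D\<^sub>1" | "k \<in> set D\<^sub>2" | "k \<in> set D\<^sub>3" using assms by blast
  then have "k \<in> darts_of G \<and> k \<notin> {m, opp G m, w\<^sub>1, w\<^sub>3, uv\<^sub>1, uv\<^sub>2}"
  proof cases
    case 1
    then have "k \<in> darts_of G" "tail (dg G) k = v\<^sub>1" "k \<noteq> m" "k \<noteq> w\<^sub>1"
      using ccw_set[OF ccw_v1(1)] ccw_distinct[OF ccw_v1(1)] by auto
    then show ?thesis using ends opp_ends vertices_distinct' by auto
  next
    case 2
    then have "k \<in> darts_of G" "tail (dg G) k = v\<^sub>2" "k \<noteq> opp G m"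
      using ccw_set[OF ccw_v2(1)] ccw_distinct[OF ccw_v2(1)] by auto
    then show ?thesis using ends opp_ends vertices_distinct' by auto
  next
    case 3
    then have "k \<in> darts_of G" "tail (dg G) k = v\<^sub>3" "k \<noteq> w\<^sub>3"
      using ccw_set[OF ccw_v3(1)] ccw_distinct[OF ccw_v3(1)] by auto
    then show ?thesis using ends opp_ends vertices_distinct' by auto
  qed
  then show ?thesis by (auto simp: T_def start_H_def)
qed

lemma next_T:
  assumes "k \<in> T"
  shows "face_succ G (last (path_G k)) \<in> T \<and>
    face_succ H (last (path_H k)) = start_H (face_succ G (last (path_G k)))"
proof -
  have in_T: "m \<in> T" "w\<^sub>2 \<in> T" "w\<^sub>3 \<in> T" "uv\<^sub>3 \<in> T"
    using ends dart_neq' by (auto simp: T_def)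
  have start: "start_H m = w\<^sub>1" "start_H w\<^sub>2 = w\<^sub>2" "start_H w\<^sub>3 = opp H n" "start_H uv\<^sub>3 = uv\<^sub>3"
    using dart_neq' by (auto simp: start_H_def)
  have at_v1: "rot G x \<in> T \<and> rot H y = start_H (rot G x)"
    if "x = w\<^sub>1 \<and> y = n \<or> x = y \<and> x \<in> set D\<^sub>1" for x y
    using rot_ccw_replace_prefix[OF ccw_v1, of x y] that in_T start outer_in_T by auto
  have at_v2: "rot G x \<in> T \<and> rot H y = start_H (rot G x)"
    if "x = opp G m \<and> y = w\<^sub>2 \<or> x = y \<and> x \<in> set D\<^sub>2" for x y
    using rot_ccw_replace_prefix[of G v\<^sub>2 "[w\<^sub>2, opp G m]" D\<^sub>2 H v\<^sub>2 "[w\<^sub>2]" x y] ccw_v2 that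
      in_T start outer_in_T by auto
  have at_v3: "rot G x \<in> T \<and> rot H x = start_H (rot G x)" if "x = w\<^sub>3 \<or> x \<in> set D\<^sub>3" for x
    using rot_ccw_replace_prefix[of G v\<^sub>3 "[w\<^sub>3]" D\<^sub>3 H v\<^sub>3 "[opp H n, w\<^sub>3]" x x] ccw_v3 that
      in_T start outer_in_T by auto
  have k: "k \<in> darts_of G" "k \<noteq> opp G m" "k \<noteq> w\<^sub>1" "k \<noteq> uv\<^sub>2" "k \<noteq> uv\<^sub>1"
    using assms by (auto simp: T_def)
  consider "k = m" | "k = w\<^sub>3" | "k \<in> C" "k \<noteq> m" "k \<noteq> w\<^sub>3" using k darts by auto
  then show ?thesis
  proof cases
    case 1
    then show ?thesis
      using at_v2[of "opp G m" w\<^sub>2] dart_neq' by (simp add: path_G_def path_H_def face_succ_def opp_H)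
  next
    case 2
    then show ?thesis
      using at_v1[of w\<^sub>1 n] dart_neq' by (simp add: path_G_def path_H_def start face_succ_def opp_H)
  next
    case 3
    define x where "x = opp G k"
    have x: "x \<in> C" "x \<noteq> m" "x \<noteq> w\<^sub>1" "x \<noteq> w\<^sub>2" "x \<noteq> opp G m" "x \<noteq> uv\<^sub>1" "x \<noteq> uv\<^sub>3"
      using 3 k C_opp by (auto simp: x_def G.arev_eq_iff)
    have succ: "face_succ G (last (path_G k)) = rot G x" "face_succ H (last (path_H k)) = rot H x"
      using 3 by (simp_all add: path_G_def path_H_def start_H_def face_succ_def x_def C_same)
    have xG: "x \<in> darts_of G" using C_cases[OF x(1)] by simp
    consider "tail (dg G) x = u" | "tail (dg G) x = v\<^sub>1" | "tail (dg G) x = v\<^sub>2"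
      | "tail (dg G) x = v\<^sub>3" | "tail (dg G) x \<notin> {u, v\<^sub>1, v\<^sub>2, v\<^sub>3}" by blast
    then show ?thesis
    proof cases
      case 1
      then have "x \<in> set [uv\<^sub>1, uv\<^sub>2, uv\<^sub>3]" using ccw_set[OF ccw_u] xG by blast
      then have "x = uv\<^sub>2" using x by auto
      then show ?thesis using succ rot_triangle in_T start by simp
    next
      case 2
      then have "x \<in> set ([m, w\<^sub>1] @ D\<^sub>1)" using ccw_set[OF ccw_v1(1)] xG by blast
      then show ?thesis using x succ at_v1[of x x] by auto
    next
      case 3
      then have "x \<in> set ([w\<^sub>2, opp G m] @ D\<^sub>2)" using ccw_set[OF ccw_v2(1)] xG by blast
      then show ?thesis using x succ at_v2[of x x] by auto
    next
      case 4
      then have "x \<in> set (w\<^sub>3 # D\<^sub>3)" using ccw_set[OF ccw_v3(1)] xG by blast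
      then show ?thesis using x succ at_v3[of x] by auto
    next
      case 5
      then have "rot H x = rot G x" using C_same(6)[OF x(1)] by simp
      moreover have "rot G x \<in> darts_of G" "tail (dg G) (rot G x) = tail (dg G) x" using xG by simp_all
      moreover have "rot G x \<notin> {m, opp G m, w\<^sub>1, w\<^sub>3, uv\<^sub>1, uv\<^sub>2}"
        using 5 calculation(3) ends opp_ends by (metis insertE insertI1 insertI2 singletonD)
      ultimately show ?thesis using succ by (simp add: T_def start_H_def)
    qed
  qed
qed

lemma first_return_G: "first_return (face_succ G) (darts_of G) T id path_G next_T"
proof
  show "face_succ G (last (path_G t)) = id (next_T t)" "next_T t \<in> T" if "t \<in> T" for t
    using next_T[OF that] that by (simp_all add: next_T_def)
  show "set (tl (path_G t)) \<inter> id ` T = {}" for t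
    by (auto simp: path_G_def T_def)
  show "successively (\<lambda>x y. face_succ G x = y) (path_G t)" for t
    by (simp add: path_G_def face_succ_def rot_triangle)
qed (auto simp: G.face_succ_permutes T_def path_G_def next_T_def)

lemma first_return_H: "first_return (face_succ H) (darts_of H) T start_H path_H next_T"
proof
  show "face_succ H (last (path_H t)) = start_H (next_T t)" "next_T t \<in> T" if "t \<in> T" for t
    using next_T[OF that] that by (simp_all add: next_T_def)
  have T: "t = m \<or> t \<in> C" "t \<noteq> w\<^sub>1" if "t \<in> T" for t
    using that darts by (auto simp: T_def)
  have "w\<^sub>1 \<noteq> opp H n" using uv_in_C darts by auto
  then show "inj_on start_H T"
    using T darts by (intro inj_onI) (metis start_H_def)
  show "start_H t \<in> darts_of H" if "t \<in> T" for t
    using that darts uv_in_C by (auto simp: start_H_def T_def)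
  have "uv\<^sub>2 \<notin> start_H ` T"
    using dart_neq' by (auto simp: start_H_def T_def)
  then show "set (tl (path_H t)) \<inter> start_H ` T = {}" for t
    by (auto simp: path_H_def)
  show "successively (\<lambda>x y. face_succ H x = y) (path_H t)" for t
    by (simp add: path_H_def face_succ_def opp_H rot_triangle)
qed (auto simp: H.face_succ_permutes path_H_def start_H_def next_T_def T_def)

text \<open>The assumption \<open>m\<close> is the condition for the triangle \<open>u v\<^sub>1 v\<^sub>2\<close> in \<open>G\<close>, and \<open>n\<close> that for the
  triangle \<open>u v\<^sub>1 v\<^sub>3\<close> in \<open>H\<close>. They say at the same time that \<open>v\<^sub>1 v\<^sub>2\<close> and \<open>v\<^sub>1 u v\<^sub>2\<close> have the
  same sign, and so have \<open>v\<^sub>3 u v\<^sub>1\<close> and \<open>v\<^sub>3 v\<^sub>1\<close>.\<close>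

lemma kasteleyn_iff_lambda:
  assumes or: "orientation G K" "orientation H L"
    and C: "\<And>k. k \<in> C \<Longrightarrow> dart_sign L k = dart_sign K k"
    and m: "dart_sign K m * dart_sign K uv\<^sub>1 * dart_sign K uv\<^sub>2 = - 1"
    and n: "dart_sign L n = dart_sign K uv\<^sub>3 * dart_sign K uv\<^sub>1"
  shows "kasteleyn G K \<longleftrightarrow> kasteleyn H L"
proof -
  have opp: "dart_sign K w\<^sub>1 = - dart_sign K uv\<^sub>1" "dart_sign K w\<^sub>3 = - dart_sign K uv\<^sub>3"
      "dart_sign L (opp H n) = - dart_sign L n"
    using or ends by (simp_all add: orientation_opp)
  have m': "dart_sign K m = - (dart_sign K uv\<^sub>1 * dart_sign K uv\<^sub>2)"
    using m by (auto simp: dart_sign_def split: if_splits)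
  have weights: "prod_list (map (dart_sign K) (path_G t)) = prod_list (map (dart_sign L) (path_H t))"
    if "t \<in> T" for t
    using that uv_in_C dart_neq' darts
    by (auto simp: path_G_def path_H_def start_H_def C opp m' n T_def)
  have n': "- (dart_sign L n * dart_sign L uv\<^sub>3 * dart_sign L uv\<^sub>1) = - 1"
    using uv_in_C by (simp add: C n) (simp add: dart_sign_def)
  show ?thesis
  proof
    assume K: "kasteleyn G K"
    show "kasteleyn H L"
    proof (rule kasteleyn_transfer[where b = "\<lambda>_. 1" and c = "\<lambda>_. 1" and K = K and I = "{n, w\<^sub>3, uv\<^sub>1}",
          OF G.torus_graph_axioms H.torus_graph_axioms or(2) first_return_G first_return_H])
      fix k assume k: "k \<in> darts_of H"
      have in_path: "k \<in> set (path_H k)" if "k \<in> T" "k \<noteq> w\<^sub>3" "k \<noteq> m"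
        using that by (simp add: path_H_def start_H_def)
      have "m \<in> T" "w\<^sub>3 \<in> T" using ends dart_neq' by (auto simp: T_def)
      moreover have "set (path_H m) = {w\<^sub>1, uv\<^sub>2}" "set (path_H w\<^sub>3) = {opp H n}"
        using dart_neq' by (simp_all add: path_H_def start_H_def)
      moreover have "k \<in> {n, w\<^sub>3, uv\<^sub>1} \<or> k = opp H n \<or> k \<in> {w\<^sub>1, uv\<^sub>2} \<or> k \<in> T \<and> k \<noteq> w\<^sub>3 \<and> k \<noteq> m"
        using k darts by (auto simp: T_def)
      ultimately show "k \<in> {n, w\<^sub>3, uv\<^sub>1} \<or> (\<exists>t\<in>T. k \<in> set (path_H t))"
        using in_path by blast
    next
      fix k assume "k \<in> {n, w\<^sub>3, uv\<^sub>1}"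
      then show "prod (dart_sign L) (orbit (face_succ H) k) = - 1"
        using triangle_sign_H[OF or(2)] n' triangle_H by auto
    qed (use weights K in simp_all)
  next
    assume L: "kasteleyn H L"
    show "kasteleyn G K"
    proof (rule kasteleyn_transfer[where b = "\<lambda>_. 1" and c = "\<lambda>_. 1" and K = L and I = "{opp G m, w\<^sub>1, uv\<^sub>2}",
          OF H.torus_graph_axioms G.torus_graph_axioms or(1) first_return_H first_return_G])
      fix k assume k: "k \<in> darts_of G"
      have in_path: "k \<in> set (path_G k)" by (simp add: path_G_def)
      have "w\<^sub>3 \<in> T" using ends dart_neq' by (auto simp: T_def)
      moreover have "uv\<^sub>1 \<in> set (path_G w\<^sub>3)" by (simp add: path_G_def)
      ultimately show "k \<in> {opp G m, w\<^sub>1, uv\<^sub>2} \<or> (\<exists>t\<in>T. k \<in> set (path_G t))"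
        using k in_path by (auto simp: T_def)
    next
      fix k assume "k \<in> {opp G m, w\<^sub>1, uv\<^sub>2}"
      then show "prod (dart_sign K) (orbit (face_succ G) k) = - 1"
        using triangle_sign_G[OF or(1)] m triangle_G by auto
    qed (use weights L in simp_all)
  qed
qed

lemma matrix_at_u:
  "dart_matrix G K C u y = (if y = v\<^sub>1 then dart_entry G K uv\<^sub>1 else 0) +
    (if y = v\<^sub>2 then dart_entry G K uv\<^sub>2 else 0) + (if y = v\<^sub>3 then dart_entry G K uv\<^sub>3 else 0)"
  "dart_matrix G K C x u = (if x = v\<^sub>1 then dart_entry G K w\<^sub>1 else 0) +
    (if x = v\<^sub>2 then dart_entry G K w\<^sub>2 else 0) + (if x = v\<^sub>3 then dart_entry G K w\<^sub>3 else 0)"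
proof -
  have out: "{k \<in> darts_of G. tail (dg G) k = u} = {uv\<^sub>1, uv\<^sub>2, uv\<^sub>3}"
    using ccw_set[OF ccw_u] by simp
  have into: "k \<in> {w\<^sub>1, w\<^sub>2, w\<^sub>3}" if "k \<in> C" "head (dg G) k = u" for k
  proof -
    have "opp G k \<in> {k \<in> darts_of G. tail (dg G) k = u}" using that C_cases by simp
    then have "opp G k \<in> {uv\<^sub>1, uv\<^sub>2, uv\<^sub>3}" unfolding out .
    then show ?thesis by (metis G.arev_arev insert_iff singletonD)
  qed
  have "dart_matrix G K C u y = dart_matrix G K {uv\<^sub>1, uv\<^sub>2, uv\<^sub>3} u y"
    unfolding dart_matrix_def using uv_in_C C_cases out
    by (intro sum.mono_neutral_right finite_C) auto
  then show "dart_matrix G K C u y = (if y = v\<^sub>1 then dart_entry G K uv\<^sub>1 else 0) +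
    (if y = v\<^sub>2 then dart_entry G K uv\<^sub>2 else 0) + (if y = v\<^sub>3 then dart_entry G K uv\<^sub>3 else 0)"
    using dart_neq' by (simp add: dart_matrix_insert dart_matrix_empty ends eq_commute add_ac)
  have "dart_matrix G K C x u = dart_matrix G K {w\<^sub>1, w\<^sub>2, w\<^sub>3} x u"
    unfolding dart_matrix_def using uv_in_C into
    by (intro sum.mono_neutral_right finite_C) auto
  then show "dart_matrix G K C x u = (if x = v\<^sub>1 then dart_entry G K w\<^sub>1 else 0) +
    (if x = v\<^sub>2 then dart_entry G K w\<^sub>2 else 0) + (if x = v\<^sub>3 then dart_entry G K w\<^sub>3 else 0)"
    using dart_neq' by (simp add: dart_matrix_insert dart_matrix_empty opp_ends eq_commute add_ac)
qed

text \<open>The multiple \<open>X\<close> of the row of \<open>u\<close> is chosen to cancel the entry of \<open>v\<^sub>1 v\<^sub>2\<close>. As the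
  triangles are faces, what it adds at \<open>v\<^sub>3\<close> has the crossing numbers and the sign of the new edge,
  and the diagonal entry that it adds at \<open>v\<^sub>1\<close> cancels with the one added by the column operation.\<close>

lemma charpoly_lambda:
  assumes or: "orientation G K" "orientation H L"
    and C: "\<And>k. k \<in> C \<Longrightarrow> dart_sign L k = dart_sign K k"
    and m: "dart_sign K m * dart_sign K uv\<^sub>1 * dart_sign K uv\<^sub>2 = - 1"
    and n: "dart_sign L n = dart_sign K uv\<^sub>3 * dart_sign K uv\<^sub>1"
  shows "charpoly G K = charpoly H L"
proof -
  define \<sigma> where "\<sigma> k = real_of_int (dart_sign K k)" for k
  define X where "X = (Poly_Mapping.single (- crossing G uv\<^sub>1) (\<sigma> uv\<^sub>1 * (a / b)) :: laurent2)"
  define X' where "X' = (Poly_Mapping.single (crossing G uv\<^sub>1) (\<sigma> uv\<^sub>1 * (a / b)) :: laurent2)"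
  let ?M = "dart_matrix G K C"
  have b: "b > 0" using G.wt_pos[of uv\<^sub>2] ends by simp
  have m': "dart_sign K m = - (dart_sign K uv\<^sub>1 * dart_sign K uv\<^sub>2)"
    using m by (auto simp: dart_sign_def split: if_splits)
  have sq: "\<sigma> k * (\<sigma> k * r) = r" for k r
    by (simp add: \<sigma>_def dart_sign_def)
  have entries: "dart_entry G K k = Poly_Mapping.single (crossing G k) (- \<sigma> k * wt G k)" for k
    by (simp add: dart_entry_def \<sigma>_def)
  have opp_entries: "dart_entry G K (opp G k) = Poly_Mapping.single (- crossing G k) (\<sigma> k * wt G k)"
    if "k \<in> darts_of G" for k
    using that by (simp add: dart_entry_def \<sigma>_def orientation_opp[OF or(1)] G.crossing_opp G.wt_opp)
  have entry_n: "dart_entry H L n =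
      Poly_Mapping.single (crossing G uv\<^sub>3 - crossing G uv\<^sub>1) (- (\<sigma> uv\<^sub>3 * \<sigma> uv\<^sub>1) * (a * d / b))"
    by (simp add: dart_entry_def n \<sigma>_def crossing_n ends)
  have entry_n': "dart_entry H L (opp H n) =
      Poly_Mapping.single (crossing G uv\<^sub>1 - crossing G uv\<^sub>3) (\<sigma> uv\<^sub>3 * \<sigma> uv\<^sub>1 * (a * d / b))"
    using ends by (simp add: dart_entry_def n \<sigma>_def crossing_n orientation_opp[OF or(2)]
        H.crossing_opp H.wt_opp)
  have \<sigma>_m: "\<sigma> m = - (\<sigma> uv\<^sub>1 * \<sigma> uv\<^sub>2)"
    by (simp add: \<sigma>_def m')
  note entries_uv = entries[of uv\<^sub>1] entries[of uv\<^sub>2] entries[of uv\<^sub>3] entries[of m]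
    opp_entries[OF ends(1)] opp_entries[OF ends(5)] opp_entries[OF ends(9)]
    opp_entries[OF ends(13)] ends crossing_m \<sigma>_m
  have elim: "dart_entry G K m + X * dart_entry G K uv\<^sub>2 = 0" "X * dart_entry G K uv\<^sub>3 = dart_entry H L n"
    "dart_entry G K (opp G m) + X' * dart_entry G K w\<^sub>2 = 0" "X' * dart_entry G K w\<^sub>3 = dart_entry H L (opp H n)"
    "X * dart_entry G K uv\<^sub>1 + X' * dart_entry G K w\<^sub>1 = 0"
    using b by (simp_all add: entries_uv entry_n entry_n' X_def X'_def mult_single sq mult_ac
        flip: single_add)
  have MG: "dart_matrix G K (darts_of G) x y =
      ?M x y + (if x = v\<^sub>1 \<and> y = v\<^sub>2 then dart_entry G K m else 0)
      + (if x = v\<^sub>2 \<and> y = v\<^sub>1 then dart_entry G K (opp G m) else 0)" for x y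
  proof -
    have "dart_matrix G K (darts_of G) x y = ?M x y + dart_matrix G K {m, opp G m} x y"
      unfolding darts(1) by (rule dart_matrix_Un) (use darts(2,3) in \<open>auto simp: finite_C\<close>)
    then show ?thesis
      using dart_neq' by (simp add: dart_matrix_insert dart_matrix_empty ends opp_ends eq_commute add_ac)
  qed
  have MH: "dart_matrix H L (darts_of H) x y =
      ?M x y + (if x = v\<^sub>1 \<and> y = v\<^sub>3 then dart_entry H L n else 0)
      + (if x = v\<^sub>3 \<and> y = v\<^sub>1 then dart_entry H L (opp H n) else 0)" for x y
  proof -
    have "dart_matrix H L (darts_of H) x y = dart_matrix H L C x y + dart_matrix H L {n, opp H n} x y"
      unfolding darts(4) by (rule dart_matrix_Un) (use darts(5,6) in \<open>auto simp: finite_C\<close>)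
    moreover have "dart_matrix H L C x y = ?M x y"
      unfolding dart_matrix_def by (rule sum.cong) (auto simp: dart_entry_def C_same C)
    ultimately show ?thesis
      using dart_neq' by (simp add: dart_matrix_insert dart_matrix_empty ends opp_ends eq_commute add_ac)
  qed
  have u: "u \<in> verts_of G" "v\<^sub>1 \<in> verts_of G"
    using ccw_vertex[OF ccw_u] ccw_vertex[OF ccw_v1(1)] by auto
  let ?G = "dart_matrix G K (darts_of G)"
  define R where "R = ?G(v\<^sub>1 := \<lambda>y. 1 * ?G v\<^sub>1 y + X * ?G u y, u := \<lambda>y. 0 * ?G v\<^sub>1 y + 1 * ?G u y)"
  have R: "R x y = (if x = v\<^sub>1 then ?G v\<^sub>1 y + X * ?G u y else ?G x y)" for x y
    using vertices_distinct' by (simp add: R_def)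
  have "det_on (verts_of G) (dart_matrix H L (darts_of H)) =
      (1 * 1 - X * 0) * (1 * 1 - X' * 0) * det_on (verts_of G) ?G"
  proof (rule det_on_combine_two_rows_columns[where i = v\<^sub>1 and j = u and M = ?G and a = 1 and b = X
        and c = 0 and d = 1, folded R_def])
    fix x y
    show "dart_matrix H L (darts_of H) x v\<^sub>1 = 1 * R x v\<^sub>1 + X' * R x u"
      using elim vertices_distinct'
      by (cases "x = v\<^sub>1"; cases "x = v\<^sub>2"; cases "x = v\<^sub>3")
        (simp_all add: R MG MH matrix_at_u add.assoc)
    show "dart_matrix H L (darts_of H) x u = 0 * R x v\<^sub>1 + 1 * R x u"
      using vertices_distinct' by (simp add: R MG MH matrix_at_u)
    assume "y \<noteq> v\<^sub>1" "y \<noteq> u"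
    then show "dart_matrix H L (darts_of H) x y = R x y"
      using elim vertices_distinct'
      by (cases "y = v\<^sub>2"; cases "y = v\<^sub>3") (simp_all add: R MG MH matrix_at_u add.assoc)
  qed (use u vertices_distinct' in auto)
  then show ?thesis
    by (simp add: G.charpoly_eq_det_on H.charpoly_eq_det_on same_vertices)
qed

lemma orientations_agree_common:
  assumes "\<And>k. k \<in> C \<Longrightarrow> dart_sign L k = dart_sign K k"
  shows "orientations_agree G K H L" "orientations_agree H L G K"
proof -
  have "k \<in> L \<longleftrightarrow> k \<in> K" if "k \<in> C" for k
    using assms[OF that] by (simp add: dart_sign_def split: if_splits)
  then show "orientations_agree G K H L" "orientations_agree H L G K"
    unfolding orientations_agree_def C_def by (auto intro!: exI[of _ "{}"])
qed

lemma transfer_lambda: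
  assumes K: "kasteleyn G K"
  shows "\<exists>L. kasteleyn H L \<and> orientations_agree G K H L \<and> charpoly G K = charpoly H L"
proof -
  have or: "orientation G K" using K by (simp add: kasteleyn_def)
  have "prod (dart_sign K) (orbit (face_succ G) (opp G m)) = - 1"
    using K ends unfolding G.kasteleyn_iff by simp
  then have m: "dart_sign K m * dart_sign K uv\<^sub>1 * dart_sign K uv\<^sub>2 = - 1"
    using triangle_G(1) triangle_sign_G[OF or] by simp
  define s where "s = dart_sign K uv\<^sub>3 * dart_sign K uv\<^sub>1"
  define \<tau> where "\<tau> k = (if k \<in> C then dart_sign K k else if k = n then s else - s)" for k
  obtain L where L: "orientation H L" "\<And>k. k \<in> darts_of H \<Longrightarrow> dart_sign L k = \<tau> k"
  proof (rule orientation_with_signs[of H \<tau>])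
    show "\<tau> k = 1 \<or> \<tau> k = - 1" if "k \<in> darts_of H" for k
      by (simp add: \<tau>_def s_def dart_sign_def)
    show "\<tau> (opp H k) = - \<tau> k" if "k \<in> darts_of H" for k
    proof (cases "k \<in> C")
      case True
      then show ?thesis
        using C_opp[OF True] C_cases[OF True] by (simp add: \<tau>_def C_same orientation_opp[OF or])
    next
      case False
      then show ?thesis using that darts dart_neq' by (auto simp: \<tau>_def)
    qed
  qed auto
  have C: "dart_sign L k = dart_sign K k" if "k \<in> C" for k
    using L(2) C_cases that by (simp add: \<tau>_def)
  have n: "dart_sign L n = dart_sign K uv\<^sub>3 * dart_sign K uv\<^sub>1"
    using L(2) ends darts by (simp add: \<tau>_def s_def)
  show ?thesis
    using kasteleyn_iff_lambda[OF or L(1) C m n] charpoly_lambda[OF or L(1) C m n]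
      orientations_agree_common(1)[of L K] C K by blast
qed

lemma transfer_lambda_inverse:
  assumes L: "kasteleyn H L"
  shows "\<exists>K. kasteleyn G K \<and> orientations_agree H L G K \<and> charpoly G K = charpoly H L"
proof -
  have or: "orientation H L" using L by (simp add: kasteleyn_def)
  have "prod (dart_sign L) (orbit (face_succ H) n) = - 1"
    using L ends unfolding H.kasteleyn_iff by simp
  then have n: "dart_sign L n = dart_sign L uv\<^sub>3 * dart_sign L uv\<^sub>1"
    using triangle_H(1) triangle_sign_H[OF or] by (auto simp: dart_sign_def split: if_splits)
  define s where "s = - (dart_sign L uv\<^sub>1 * dart_sign L uv\<^sub>2)"
  define \<tau> where "\<tau> k = (if k \<in> C then dart_sign L k else if k = m then s else - s)" for k
  obtain K where K: "orientation G K" "\<And>k. k \<in> darts_of G \<Longrightarrow> dart_sign K k = \<tau> k"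
  proof (rule orientation_with_signs[of G \<tau>])
    show "\<tau> k = 1 \<or> \<tau> k = - 1" if "k \<in> darts_of G" for k
      by (simp add: \<tau>_def s_def dart_sign_def)
    show "\<tau> (opp G k) = - \<tau> k" if "k \<in> darts_of G" for k
    proof (cases "k \<in> C")
      case True
      then show ?thesis
        using C_opp[OF True] C_cases[OF True] orientation_opp[OF or, of k] by (simp add: \<tau>_def C_same)
    next
      case False
      then show ?thesis using that darts dart_neq' by (auto simp: \<tau>_def)
    qed
  qed auto
  have C: "dart_sign L k = dart_sign K k" if "k \<in> C" for k
    using K(2) C_cases that by (simp add: \<tau>_def)
  have "dart_sign K m = - (dart_sign K uv\<^sub>1 * dart_sign K uv\<^sub>2)"
    using K(2) ends darts uv_in_C C by (simp add: \<tau>_def s_def)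
  then have m: "dart_sign K m * dart_sign K uv\<^sub>1 * dart_sign K uv\<^sub>2 = - 1"
    by (simp add: dart_sign_def)
  have n': "dart_sign L n = dart_sign K uv\<^sub>3 * dart_sign K uv\<^sub>1"
    using n uv_in_C C by simp
  show ?thesis
    using kasteleyn_iff_lambda[OF K(1) or C m n'] charpoly_lambda[OF K(1) or C m n']
      orientations_agree_common(2)[of L K] C L by blast
qed

end

lemma lambda_move_imp_lambda_graphs:
  assumes "torus_graph G" "torus_graph H" "lambda_move G H"
  obtains u v\<^sub>1 v\<^sub>2 v\<^sub>3 a b c d uv\<^sub>1 uv\<^sub>2 uv\<^sub>3 m n D\<^sub>1 D\<^sub>2 D\<^sub>3
  where "lambda_graphs G H u v\<^sub>1 v\<^sub>2 v\<^sub>3 a b c d uv\<^sub>1 uv\<^sub>2 uv\<^sub>3 m n D\<^sub>1 D\<^sub>2 D\<^sub>3"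
proof -
  show thesis
    using \<open>lambda_move G H\<close> unfolding lambda_move_def
  proof (elim exE conjE, goal_cases)
    case (1 u v\<^sub>1 v\<^sub>2 v\<^sub>3 a b c d uv\<^sub>1 uv\<^sub>2 uv\<^sub>3 m n D\<^sub>1 D\<^sub>2 D\<^sub>3)
    have "lambda_graphs_axioms G H u v\<^sub>1 v\<^sub>2 v\<^sub>3 a b c d uv\<^sub>1 uv\<^sub>2 uv\<^sub>3 m n D\<^sub>1 D\<^sub>2 D\<^sub>3"
      by (rule lambda_graphs_axioms.intro; rule 1)
    then show thesis
      using that assms by (simp add: lambda_graphs_def)
  qed
qed

section \<open>The disk of a spider move\<close>

text \<open>The constant Laurent polynomials.\<close>

definition const :: "real \<Rightarrow> laurent2" where
  "const r = Poly_Mapping.single 0 r"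

lemma const_simps [simp]: "const 0 = 0" "const 1 = 1" "const (- r) = - const r"
  by (simp_all add: const_def single_uminus)

lemma const_add: "const (r + s) = const r + const s"
  by (simp add: const_def single_add)

lemma const_diff: "const (r - s) = const r - const s"
  by (simp add: const_def single_diff)

lemma const_mult: "const (r * s) = const r * const s"
  by (simp add: const_def mult_single)

text \<open>One graph with the disk of a spider move. For \<open>e = 0\<close> there is no diagonal, and \<open>uu'\<close> may be any
  dart.\<close>

locale spider_graph = torus_graph G
  for G :: "('v, 'd) emb_graph" +
  fixes x y x' y' u u' :: 'v and a b c d e :: real and X Y X' Y' :: "'d list"
    and t :: "'v \<Rightarrow> int \<times> int" and ux uy uy' u'x' u'y u'y' uu' :: 'd
  assumes distinct_vertices: "distinct [x, y, x', y', u, u']"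
    and links: "link G ux u x 1" "link G uy u y b" "link G uy' u y' a"
      "link G u'x' u' x' 1" "link G u'y u' y c" "link G u'y' u' y' d"
    and link_diagonal: "e \<noteq> 0 \<Longrightarrow> link G uu' u u' e"
    and ccw_u: "ccw G u ([ux, uy] @ (if e = 0 then [] else [uu']) @ [uy'])"
    and ccw_u': "ccw G u' ([u'x', u'y'] @ (if e = 0 then [] else [opp G uu']) @ [u'y])"
    and ccw_corners: "ccw G x (opp G ux # X)" "ccw G y (opp G u'y # opp G uy # Y)"
      "ccw G x' (opp G u'x' # X')" "ccw G y' (opp G uy' # opp G u'y' # Y')"
    and crossing_disk: "\<And>k. k \<in> darts_of G \<Longrightarrow> tail (dg G) k \<in> {u, u'} \<Longrightarrow>
      crossing G k = t (head (dg G) k) - t (tail (dg G) k)"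
begin

lemma ends:
  "ux \<in> darts_of G" "tail (dg G) ux = u" "head (dg G) ux = x" "wt G ux = 1"
  "uy \<in> darts_of G" "tail (dg G) uy = u" "head (dg G) uy = y" "wt G uy = b"
  "uy' \<in> darts_of G" "tail (dg G) uy' = u" "head (dg G) uy' = y'" "wt G uy' = a"
  "u'x' \<in> darts_of G" "tail (dg G) u'x' = u'" "head (dg G) u'x' = x'" "wt G u'x' = 1"
  "u'y \<in> darts_of G" "tail (dg G) u'y = u'" "head (dg G) u'y = y" "wt G u'y = c"
  "u'y' \<in> darts_of G" "tail (dg G) u'y' = u'" "head (dg G) u'y' = y'" "wt G u'y' = d"
  using links by (simp_all add: link_def)

lemma ends_diagonal:
  assumes "e \<noteq> 0"
  shows "uu' \<in> darts_of G" "tail (dg G) uu' = u" "head (dg G) uu' = u'" "wt G uu' = e"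
  using link_diagonal[OF assms] by (simp_all add: link_def)

lemma vertices_distinct:
  "x \<noteq> y" "x \<noteq> x'" "x \<noteq> y'" "x \<noteq> u" "x \<noteq> u'" "y \<noteq> x'" "y \<noteq> y'" "y \<noteq> u" "y \<noteq> u'"
  "x' \<noteq> y'" "x' \<noteq> u" "x' \<noteq> u'" "y' \<noteq> u" "y' \<noteq> u'" "u \<noteq> u'"
  using distinct_vertices by auto

lemmas vertices_distinct' = vertices_distinct vertices_distinct[symmetric]

lemma weights_pos: "a > 0" "b > 0" "c > 0" "d > 0"
  using wt_pos[of uy'] wt_pos[of uy] wt_pos[of u'y] wt_pos[of u'y'] ends by simp_all

lemma out_u: "{k \<in> darts_of G. tail (dg G) k = u} = {ux, uy, uy'} \<union> (if e = 0 then {} else {uu'})"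
  by (subst ccw_set[OF ccw_u, symmetric]) auto

lemma out_u': "{k \<in> darts_of G. tail (dg G) k = u'} =
    {u'x', u'y, u'y'} \<union> (if e = 0 then {} else {opp G uu'})"
  by (subst ccw_set[OF ccw_u', symmetric]) auto

definition C :: "'d set" where
  "C = {k \<in> darts_of G. tail (dg G) k \<notin> {u, u'} \<and> head (dg G) k \<notin> {u, u'}}"

lemma C_opp: "k \<in> C \<Longrightarrow> opp G k \<in> C"
  by (simp add: C_def)

text \<open>A face entering the disk at the corner \<open>w\<close> runs along \<open>first_dart w\<close> and
  \<open>second_dart w\<close> to the next corner.\<close>

definition corners :: "'v set" where "corners = {x, y, x', y'}"

definition first_dart :: "'v \<Rightarrow> 'd" where
  "first_dart w = (if w = x then opp G ux else if w = y then opp G u'y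
    else if w = x' then opp G u'x' else opp G uy')"

definition second_dart :: "'v \<Rightarrow> 'd" where
  "second_dart w = (if w = x then uy else if w = y then u'x' else if w = x' then u'y' else ux)"

definition next_corner :: "'v \<Rightarrow> 'v" where
  "next_corner w = (if w = x then y else if w = y then x' else if w = x' then y' else x)"

definition inside :: "'v \<Rightarrow> 'd list" where
  "inside w = (if w = x then [opp G ux] else if w = y then [opp G u'y, opp G uy]
    else if w = x' then [opp G u'x'] else [opp G uy', opp G u'y'])"

definition outside :: "'v \<Rightarrow> 'd list" where
  "outside w = (if w = x then X else if w = y then Y else if w = x' then X' else Y')"

lemma corner_cases:
  assumes "w \<in> corners"
  obtains "w = x" | "w = y" | "w = x'" | "w = y'"
  using assms by (auto simp: corners_def)

lemma ccw_corner: "w \<in> corners \<Longrightarrow> ccw G w (inside w @ outside w)"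
  using ccw_corners vertices_distinct'
  by (elim corner_cases) (simp_all add: inside_def outside_def)

lemma inside_nonempty: "inside w \<noteq> []"
  by (simp add: inside_def)

lemma hd_inside: "hd (inside w) = first_dart w"
  by (simp add: inside_def first_dart_def)

lemma next_corner_in: "w \<in> corners \<Longrightarrow> next_corner w \<in> corners"
  by (simp add: corners_def next_corner_def)

lemma opp_second_dart: "w \<in> corners \<Longrightarrow> opp G (second_dart w) = last (inside (next_corner w))"
  using vertices_distinct'
  by (elim corner_cases) (simp_all add: second_dart_def inside_def next_corner_def)

lemma rot_disk:
  "rot G ux = uy" "rot G uy' = ux" "rot G u'x' = u'y'" "rot G u'y = u'x'"
  "e = 0 \<Longrightarrow> rot G uy = uy'" "e = 0 \<Longrightarrow> rot G u'y' = u'y"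
  "e \<noteq> 0 \<Longrightarrow> rot G uy = uu'" "e \<noteq> 0 \<Longrightarrow> rot G uu' = uy'"
  "e \<noteq> 0 \<Longrightarrow> rot G u'y' = opp G uu'" "e \<noteq> 0 \<Longrightarrow> rot G (opp G uu') = u'y"
  "rot G (opp G u'y) = opp G uy" "rot G (opp G uy') = opp G u'y'"
proof -
  show "rot G ux = uy"
    using rot_ccw_step[of G u "[]" ux uy] ccw_u by simp
  show "rot G uy' = ux"
    using rot_ccw_last[of G u "[ux, uy] @ (if e = 0 then [] else [uu'])" uy'] ccw_u by simp
  show "rot G u'x' = u'y'"
    using rot_ccw_step[of G u' "[]" u'x' u'y'] ccw_u' by simp
  show "rot G u'y = u'x'"
    using rot_ccw_last[of G u' "[u'x', u'y'] @ (if e = 0 then [] else [opp G uu'])" u'y] ccw_u' by simp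
  show "rot G uy = uy'" if "e = 0"
    using rot_ccw_step[of G u "[ux]" uy uy'] ccw_u that by simp
  show "rot G u'y' = u'y" if "e = 0"
    using rot_ccw_step[of G u' "[u'x']" u'y' u'y] ccw_u' that by simp
  show "rot G uy = uu'" "rot G uu' = uy'" if "e \<noteq> 0"
    using rot_ccw_step[of G u "[ux]" uy uu'] rot_ccw_step[of G u "[ux, uy]" uu' uy'] ccw_u that
    by simp_all
  show "rot G u'y' = opp G uu'" "rot G (opp G uu') = u'y" if "e \<noteq> 0"
    using rot_ccw_step[of G u' "[u'x']" u'y' "opp G uu'"]
      rot_ccw_step[of G u' "[u'x', u'y']" "opp G uu'" u'y] ccw_u' that
    by simp_all
  show "rot G (opp G u'y) = opp G uy" "rot G (opp G uy') = opp G u'y'"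
    using rot_ccw_step[of G y "[]"] rot_ccw_step[of G y' "[]"] ccw_corners by simp_all
qed

lemma face_succ_first_dart: "w \<in> corners \<Longrightarrow> face_succ G (first_dart w) = second_dart w"
  using vertices_distinct' rot_disk
  by (elim corner_cases) (simp_all add: second_dart_def first_dart_def face_succ_def)

lemma dart_neq:
  "distinct [ux, uy, uy', u'x', u'y, u'y',
    opp G ux, opp G uy, opp G uy', opp G u'x', opp G u'y, opp G u'y']"
  "e \<noteq> 0 \<Longrightarrow> distinct [ux, uy, uy', u'x', u'y, u'y', uu',
    opp G ux, opp G uy, opp G uy', opp G u'x', opp G u'y, opp G u'y', opp G uu']"
proof -
  have ne: "k \<noteq> l" if "tail (dg G) k \<noteq> tail (dg G) l \<or> head (dg G) k \<noteq> head (dg G) l" for k l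
    using that by auto
  have opp_ends: "tail (dg G) (opp G k) = head (dg G) k \<and> head (dg G) (opp G k) = tail (dg G) k"
    if "k \<in> darts_of G" for k using that by simp
  note opps = opp_ends[OF ends(1)] opp_ends[OF ends(5)] opp_ends[OF ends(9)] opp_ends[OF ends(13)]
    opp_ends[OF ends(17)] opp_ends[OF ends(21)]
  show "distinct [ux, uy, uy', u'x', u'y, u'y',
    opp G ux, opp G uy, opp G uy', opp G u'x', opp G u'y, opp G u'y']"
    unfolding distinct.simps list.set insert_iff empty_iff de_Morgan_disj
    by (intro conjI TrueI not_False_eq_True[THEN iffD2] ne)
      (simp_all add: opps ends vertices_distinct')
  show "distinct [ux, uy, uy', u'x', u'y, u'y', uu',
    opp G ux, opp G uy, opp G uy', opp G u'x', opp G u'y, opp G u'y', opp G uu']" if "e \<noteq> 0"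
    unfolding distinct.simps list.set insert_iff empty_iff de_Morgan_disj
    by (intro conjI TrueI not_False_eq_True[THEN iffD2] ne)
      (simp_all add: opps ends ends_diagonal[OF that] vertices_distinct'
        opp_ends[OF ends_diagonal(1)[OF that]])
qed

text \<open>The darts that run clockwise around the faces inside the disk.\<close>

definition inner :: "'d set" where
  "inner = {opp G uy, u'y, opp G u'y', uy'} \<union> (if e = 0 then {} else {uu', opp G uu'})"

lemma touching_cases:
  assumes "k \<in> darts_of G" "k \<notin> C"
  shows "k \<in> inner \<or> k \<in> first_dart ` corners \<or> k \<in> second_dart ` corners"
    "head (dg G) k \<in> {u, u'} \<Longrightarrow> tail (dg G) k \<notin> {u, u'} \<Longrightarrow>
      tail (dg G) k \<in> corners \<and> k \<in> set (inside (tail (dg G) k))"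
proof -
  let ?out = "{ux, uy, uy', u'x', u'y, u'y'} \<union> (if e = 0 then {} else {uu', opp G uu'})"
  have out: "l \<in> ?out" if "l \<in> darts_of G" "tail (dg G) l \<in> {u, u'}" for l
    using that out_u out_u' by (auto split: if_splits)
  have out_opp: "\<exists>l\<in>?out. k = opp G l" if "head (dg G) k \<in> {u, u'}"
    using out[of "opp G k"] that assms(1) by (metis arev_arev arev_in_arcs tail_arev)
  have images: "first_dart ` corners = {opp G ux, opp G u'y, opp G u'x', opp G uy'}"
    "second_dart ` corners = {uy, u'x', u'y', ux}"
    using vertices_distinct' by (auto simp: corners_def first_dart_def second_dart_def)
  have "k \<in> ?out \<or> (\<exists>l\<in>?out. k = opp G l)"
    using assms out[of k] out_opp by (auto simp: C_def)
  then show "k \<in> inner \<or> k \<in> first_dart ` corners \<or> k \<in> second_dart ` corners"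
    unfolding images inner_def by (auto split: if_splits)
  assume k: "head (dg G) k \<in> {u, u'}" "tail (dg G) k \<notin> {u, u'}"
  from out_opp[OF k(1)] obtain l where "l \<in> ?out" "k = opp G l" by blast
  then show "tail (dg G) k \<in> corners \<and> k \<in> set (inside (tail (dg G) k))"
    using k(2) ends ends_diagonal vertices_distinct'
    by (auto simp: corners_def inside_def split: if_splits)
qed

lemma first_dart_props:
  assumes "w \<in> corners"
  shows "first_dart w \<in> darts_of G" "first_dart w \<notin> C" "tail (dg G) (first_dart w) = w"
    "head (dg G) (first_dart w) \<in> {u, u'}"
    "second_dart w \<in> darts_of G" "second_dart w \<notin> C" "tail (dg G) (second_dart w) \<in> {u, u'}"
  using assms vertices_distinct'
  by (elim corner_cases; simp add: first_dart_def second_dart_def C_def ends)+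

lemma set_inside:
  assumes "w \<in> corners" "k \<in> set (inside w)"
  shows "k \<notin> C"
  using assms vertices_distinct'
  by (elim corner_cases) (auto simp: inside_def C_def ends)

lemma outside_in_C:
  assumes "w \<in> corners" "k \<in> set (outside w)"
  shows "k \<in> C"
proof (rule ccontr)
  assume "k \<notin> C"
  have k: "k \<in> darts_of G" "tail (dg G) k = w" "k \<notin> set (inside w)"
    using ccw_set[OF ccw_corner[OF assms(1)]] ccw_distinct[OF ccw_corner[OF assms(1)]] assms(2)
    by auto
  have "w \<notin> {u, u'}" using assms(1) vertices_distinct' by (auto simp: corners_def)
  then have "head (dg G) k \<in> {u, u'}" using \<open>k \<notin> C\<close> k by (auto simp: C_def)
  then show False
    using touching_cases(2)[OF k(1) \<open>k \<notin> C\<close>] k \<open>w \<notin> {u, u'}\<close> by simp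
qed

text \<open>The index set of the section depends on the outside of the disk only: it consists of the darts
  there and of the corners, which stand for the darts leading from a corner into the disk.\<close>

definition T :: "('d + 'v) set" where "T = Inl ` C \<union> Inr ` corners"

definition start :: "'d + 'v \<Rightarrow> 'd" where
  "start s = (case s of Inl k \<Rightarrow> k | Inr w \<Rightarrow> first_dart w)"

definition path :: "'d + 'v \<Rightarrow> 'd list" where
  "path s = (case s of Inl k \<Rightarrow> [k] | Inr w \<Rightarrow> [first_dart w, second_dart w])"

text \<open>A face that goes on with \<open>k\<close> either stays outside the disk or enters it at the tail of \<open>k\<close>.\<close>

definition entry :: "'d \<Rightarrow> 'd + 'v" where
  "entry k = (if k \<in> C then Inl k else Inr (tail (dg G) k))"

definition next_T :: "'d + 'v \<Rightarrow> 'd + 'v" where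
  "next_T s = (if s \<in> T then entry (face_succ G (last (path s))) else s)"

lemma T_simps [simp]: "Inl k \<in> T \<longleftrightarrow> k \<in> C" "Inr w \<in> T \<longleftrightarrow> w \<in> corners"
  by (auto simp: T_def)

lemma entry_first_dart: "w \<in> corners \<Longrightarrow> entry (first_dart w) = Inr w"
  by (simp add: entry_def first_dart_props)

lemma rot_enters:
  assumes k: "k \<in> darts_of G" and tail: "tail (dg G) k \<notin> {u, u'}"
    and corner: "tail (dg G) k \<in> corners \<Longrightarrow>
      k = last (inside (tail (dg G) k)) \<or> k \<in> set (outside (tail (dg G) k))"
  shows "rot G k \<in> C \<or> tail (dg G) k \<in> corners \<and> rot G k = first_dart (tail (dg G) k)"
proof (cases "tail (dg G) k \<in> corners")
  case True
  then show ?thesis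
    using rot_ccw_replace_prefix[OF ccw_corner[OF True] ccw_corner[OF True]
        inside_nonempty inside_nonempty, of k k] corner[OF True] outside_in_C[OF True]
    by (auto simp: hd_inside)
next
  case False
  have r: "rot G k \<in> darts_of G" "tail (dg G) (rot G k) = tail (dg G) k" using k by simp_all
  have "rot G k \<in> C"
    using touching_cases(2)[OF r(1)] r tail False by (auto simp: C_def)
  then show ?thesis ..
qed

lemma opp_last_path:
  assumes "s \<in> T"
  defines "k \<equiv> opp G (last (path s))"
  shows "k \<in> darts_of G" "tail (dg G) k \<notin> {u, u'}"
    "tail (dg G) k \<in> corners \<Longrightarrow>
      k = last (inside (tail (dg G) k)) \<or> k \<in> set (outside (tail (dg G) k))"
proof -
  have "k \<in> darts_of G \<and> tail (dg G) k \<notin> {u, u'} \<and> (tail (dg G) k \<in> corners \<longrightarrow>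
      k = last (inside (tail (dg G) k)) \<or> k \<in> set (outside (tail (dg G) k)))"
  proof (cases s)
    case (Inl l)
    then have k: "k \<in> C" using assms C_opp by (simp add: path_def)
    then have "k \<in> darts_of G" "tail (dg G) k \<notin> {u, u'}" by (auto simp: C_def)
    moreover have "k \<in> set (outside (tail (dg G) k))" if "tail (dg G) k \<in> corners"
    proof -
      have "k \<in> set (inside (tail (dg G) k) @ outside (tail (dg G) k))"
        unfolding ccw_set[OF ccw_corner[OF that]] using \<open>k \<in> darts_of G\<close> by simp
      then show ?thesis using set_inside[OF that] k by auto
    qed
    ultimately show ?thesis by simp
  next
    case (Inr w)
    then have w: "next_corner w \<in> corners" "k = last (inside (next_corner w))"
      using assms next_corner_in opp_second_dart by (simp_all add: path_def)
    have "k \<in> set (inside (next_corner w) @ outside (next_corner w))"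
      using w inside_nonempty by simp
    then have "k \<in> darts_of G" "tail (dg G) k = next_corner w"
      unfolding ccw_set[OF ccw_corner[OF w(1)]] by simp_all
    moreover have "next_corner w \<notin> {u, u'}"
      using w(1) vertices_distinct' by (auto simp: corners_def)
    ultimately show ?thesis using w by simp
  qed
  then show "k \<in> darts_of G" "tail (dg G) k \<notin> {u, u'}"
    "tail (dg G) k \<in> corners \<Longrightarrow>
      k = last (inside (tail (dg G) k)) \<or> k \<in> set (outside (tail (dg G) k))" by auto
qed

lemma next_T:
  assumes "s \<in> T"
  shows "face_succ G (last (path s)) = start (next_T s)" "next_T s \<in> T"
proof -
  define k where "k = opp G (last (path s))"
  have "rot G k \<in> C \<or> tail (dg G) k \<in> corners \<and> rot G k = first_dart (tail (dg G) k)"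
    unfolding k_def by (intro rot_enters opp_last_path[OF assms])
  moreover have "face_succ G (last (path s)) = rot G k"
    by (simp add: face_succ_def k_def)
  ultimately show "face_succ G (last (path s)) = start (next_T s)" "next_T s \<in> T"
    using assms by (auto simp: next_T_def entry_first_dart) (auto simp: entry_def start_def)
qed

lemma first_return_disk: "first_return (face_succ G) (darts_of G) T start path next_T"
proof
  show "finite (darts_of G)" "face_succ G permutes darts_of G"
    by (simp_all add: face_succ_permutes)
  show "finite T" by (simp add: T_def C_def corners_def)
  have "tail (dg G) (start s) \<notin> {u, u'}" if "s \<in> T" for s
  proof (cases s)
    case (Inl k)
    then show ?thesis using that by (simp add: start_def C_def)
  next
    case (Inr w)
    then have "tail (dg G) (start s) = w" "w \<in> corners"
      using that first_dart_props(3) by (simp_all add: start_def)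
    then show ?thesis using vertices_distinct' by (auto simp: corners_def)
  qed
  then have "second_dart w \<notin> start ` T" if "w \<in> corners" for w
    using first_dart_props(7)[OF that] by (metis imageE)
  then show "set (tl (path s)) \<inter> start ` T = {}" if "s \<in> T" for s
    using that by (cases s) (simp_all add: path_def)
  show "inj_on start T"
  proof (rule inj_onI)
    fix s s' assume "s \<in> T" "s' \<in> T" "start s = start s'"
    then show "s = s'"
      using first_dart_props(2,3) by (cases s; cases s'; simp add: start_def; metis)
  qed
  show "start s \<in> darts_of G" if "s \<in> T" for s
    using that first_dart_props(1) by (auto simp: T_def start_def C_def)
  show "path s \<noteq> [] \<and> hd (path s) = start s" for s
    by (simp add: path_def start_def split: sum.split)
  show "successively (\<lambda>k l. face_succ G k = l) (path s)" if "s \<in> T" for s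
    using that face_succ_first_dart by (auto simp: T_def path_def)
  show "face_succ G (last (path s)) = start (next_T s)" "next_T s \<in> T" if "s \<in> T" for s
    using next_T[OF that] by simp_all
  show "next_T s = s" if "s \<notin> T" for s
    using that by (simp add: next_T_def)
qed

lemma cover_disk:
  assumes "k \<in> darts_of G"
  shows "k \<in> inner \<or> (\<exists>s\<in>T. k \<in> set (path s))"
proof (cases "k \<in> C")
  case True
  then show ?thesis by (intro disjI2 bexI[of _ "Inl k"]) (simp_all add: path_def)
next
  case False
  have "\<exists>s\<in>T. k \<in> set (path s)" if "w \<in> corners" "k = first_dart w \<or> k = second_dart w" for w
    using that by (intro bexI[of _ "Inr w"]) (auto simp: path_def)
  then show ?thesis using touching_cases(1)[OF assms False] by blast
qed

text \<open>The condition that the faces inside the disk impose on the signs. These are a quadrangle if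
  \<open>e = 0\<close>; otherwise the diagonal divides it into two triangles, of which the first determines the
  sign of the diagonal.\<close>

definition inner_signs :: "'d set \<Rightarrow> bool" where
  "inner_signs K \<longleftrightarrow>
    dart_sign K uy * dart_sign K uy' * dart_sign K u'y * dart_sign K u'y' = - 1 \<and>
    (e \<noteq> 0 \<longrightarrow> dart_sign K uu' = dart_sign K uy * dart_sign K u'y)"

lemma inner_orbits:
  "e = 0 \<Longrightarrow> k \<in> {opp G uy, uy', opp G u'y', u'y} \<Longrightarrow>
    orbit (face_succ G) k = {opp G uy, uy', opp G u'y', u'y}"
  "e \<noteq> 0 \<Longrightarrow> k \<in> {opp G uy, uu', u'y} \<Longrightarrow> orbit (face_succ G) k = {opp G uy, uu', u'y}"
  "e \<noteq> 0 \<Longrightarrow> k \<in> {opp G u'y', opp G uu', uy'} \<Longrightarrow>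
    orbit (face_succ G) k = {opp G u'y', opp G uu', uy'}"
proof -
  have *: "face_succ G u'y = opp G uy" "face_succ G uy' = opp G u'y'"
    by (simp_all add: face_succ_def rot_disk)
  show "orbit (face_succ G) k = {opp G uy, uy', opp G u'y', u'y}"
    if "e = 0" "k \<in> {opp G uy, uy', opp G u'y', u'y}"
  proof -
    have "face_succ G (opp G uy) = uy'" "face_succ G (opp G u'y') = u'y"
      using that by (simp_all add: face_succ_def rot_disk)
    then show ?thesis using that(2) * by (auto simp: orbit_four_cycle)
  qed
  show "orbit (face_succ G) k = {opp G uy, uu', u'y}" if "e \<noteq> 0" "k \<in> {opp G uy, uu', u'y}"
  proof -
    have "face_succ G (opp G uy) = uu'" "face_succ G uu' = u'y"
      using that by (simp_all add: face_succ_def rot_disk)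
    then show ?thesis using that(2) * by (auto simp: orbit_three_cycle)
  qed
  show "orbit (face_succ G) k = {opp G u'y', opp G uu', uy'}"
    if "e \<noteq> 0" "k \<in> {opp G u'y', opp G uu', uy'}"
  proof -
    have "face_succ G (opp G u'y') = opp G uu'" "face_succ G (opp G uu') = uy'"
      using that by (simp_all add: face_succ_def rot_disk)
    then show ?thesis using that(2) * by (auto simp: orbit_three_cycle)
  qed
qed

lemma inner_products:
  assumes "orientation G K"
  shows "prod (dart_sign K) {opp G uy, uy', opp G u'y', u'y} =
      dart_sign K uy * dart_sign K uy' * dart_sign K u'y * dart_sign K u'y'"
    "e \<noteq> 0 \<Longrightarrow> prod (dart_sign K) {opp G uy, uu', u'y} =
      - (dart_sign K uy * dart_sign K uu' * dart_sign K u'y)"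
    "e \<noteq> 0 \<Longrightarrow> prod (dart_sign K) {opp G u'y', opp G uu', uy'} =
      dart_sign K u'y' * dart_sign K uu' * dart_sign K uy'"
proof -
  have opp: "dart_sign K (opp G uy) = - dart_sign K uy" "dart_sign K (opp G u'y') = - dart_sign K u'y'"
    "e \<noteq> 0 \<Longrightarrow> dart_sign K (opp G uu') = - dart_sign K uu'"
    using assms ends ends_diagonal by (simp_all add: orientation_opp)
  have ne: "distinct [opp G uy, uy', opp G u'y', u'y]" using dart_neq(1) by auto
  then show "prod (dart_sign K) {opp G uy, uy', opp G u'y', u'y} =
      dart_sign K uy * dart_sign K uy' * dart_sign K u'y * dart_sign K u'y'"
    by (simp add: opp mult_ac)
  assume "e \<noteq> 0"
  then have "distinct [opp G uy, uu', u'y]" "distinct [opp G u'y', opp G uu', uy']"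
    using dart_neq(2) by auto
  then show "prod (dart_sign K) {opp G uy, uu', u'y} =
      - (dart_sign K uy * dart_sign K uu' * dart_sign K u'y)"
    "prod (dart_sign K) {opp G u'y', opp G uu', uy'} =
      dart_sign K u'y' * dart_sign K uu' * dart_sign K uy'"
    using opp \<open>e \<noteq> 0\<close> by (simp_all add: mult_ac)
qed

lemma inner_signs_if_kasteleyn:
  assumes "kasteleyn G K"
  shows "inner_signs K"
proof -
  have or: "orientation G K" using assms by (simp add: kasteleyn_def)
  have face: "prod (dart_sign K) (orbit (face_succ G) k) = - 1" if "k \<in> darts_of G" for k
    using assms that by (simp add: kasteleyn_iff)
  show ?thesis
  proof (cases "e = 0")
    case True
    then show ?thesis
      using face[of uy'] inner_orbits(1)[OF True, of uy'] inner_products(1)[OF or] ends(9)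
      unfolding inner_signs_def by simp
  next
    case False
    have "dart_sign K uy * dart_sign K uu' * dart_sign K u'y = 1"
      using face[of u'y] inner_orbits(2)[OF False, of u'y] inner_products(2)[OF or False] ends by simp
    moreover have "dart_sign K u'y' * dart_sign K uu' * dart_sign K uy' = - 1"
      using face[of uy'] inner_orbits(3)[OF False, of uy'] inner_products(3)[OF or False] ends by simp
    ultimately show ?thesis
      by (auto simp: inner_signs_def dart_sign_def split: if_splits)
  qed
qed

lemma inner_faces:
  assumes "orientation G K" "inner_signs K" "k \<in> inner"
  shows "prod (dart_sign K) (orbit (face_succ G) k) = - 1"
proof (cases "e = 0")
  case True
  then have "k \<in> {opp G uy, uy', opp G u'y', u'y}" using assms(3) unfolding inner_def by auto
  then show ?thesis
    using inner_orbits(1)[OF True] inner_products(1)[OF assms(1)] assms(2)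
    unfolding inner_signs_def by simp
next
  case False
  have s: "dart_sign K uu' = dart_sign K uy * dart_sign K u'y"
    "dart_sign K uy * dart_sign K uy' * dart_sign K u'y * dart_sign K u'y' = - 1"
    using assms(2) False by (simp_all add: inner_signs_def)
  have p: "prod (dart_sign K) {opp G uy, uu', u'y} = - 1"
    "prod (dart_sign K) {opp G u'y', opp G uu', uy'} = - 1"
    unfolding inner_products(2,3)[OF assms(1) False] s(1) using s(2)
    by (auto simp: dart_sign_def split: if_splits)
  have "k \<in> {opp G uy, uu', u'y} \<or> k \<in> {opp G u'y', opp G uu', uy'}"
    using assms(3) False by (auto simp: inner_def)
  then show ?thesis
    using p inner_orbits(2,3)[OF False] by metis
qed

text \<open>Every vertex is shifted by its value of \<open>t\<close>. As \<open>t\<close> describes a lift of the disk, this makes the rows and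
  columns of \<open>u\<close> and \<open>u'\<close> constant.\<close>

definition shifted_matrix :: "'d set \<Rightarrow> 'v \<Rightarrow> 'v \<Rightarrow> laurent2" where
  "shifted_matrix K p q =
    Poly_Mapping.single (t p) 1 * dart_matrix G K (darts_of G) p q * Poly_Mapping.single (- t q) 1"

lemma charpoly_eq_shifted: "charpoly G K = det_on (verts_of G) (shifted_matrix K)"
  unfolding shifted_matrix_def charpoly_eq_det_on
  by (simp add: det_on_scale_rows_columns mult_single)

lemma shifted_matrix_outside:
  assumes "p \<notin> {u, u'}" "q \<notin> {u, u'}"
  shows "shifted_matrix K p q =
    Poly_Mapping.single (t p) 1 * dart_matrix G K C p q * Poly_Mapping.single (- t q) 1"
proof -
  have "dart_matrix G K (darts_of G) p q = dart_matrix G K C p q"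
    unfolding dart_matrix_def
    by (rule sum.mono_neutral_right) (use assms in \<open>auto simp: C_def\<close>)
  then show ?thesis by (simp add: shifted_matrix_def)
qed

lemma shifted_matrix_center:
  assumes or: "orientation G K" and p: "p \<in> {u, u'}"
  shows "shifted_matrix K p q = (\<Sum>k | k \<in> darts_of G \<and> tail (dg G) k = p.
      if head (dg G) k = q then const (- (dart_sign K k * wt G k)) else 0)" (is ?row)
    and "shifted_matrix K q p = (\<Sum>k | k \<in> darts_of G \<and> tail (dg G) k = p.
      if head (dg G) k = q then const (dart_sign K k * wt G k) else 0)" (is ?column)
proof -
  let ?out = "{k \<in> darts_of G. tail (dg G) k = p}"
  have cr: "crossing G k = t (head (dg G) k) - t p" if "k \<in> ?out" for k
    using crossing_disk[of k] that p by auto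
  have "dart_matrix G K (darts_of G) p q = (\<Sum>k\<in>?out. if head (dg G) k = q then dart_entry G K k else 0)"
    unfolding dart_matrix_def by (rule sum.mono_neutral_cong_right) auto
  then have "shifted_matrix K p q = (\<Sum>k\<in>?out. Poly_Mapping.single (t p) 1 *
      (if head (dg G) k = q then dart_entry G K k else 0) * Poly_Mapping.single (- t q) 1)"
    by (simp add: shifted_matrix_def sum_distrib_left sum_distrib_right)
  also have "\<dots> = (\<Sum>k\<in>?out. if head (dg G) k = q then const (- (dart_sign K k * wt G k)) else 0)"
    by (rule sum.cong) (auto simp: dart_entry_def cr const_def mult_single)
  finally show ?row .
  have into: "{k \<in> darts_of G. head (dg G) k = p} = opp G ` ?out"
    by (auto intro!: image_eqI[of _ _ "opp G _"])
  have "dart_matrix G K (darts_of G) q p =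
      (\<Sum>k | k \<in> darts_of G \<and> head (dg G) k = p. if tail (dg G) k = q then dart_entry G K k else 0)"
    unfolding dart_matrix_def by (rule sum.mono_neutral_cong_right) auto
  also have "\<dots> = (\<Sum>k\<in>?out. if head (dg G) k = q then dart_entry G K (opp G k) else 0)"
    unfolding into by (subst sum.reindex) (auto intro!: sum.cong)
  finally have "shifted_matrix K q p = (\<Sum>k\<in>?out. Poly_Mapping.single (t q) 1 *
      (if head (dg G) k = q then dart_entry G K (opp G k) else 0) * Poly_Mapping.single (- t p) 1)"
    by (simp add: shifted_matrix_def sum_distrib_left sum_distrib_right)
  also have "\<dots> = (\<Sum>k\<in>?out. if head (dg G) k = q then const (dart_sign K k * wt G k) else 0)"
    by (rule sum.cong)
      (auto simp: dart_entry_def cr const_def mult_single crossing_opp wt_opp orientation_opp[OF or])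
  finally show ?column .
qed

text \<open>The constants in the columns of \<open>u\<close> and \<open>u'\<close> of the shifted matrix; the rows are their negatives.\<close>

definition center_row :: "'d set \<Rightarrow> 'v \<Rightarrow> real" where
  "center_row K q = (if q = x then dart_sign K ux else if q = y then dart_sign K uy * b
    else if q = y' then dart_sign K uy' * a else if q = u' then dart_sign K uu' * e else 0)"

definition center_row' :: "'d set \<Rightarrow> 'v \<Rightarrow> real" where
  "center_row' K q = (if q = x' then dart_sign K u'x' else if q = y then dart_sign K u'y * c
    else if q = y' then dart_sign K u'y' * d else if q = u then - (dart_sign K uu' * e) else 0)"

lemma sum_at_centers:
  fixes h :: "'d \<Rightarrow> laurent2"
  shows "(\<Sum>k | k \<in> darts_of G \<and> tail (dg G) k = u. h k) =
      h ux + h uy + h uy' + (if e = 0 then 0 else h uu')"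
    "(\<Sum>k | k \<in> darts_of G \<and> tail (dg G) k = u'. h k) =
      h u'x' + h u'y + h u'y' + (if e = 0 then 0 else h (opp G uu'))"
proof -
  show "(\<Sum>k | k \<in> darts_of G \<and> tail (dg G) k = u. h k) =
      h ux + h uy + h uy' + (if e = 0 then 0 else h uu')"
    unfolding out_u using dart_neq by (cases "e = 0") (auto simp: add_ac)
  show "(\<Sum>k | k \<in> darts_of G \<and> tail (dg G) k = u'. h k) =
      h u'x' + h u'y + h u'y' + (if e = 0 then 0 else h (opp G uu'))"
    unfolding out_u' using dart_neq by (cases "e = 0") (auto simp: add_ac)
qed

lemma shifted_matrix_rows:
  assumes or: "orientation G K"
  shows "shifted_matrix K u q = const (- center_row K q)" "shifted_matrix K q u = const (center_row K q)"
    "shifted_matrix K u' q = const (- center_row' K q)" "shifted_matrix K q u' = const (center_row' K q)"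
proof -
  have opp: "e \<noteq> 0 \<Longrightarrow> dart_sign K (opp G uu') = - dart_sign K uu' \<and> wt G (opp G uu') = e \<and>
      head (dg G) (opp G uu') = u"
    using ends_diagonal by (simp add: orientation_opp[OF or] wt_opp)
  show "shifted_matrix K u q = const (- center_row K q)" "shifted_matrix K q u = const (center_row K q)"
    unfolding shifted_matrix_center[OF or insertI1] sum_at_centers center_row_def
    using vertices_distinct' ends_diagonal by (auto simp: ends)
  show "shifted_matrix K u' q = const (- center_row' K q)" "shifted_matrix K q u' = const (center_row' K q)"
    unfolding shifted_matrix_center[OF or insertI2[OF singletonI]] sum_at_centers center_row'_def
    using vertices_distinct' opp by (auto simp: ends)
qed

end

section \<open>The spider moves\<close>

locale spider_pair =
  G: spider_graph G v\<^sub>1 v\<^sub>2 v\<^sub>3 v\<^sub>4 u\<^sub>1 u\<^sub>3 a b c d e D\<^sub>1 D\<^sub>2 D\<^sub>3 D\<^sub>4 t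
    u\<^sub>1v\<^sub>1 u\<^sub>1v\<^sub>2 u\<^sub>1v\<^sub>4 u\<^sub>3v\<^sub>3 u\<^sub>3v\<^sub>2 u\<^sub>3v\<^sub>4 u\<^sub>1u\<^sub>3 +
  H: spider_graph H v\<^sub>2 v\<^sub>3 v\<^sub>4 v\<^sub>1 u\<^sub>2 u\<^sub>4 "d / (a * c + b * d)" "a / (a * c + b * d)"
    "b / (a * c + b * d)" "c / (a * c + b * d)" "e / (a * c + b * d)" D\<^sub>2 D\<^sub>3 D\<^sub>4 D\<^sub>1 t
    u\<^sub>2v\<^sub>2 u\<^sub>2v\<^sub>3 u\<^sub>2v\<^sub>1 u\<^sub>4v\<^sub>4 u\<^sub>4v\<^sub>3 u\<^sub>4v\<^sub>1 u\<^sub>2u\<^sub>4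
  for G H :: "('v, 'd) emb_graph" and v\<^sub>1 v\<^sub>2 v\<^sub>3 v\<^sub>4 u\<^sub>1 u\<^sub>2 u\<^sub>3 u\<^sub>4 :: 'v
    and a b c d e :: real and D\<^sub>1 D\<^sub>2 D\<^sub>3 D\<^sub>4 :: "'d list" and t :: "'v \<Rightarrow> int \<times> int"
    and u\<^sub>1v\<^sub>1 u\<^sub>1v\<^sub>2 u\<^sub>1v\<^sub>4 u\<^sub>3v\<^sub>3 u\<^sub>3v\<^sub>2 u\<^sub>3v\<^sub>4 u\<^sub>1u\<^sub>3 u\<^sub>2v\<^sub>2 u\<^sub>2v\<^sub>3 u\<^sub>2v\<^sub>1 u\<^sub>4v\<^sub>4 u\<^sub>4v\<^sub>3 u\<^sub>4v\<^sub>1 u\<^sub>2u\<^sub>4 :: 'd +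
  assumes new_vertices: "{u\<^sub>1, u\<^sub>3} \<inter> verts_of H = {}" "{u\<^sub>2, u\<^sub>4} \<inter> verts_of G = {}"
      "verts_of G - {u\<^sub>1, u\<^sub>3} = verts_of H - {u\<^sub>2, u\<^sub>4}"
    and common_G: "darts_of G \<inter> darts_of H =
        {k \<in> darts_of G. tail (dg G) k \<notin> {u\<^sub>1, u\<^sub>3} \<and> head (dg G) k \<notin> {u\<^sub>1, u\<^sub>3}}"
    and common_H: "darts_of G \<inter> darts_of H =
        {k \<in> darts_of H. tail (dg H) k \<notin> {u\<^sub>2, u\<^sub>4} \<and> head (dg H) k \<notin> {u\<^sub>2, u\<^sub>4}}"
    and same: "same_outside G H {v\<^sub>1, v\<^sub>2, v\<^sub>3, v\<^sub>4}"
begin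

abbreviation \<Delta> where "\<Delta> \<equiv> a * c + b * d"

lemma \<Delta>_pos: "\<Delta> > 0"
  using G.weights_pos by (simp add: add_pos_pos)

lemma same_C: "H.C = G.C" "G.C = darts_of G \<inter> darts_of H"
  using common_G common_H by (simp_all add: G.C_def H.C_def)

lemma same_corners: "H.corners = G.corners"
  by (auto simp: G.corners_def H.corners_def)

lemma same_T: "H.T = G.T"
  by (simp add: G.T_def H.T_def same_C(1) same_corners)

lemma C_same:
  assumes "k \<in> G.C"
  shows "opp H k = opp G k" "tail (dg H) k = tail (dg G) k" "head (dg H) k = head (dg G) k"
    "wt H k = wt G k" "crossing H k = crossing G k"
    "tail (dg G) k \<notin> G.corners \<Longrightarrow> rot H k = rot G k"
proof -
  have *: "tail (dg H) k = tail (dg G) k \<and> opp H k = opp G k \<and> wt H k = wt G k \<and>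
      crossing H k = crossing G k \<and> (tail (dg G) k \<notin> G.corners \<longrightarrow> rot H k = rot G k)"
    if "k \<in> G.C" for k
    using same that unfolding same_outside_def same_C(2) G.corners_def by blast
  then show "opp H k = opp G k" "tail (dg H) k = tail (dg G) k"
    "wt H k = wt G k" "crossing H k = crossing G k"
    "tail (dg G) k \<notin> G.corners \<Longrightarrow> rot H k = rot G k" using assms by blast+
  have "k \<in> darts_of G" "k \<in> darts_of H" using assms same_C by auto
  then have "head (dg H) k = tail (dg H) (opp H k)" "head (dg G) k = tail (dg G) (opp G k)"
    by simp_all
  then show "head (dg H) k = head (dg G) k"
    using *[OF assms] *[OF G.C_opp[OF assms]] by simp
qed

lemma corner_cases:
  assumes "w \<in> G.corners"
  obtains "w = v\<^sub>1" | "w = v\<^sub>2" | "w = v\<^sub>3" | "w = v\<^sub>4"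
  using assms by (auto simp: G.corners_def)

lemma same_next_corner: "w \<in> G.corners \<Longrightarrow> H.next_corner w = G.next_corner w"
  using G.vertices_distinct'
  by (elim corner_cases) (simp_all add: G.next_corner_def H.next_corner_def)

lemma same_outside_list: "w \<in> G.corners \<Longrightarrow> H.outside w = G.outside w"
  using G.vertices_distinct'
  by (elim corner_cases) (simp_all add: G.outside_def H.outside_def)

text \<open>A face leaving the disk at a corner goes on in the same way in both graphs, since the two passages
  through the disk starting at a corner end at the same corner.\<close>

lemma same_next_T: "H.next_T = G.next_T"
proof
  fix s
  show "H.next_T s = G.next_T s"
  proof (cases "s \<in> G.T")
    case False
    then show ?thesis by (simp add: G.next_T_def H.next_T_def same_T)
  next
    case True
    have at_corner: "H.entry (rot H l) = G.entry (rot G k)"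
      if w: "w \<in> G.corners"
        and kl: "k = last (G.inside w) \<and> l = last (H.inside w) \<or> k = l \<and> k \<in> set (G.outside w)"
      for k l w
    proof -
      have w': "w \<in> H.corners" using w same_corners by simp
      have "ccw H w (H.inside w @ G.outside w)"
        using H.ccw_corner[OF w'] same_outside_list[OF w] by simp
      from rot_ccw_replace_prefix[OF G.ccw_corner[OF w] this G.inside_nonempty H.inside_nonempty kl]
      consider "rot G k = G.first_dart w" "rot H l = H.first_dart w"
        | "rot G k = rot H l" "rot G k \<in> G.C"
        using G.outside_in_C[OF w] by (auto simp: G.hd_inside H.hd_inside)
      then show ?thesis
      proof cases
        case 1
        then show ?thesis by (simp add: G.entry_first_dart[OF w] H.entry_first_dart[OF w'])
      next
        case 2
        then show ?thesis by (simp add: G.entry_def H.entry_def same_C(1))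
      qed
    qed
    show ?thesis
    proof (cases s)
      case (Inr w)
      then have w: "w \<in> G.corners" "w \<in> H.corners" using True same_corners by simp_all
      show ?thesis
        using at_corner[OF G.next_corner_in[OF w(1)], of "opp G (G.second_dart w)" "opp H (H.second_dart w)"]
          G.opp_second_dart[OF w(1)] H.opp_second_dart[OF w(2)] same_next_corner[OF w(1)] Inr w
        by (simp add: G.next_T_def H.next_T_def G.path_def H.path_def face_succ_def)
    next
      case (Inl l)
      define k where "k = opp G l"
      have l: "l \<in> G.C" using True Inl by simp
      then have k: "k \<in> G.C" "k \<in> darts_of G" using G.C_opp same_C by (auto simp: k_def)
      have "H.entry (rot H k) = G.entry (rot G k)"
      proof (cases "tail (dg G) k \<in> G.corners")
        case True
        have "k \<in> set (G.inside (tail (dg G) k) @ G.outside (tail (dg G) k))"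
          unfolding ccw_set[OF G.ccw_corner[OF True]] using k by simp
        then have "k \<in> set (G.outside (tail (dg G) k))" using G.set_inside[OF True] k by auto
        then show ?thesis using at_corner[OF True, of k k] by simp
      next
        case False
        have "tail (dg G) k \<notin> {u\<^sub>1, u\<^sub>3}" using k by (simp add: G.C_def)
        then have "rot G k \<in> G.C" using G.rot_enters[OF k(2)] False by blast
        then show ?thesis using C_same(6)[OF k(1) False] by (simp add: G.entry_def H.entry_def same_C(1))
      qed
      then show ?thesis
        using Inl l C_same(1)[OF l] by (simp add: G.next_T_def H.next_T_def G.path_def H.path_def
            face_succ_def same_T k_def)
    qed
  qed
qed

text \<open>The passages from one corner to the next have the same sign in both graphs: these are four
  equations for the signs of the six new edges from \<open>u\<^sub>2\<close> and \<open>u\<^sub>4\<close> to corners. Reversing all edges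
  at \<open>u\<^sub>2\<close> or at \<open>u\<^sub>4\<close> preserves them, hence one may prescribe \<open>1\<close> at \<open>u\<^sub>2v\<^sub>2\<close> and \<open>u\<^sub>4v\<^sub>4\<close>. The sign of
  the diagonal results from the triangles.\<close>

definition matching_signs :: "'d set \<Rightarrow> 'd set \<Rightarrow> bool" where
  "matching_signs K L \<longleftrightarrow> (\<forall>k\<in>G.C. dart_sign L k = dart_sign K k) \<and>
    dart_sign L u\<^sub>2v\<^sub>2 = 1 \<and> dart_sign L u\<^sub>4v\<^sub>4 = 1 \<and>
    dart_sign L u\<^sub>2v\<^sub>1 = dart_sign K u\<^sub>1v\<^sub>1 * dart_sign K u\<^sub>1v\<^sub>2 \<and>
    dart_sign L u\<^sub>2v\<^sub>3 = dart_sign K u\<^sub>3v\<^sub>2 * dart_sign K u\<^sub>3v\<^sub>3 \<and>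
    dart_sign L u\<^sub>4v\<^sub>3 = dart_sign K u\<^sub>3v\<^sub>3 * dart_sign K u\<^sub>3v\<^sub>4 \<and>
    dart_sign L u\<^sub>4v\<^sub>1 = dart_sign K u\<^sub>1v\<^sub>4 * dart_sign K u\<^sub>1v\<^sub>1 \<and>
    (e \<noteq> 0 \<longrightarrow> dart_sign L u\<^sub>2u\<^sub>4 = dart_sign K u\<^sub>3v\<^sub>2 * dart_sign K u\<^sub>3v\<^sub>4)"

lemma path_signs:
  assumes or: "orientation G K" "orientation H L" and m: "matching_signs K L" and s: "s \<in> G.T"
  shows "prod_list (map (dart_sign K) (G.path s)) = prod_list (map (dart_sign L) (H.path s))"
proof (cases s)
  case (Inl k)
  then show ?thesis using m s by (simp add: G.path_def H.path_def matching_signs_def)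
next
  case (Inr w)
  have "w \<in> G.corners" using s Inr by simp
  moreover have oppK: "dart_sign K (opp G k) = - dart_sign K k" if "k \<in> darts_of G" for k
    using or that by (simp add: orientation_opp)
  moreover have oppL: "dart_sign L (opp H k) = - dart_sign L k" if "k \<in> darts_of H" for k
    using or that by (simp add: orientation_opp)
  ultimately have "dart_sign K (G.first_dart w) * dart_sign K (G.second_dart w) =
      dart_sign L (H.first_dart w) * dart_sign L (H.second_dart w)"
    using m G.vertices_distinct'
    by (elim corner_cases)
      (simp_all add: G.first_dart_def G.second_dart_def H.first_dart_def H.second_dart_def
        matching_signs_def G.ends H.ends mult_ac)
  then show ?thesis using Inr by (simp add: G.path_def H.path_def)
qed

lemma kasteleyn_spider:
  assumes K: "kasteleyn G K" and L: "orientation H L" and m: "matching_signs K L"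
  shows "kasteleyn H L"
proof -
  have or: "orientation G K" using K by (simp add: kasteleyn_def)
  have sK: "G.inner_signs K" using K by (rule G.inner_signs_if_kasteleyn)
  have square: "dart_sign K k * (dart_sign K k * i) = i" for k i
    by (simp add: dart_sign_def)
  have "dart_sign L u\<^sub>2v\<^sub>3 * dart_sign L u\<^sub>2v\<^sub>1 * dart_sign L u\<^sub>4v\<^sub>3 * dart_sign L u\<^sub>4v\<^sub>1 =
      dart_sign K u\<^sub>1v\<^sub>2 * dart_sign K u\<^sub>1v\<^sub>4 * dart_sign K u\<^sub>3v\<^sub>2 * dart_sign K u\<^sub>3v\<^sub>4"
    using m by (simp add: matching_signs_def square mult_ac)
  also have "\<dots> = - 1"
    using sK by (simp add: G.inner_signs_def)
  moreover have "dart_sign L u\<^sub>2u\<^sub>4 = dart_sign L u\<^sub>2v\<^sub>3 * dart_sign L u\<^sub>4v\<^sub>3" if "e \<noteq> 0"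
    using m that by (simp add: matching_signs_def square mult_ac)
  ultimately have sL: "H.inner_signs L"
    using \<Delta>_pos by (simp add: H.inner_signs_def)
  show ?thesis
  proof (rule kasteleyn_transfer[where b = "\<lambda>_. 1" and c = "\<lambda>_. 1" and K = K and I = H.inner,
        OF G.torus_graph_axioms H.torus_graph_axioms L G.first_return_disk
          H.first_return_disk[unfolded same_T same_next_T]])
    show "k \<in> H.inner \<or> (\<exists>s\<in>G.T. k \<in> set (H.path s))" if "k \<in> darts_of H" for k
      using H.cover_disk[OF that] unfolding same_T .
    show "prod (dart_sign L) (orbit (face_succ H) k) = - 1" if "k \<in> H.inner" for k
      using H.inner_faces[OF L sL that] .
  qed (use K path_signs[OF or L m] in simp_all)
qed

text \<open>The row of \<open>u\<^sub>2\<close> is the combination of the rows of \<open>u\<^sub>1\<close> and \<open>u\<^sub>3\<close>, with coefficients \<open>p\<close> and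
  \<open>q\<close>, which vanishes at \<open>v\<^sub>4\<close>; the row of \<open>u\<^sub>4\<close>, with coefficients \<open>r\<close> and \<open>s\<close>, is the one which
  vanishes at \<open>v\<^sub>2\<close>. They do vanish there because the quadrangle in the disk is a face or a union of
  two: this makes \<open>\<beta> \<gamma>\<close> and \<open>\<beta>' \<gamma>'\<close> opposite. The diagonal is multiplied by the determinant of the
  coefficients, \<open>\<plusminus>1/\<Delta>\<close>, so that the diagonal spider move needs no separate argument.\<close>

lemma charpoly_spider:
  assumes K: "kasteleyn G K" and L: "orientation H L" and m: "matching_signs K L"
  shows "charpoly G K = const (\<Delta>\<^sup>2) * charpoly H L"
proof -
  have or: "orientation G K" using K by (simp add: kasteleyn_def)
  have sK: "G.inner_signs K" using K by (rule G.inner_signs_if_kasteleyn)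
  define \<beta> \<beta>' \<gamma> \<gamma>' \<epsilon> where "\<beta> = real_of_int (dart_sign K u\<^sub>1v\<^sub>2)" and "\<beta>' = real_of_int (dart_sign K u\<^sub>3v\<^sub>2)"
    and "\<gamma> = real_of_int (dart_sign K u\<^sub>1v\<^sub>4)" and "\<gamma>' = real_of_int (dart_sign K u\<^sub>3v\<^sub>4)"
    and "\<epsilon> = real_of_int (dart_sign K u\<^sub>1u\<^sub>3)"
  define p q r s where "p = \<beta> * d / \<Delta>" and "q = \<beta>' * a / \<Delta>" and "r = \<gamma> * c / \<Delta>" and "s = \<gamma>' * b / \<Delta>"
  \<comment> \<open>The two vertex sets are identified by \<open>u\<^sub>1 \<mapsto> u\<^sub>2\<close> and \<open>u\<^sub>3 \<mapsto> u\<^sub>4\<close>.\<close>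
  define f where "f w = (if w = u\<^sub>1 then u\<^sub>2 else if w = u\<^sub>3 then u\<^sub>4 else w)" for w
  let ?M = "G.shifted_matrix K" and ?N = "H.shifted_matrix L"
  have \<Delta>: "\<Delta> \<noteq> 0" using \<Delta>_pos by simp
  have in_G: "u\<^sub>1 \<in> verts_of G" "u\<^sub>3 \<in> verts_of G"
    using ccw_vertex[OF G.ccw_u] ccw_vertex[OF G.ccw_u'] by auto
  have in_H: "u\<^sub>2 \<in> verts_of H" "u\<^sub>4 \<in> verts_of H"
    using ccw_vertex[OF H.ccw_u] ccw_vertex[OF H.ccw_u'] by auto
  have f_image: "verts_of H = f ` verts_of G"
  proof -
    have "f ` verts_of G = {u\<^sub>2, u\<^sub>4} \<union> (verts_of G - {u\<^sub>1, u\<^sub>3})"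
      using in_G G.vertices_distinct by (auto simp: f_def)
    then show ?thesis using new_vertices in_H by auto
  qed
  have f_inj: "inj_on f (verts_of G)"
    using new_vertices H.vertices_distinct by (auto simp: inj_on_def f_def)
  have signs: "\<beta>' * \<gamma> = - (\<beta> * \<gamma>')" "\<beta> * \<beta> = 1" "\<gamma> * \<gamma> = 1" "\<beta>' * \<beta>' = 1" "\<gamma>' * \<gamma>' = 1"
    and \<epsilon>: "e \<noteq> 0 \<Longrightarrow> \<epsilon> = \<beta> * \<beta>'"
    using sK by (auto simp: G.inner_signs_def \<beta>_def \<beta>'_def \<gamma>_def \<gamma>'_def \<epsilon>_def dart_sign_def split: if_splits)
  have det: "p * s - q * r = \<beta> * \<gamma>' / \<Delta>"
  proof -
    have "p * s - q * r = (\<beta> * \<gamma>' * (b * d) - \<beta>' * \<gamma> * (a * c)) / (\<Delta> * \<Delta>)"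
      by (simp add: p_def q_def r_def s_def diff_divide_distrib mult_ac)
    also have "\<dots> = \<beta> * \<gamma>' * \<Delta> / (\<Delta> * \<Delta>)"
      by (simp add: signs algebra_simps)
    finally show ?thesis using \<Delta> by simp
  qed
  have det_sq: "(p * s - q * r) * (p * s - q * r) * \<Delta>\<^sup>2 = 1"
  proof -
    have "(\<beta> * \<gamma>') * (\<beta> * \<gamma>') = 1" by (simp add: signs mult_ac)
    then show ?thesis unfolding det using \<Delta> by (simp add: power2_eq_square)
  qed
  have orthogonal: "\<beta> * \<gamma> = - (\<beta>' * \<gamma>')"
    using sK by (auto simp: G.inner_signs_def \<beta>_def \<beta>'_def \<gamma>_def \<gamma>'_def dart_sign_def split: if_splits)
  have combine: "p * (\<beta> * b) + q * (\<beta>' * c) = 1" "p * (\<gamma> * a) + q * (\<gamma>' * d) = 0"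
    "r * (\<beta> * b) + s * (\<beta>' * c) = 0" "r * (\<gamma> * a) + s * (\<gamma>' * d) = 1"
  proof -
    have "p * (\<beta> * b) = (\<beta> * \<beta>) * (b * d) / \<Delta>" "q * (\<beta>' * c) = (\<beta>' * \<beta>') * (a * c) / \<Delta>"
      by (simp_all add: p_def q_def mult_ac)
    then show "p * (\<beta> * b) + q * (\<beta>' * c) = 1"
      using \<Delta> by (simp add: signs add_divide_distrib[symmetric] add.commute)
    have "p * (\<gamma> * a) = (\<beta> * \<gamma>) * (a * d) / \<Delta>" "q * (\<gamma>' * d) = (\<beta>' * \<gamma>') * (a * d) / \<Delta>"
      by (simp_all add: p_def q_def mult_ac)
    then show "p * (\<gamma> * a) + q * (\<gamma>' * d) = 0" by (simp add: orthogonal)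
    have "r * (\<beta> * b) = (\<beta> * \<gamma>) * (b * c) / \<Delta>" "s * (\<beta>' * c) = (\<beta>' * \<gamma>') * (b * c) / \<Delta>"
      by (simp_all add: r_def s_def mult_ac)
    then show "r * (\<beta> * b) + s * (\<beta>' * c) = 0" by (simp add: orthogonal)
    have "r * (\<gamma> * a) = (\<gamma> * \<gamma>) * (a * c) / \<Delta>" "s * (\<gamma>' * d) = (\<gamma>' * \<gamma>') * (b * d) / \<Delta>"
      by (simp_all add: r_def s_def mult_ac)
    then show "r * (\<gamma> * a) + s * (\<gamma>' * d) = 1"
      using \<Delta> by (simp add: signs add_divide_distrib[symmetric])
  qed
  have m_C: "dart_sign L k = dart_sign K k" if "k \<in> G.C" for k
    using m that by (simp add: matching_signs_def)
  have L_signs: "dart_sign L u\<^sub>2v\<^sub>2 = 1" "dart_sign L u\<^sub>4v\<^sub>4 = 1"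
    "real_of_int (dart_sign L u\<^sub>2v\<^sub>1) = dart_sign K u\<^sub>1v\<^sub>1 * \<beta>"
    "real_of_int (dart_sign L u\<^sub>2v\<^sub>3) = \<beta>' * dart_sign K u\<^sub>3v\<^sub>3"
    "real_of_int (dart_sign L u\<^sub>4v\<^sub>3) = dart_sign K u\<^sub>3v\<^sub>3 * \<gamma>'"
    "real_of_int (dart_sign L u\<^sub>4v\<^sub>1) = \<gamma> * dart_sign K u\<^sub>1v\<^sub>1"
    "e \<noteq> 0 \<Longrightarrow> real_of_int (dart_sign L u\<^sub>2u\<^sub>4) = \<beta>' * \<gamma>'"
    using m by (simp_all add: matching_signs_def \<beta>_def \<beta>'_def \<gamma>_def \<gamma>'_def)
  have rows: "H.center_row L w = p * G.center_row K w + q * G.center_row' K w"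
    "H.center_row' L w = r * G.center_row K w + s * G.center_row' K w"
    if w: "w \<notin> {u\<^sub>1, u\<^sub>3}" "w \<notin> {u\<^sub>2, u\<^sub>4}" for w
  proof -
    have K_rows: "G.center_row K w = (if w = v\<^sub>1 then dart_sign K u\<^sub>1v\<^sub>1 else if w = v\<^sub>2 then \<beta> * b
        else if w = v\<^sub>4 then \<gamma> * a else 0)"
      "G.center_row' K w = (if w = v\<^sub>3 then dart_sign K u\<^sub>3v\<^sub>3 else if w = v\<^sub>2 then \<beta>' * c
        else if w = v\<^sub>4 then \<gamma>' * d else 0)"
      using w by (simp_all add: G.center_row_def G.center_row'_def \<beta>_def \<beta>'_def \<gamma>_def \<gamma>'_def)
    have L_rows: "H.center_row L w = (if w = v\<^sub>2 then 1 else if w = v\<^sub>3 then \<beta>' * dart_sign K u\<^sub>3v\<^sub>3 * (a / \<Delta>)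
        else if w = v\<^sub>1 then dart_sign K u\<^sub>1v\<^sub>1 * \<beta> * (d / \<Delta>) else 0)"
      "H.center_row' L w = (if w = v\<^sub>4 then 1 else if w = v\<^sub>3 then dart_sign K u\<^sub>3v\<^sub>3 * \<gamma>' * (b / \<Delta>)
        else if w = v\<^sub>1 then \<gamma> * dart_sign K u\<^sub>1v\<^sub>1 * (c / \<Delta>) else 0)"
      using w by (simp_all add: H.center_row_def H.center_row'_def L_signs)
    have single: "real_of_int (dart_sign K u\<^sub>1v\<^sub>1) * \<beta> * (d / \<Delta>) = p * dart_sign K u\<^sub>1v\<^sub>1"
      "\<beta>' * real_of_int (dart_sign K u\<^sub>3v\<^sub>3) * (a / \<Delta>) = q * dart_sign K u\<^sub>3v\<^sub>3"
      "\<gamma> * real_of_int (dart_sign K u\<^sub>1v\<^sub>1) * (c / \<Delta>) = r * dart_sign K u\<^sub>1v\<^sub>1"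
      "real_of_int (dart_sign K u\<^sub>3v\<^sub>3) * \<gamma>' * (b / \<Delta>) = s * dart_sign K u\<^sub>3v\<^sub>3"
      by (simp_all add: p_def q_def r_def s_def mult_ac)
    show "H.center_row L w = p * G.center_row K w + q * G.center_row' K w"
      unfolding K_rows L_rows single using G.vertices_distinct(1-4,6,7,10)
      by (simp add: combine)
    show "H.center_row' L w = r * G.center_row K w + s * G.center_row' K w"
      unfolding K_rows L_rows single using G.vertices_distinct(1-4,6,7,10)
      by (simp add: combine)
  qed
  define \<eta> where "\<eta> = (p * s - q * r) * (\<epsilon> * e)"
  have \<eta>: "\<eta> = p * (s * (\<epsilon> * e)) - q * (r * (\<epsilon> * e))"
    by (simp add: \<eta>_def left_diff_distrib mult.assoc)
  have diagonal: "dart_sign L u\<^sub>2u\<^sub>4 * (e / \<Delta>) = \<eta>"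
  proof (cases "e = 0")
    case False
    have "\<eta> = (\<beta> * \<beta>) * \<beta>' * \<gamma>' * (e / \<Delta>)"
      unfolding \<eta>_def det by (simp add: \<epsilon>[OF False] mult_ac)
    then show ?thesis by (simp add: L_signs(7)[OF False] signs)
  qed (simp add: \<eta>_def)
  have centers: "G.center_row K u\<^sub>1 = 0" "G.center_row K u\<^sub>3 = \<epsilon> * e"
    "G.center_row' K u\<^sub>1 = - (\<epsilon> * e)" "G.center_row' K u\<^sub>3 = 0"
    "H.center_row L u\<^sub>2 = 0" "H.center_row L u\<^sub>4 = \<eta>"
    "H.center_row' L u\<^sub>2 = - \<eta>" "H.center_row' L u\<^sub>4 = 0"
    using G.vertices_distinct' H.vertices_distinct' diagonal
    by (simp_all add: G.center_row_def G.center_row'_def H.center_row_def H.center_row'_def \<epsilon>_def)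
  define N' where "N' x y = ?N (f x) (f y)" for x y
  define R where "R = ?M(u\<^sub>1 := \<lambda>y. const p * ?M u\<^sub>1 y + const q * ?M u\<^sub>3 y,
      u\<^sub>3 := \<lambda>y. const r * ?M u\<^sub>1 y + const s * ?M u\<^sub>3 y)"
  note M_rows = G.shifted_matrix_rows[OF or] and N_rows = H.shifted_matrix_rows[OF L]
  note u13 = G.vertices_distinct(15) G.vertices_distinct(15)[symmetric]
  have f_simps: "f u\<^sub>1 = u\<^sub>2" "f u\<^sub>3 = u\<^sub>4" using u13 by (simp_all add: f_def)
  have R_centers: "R u\<^sub>1 u\<^sub>1 = const (q * (\<epsilon> * e))" "R u\<^sub>1 u\<^sub>3 = const (- (p * (\<epsilon> * e)))"
    "R u\<^sub>3 u\<^sub>1 = const (s * (\<epsilon> * e))" "R u\<^sub>3 u\<^sub>3 = const (- (r * (\<epsilon> * e)))"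
    using u13 by (simp_all add: R_def M_rows centers const_mult)
  have comb: "const g * const h + const k * const l = const (g * h + k * l)" for g h k l
    by (simp add: const_add const_mult)
  have "det_on (verts_of G) N' =
    (const p * const s - const q * const r) * (const p * const s - const q * const r) * det_on (verts_of G) ?M"
  proof (rule det_on_combine_two_rows_columns[where i = u\<^sub>1 and j = u\<^sub>3 and M = ?M
        and a = "const p" and b = "const q" and c = "const r" and d = "const s", folded R_def])
    fix x assume x: "x \<in> verts_of G"
    consider "x = u\<^sub>1" | "x = u\<^sub>3" | "x \<notin> {u\<^sub>1, u\<^sub>3}" "x \<notin> {u\<^sub>2, u\<^sub>4}"
      using x new_vertices by blast
    then have columns: "N' x u\<^sub>1 = const p * R x u\<^sub>1 + const q * R x u\<^sub>3 \<and>
      N' x u\<^sub>3 = const r * R x u\<^sub>1 + const s * R x u\<^sub>3"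
    proof cases
      case 1
      have "N' u\<^sub>1 u\<^sub>1 = 0" "N' u\<^sub>1 u\<^sub>3 = const (- \<eta>)"
        by (simp_all add: N'_def f_simps N_rows centers)
      moreover have "p * (q * (\<epsilon> * e)) + q * (- (p * (\<epsilon> * e))) = 0"
        "r * (q * (\<epsilon> * e)) + s * (- (p * (\<epsilon> * e))) = - \<eta>"
        by (simp_all add: \<eta> mult.left_commute)
      ultimately show ?thesis
        unfolding 1 R_centers comb by (simp only: const_simps)
    next
      case 2
      have "N' u\<^sub>3 u\<^sub>1 = const \<eta>" "N' u\<^sub>3 u\<^sub>3 = 0"
        by (simp_all add: N'_def f_simps N_rows centers)
      moreover have "p * (s * (\<epsilon> * e)) + q * (- (r * (\<epsilon> * e))) = \<eta>"
        "r * (s * (\<epsilon> * e)) + s * (- (r * (\<epsilon> * e))) = 0"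
        by (simp_all add: \<eta> mult.left_commute)
      ultimately show ?thesis
        unfolding 2 R_centers comb by (simp only: const_simps)
    next
      case 3
      then have "f x = x" by (simp add: f_def)
      then have "N' x u\<^sub>1 = const (H.center_row L x)" "N' x u\<^sub>3 = const (H.center_row' L x)"
        by (simp_all add: N'_def f_simps N_rows)
      moreover have "R x u\<^sub>1 = const (G.center_row K x)" "R x u\<^sub>3 = const (G.center_row' K x)"
        using 3 by (simp_all add: R_def M_rows)
      ultimately show ?thesis by (simp add: rows[OF 3] const_add const_mult)
    qed
    then show "N' x u\<^sub>1 = const p * R x u\<^sub>1 + const q * R x u\<^sub>3"
      and "N' x u\<^sub>3 = const r * R x u\<^sub>1 + const s * R x u\<^sub>3" by simp_all
    fix y assume y: "y \<in> verts_of G" "y \<noteq> u\<^sub>1" "y \<noteq> u\<^sub>3"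
    then have y': "y \<notin> {u\<^sub>1, u\<^sub>3}" "y \<notin> {u\<^sub>2, u\<^sub>4}" "f y = y" using new_vertices by (auto simp: f_def)
    consider "x = u\<^sub>1" | "x = u\<^sub>3" | "x \<notin> {u\<^sub>1, u\<^sub>3}" "x \<notin> {u\<^sub>2, u\<^sub>4}"
      using x new_vertices by blast
    then show "N' x y = R x y"
    proof cases
      case 1
      then show ?thesis
        using y'(3) u13 by (simp add: N'_def f_simps N_rows R_def M_rows rows[OF y'(1,2)] const_add const_diff const_mult)
    next
      case 2
      then show ?thesis
        using y'(3) u13 by (simp add: N'_def f_simps N_rows R_def M_rows rows[OF y'(1,2)] const_add const_diff const_mult)
    next
      case 3
      have "dart_matrix H L H.C x y = dart_matrix G K G.C x y"
        unfolding dart_matrix_def same_C(1)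
        by (rule sum.cong) (simp_all add: C_same(2-5) dart_entry_def m_C)
      then have "?N x y = ?M x y"
        unfolding H.shifted_matrix_outside[OF 3(2) y'(2)] G.shifted_matrix_outside[OF 3(1) y'(1)]
        by simp
      then show ?thesis using 3 y'(3) by (simp add: N'_def R_def f_def)
    qed
  qed (use in_G u13 in simp_all)
  then have "det_on (verts_of G) N' = const ((p * s - q * r) * (p * s - q * r)) * charpoly G K"
    by (simp add: G.charpoly_eq_shifted const_mult const_diff)
  moreover have "charpoly H L = det_on (verts_of G) N'"
    unfolding H.charpoly_eq_shifted f_image N'_def by (rule det_on_reindex[OF f_inj]) simp
  ultimately have "const (\<Delta>\<^sup>2) * charpoly H L =
      const (\<Delta>\<^sup>2 * ((p * s - q * r) * (p * s - q * r))) * charpoly G K"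
    by (simp add: const_mult mult.assoc)
  also have "\<Delta>\<^sup>2 * ((p * s - q * r) * (p * s - q * r)) = 1"
    using det_sq by (simp add: mult.commute)
  finally show ?thesis by simp
qed

lemma transfer_spider:
  assumes K: "kasteleyn G K"
  shows "\<exists>L. kasteleyn H L \<and> orientations_agree G K H L \<and>
    charpoly G K = const (\<Delta>\<^sup>2) * charpoly H L"
proof -
  have or: "orientation G K" using K by (simp add: kasteleyn_def)
  define P where "P = {u\<^sub>2v\<^sub>2, u\<^sub>2v\<^sub>3, u\<^sub>2v\<^sub>1, u\<^sub>4v\<^sub>4, u\<^sub>4v\<^sub>3, u\<^sub>4v\<^sub>1} \<union> (if e = 0 then {} else {u\<^sub>2u\<^sub>4})"
  define val where "val k = (if k \<in> {u\<^sub>2v\<^sub>2, u\<^sub>4v\<^sub>4} then 1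
    else if k = u\<^sub>2v\<^sub>1 then dart_sign K u\<^sub>1v\<^sub>1 * dart_sign K u\<^sub>1v\<^sub>2
    else if k = u\<^sub>2v\<^sub>3 then dart_sign K u\<^sub>3v\<^sub>2 * dart_sign K u\<^sub>3v\<^sub>3
    else if k = u\<^sub>4v\<^sub>3 then dart_sign K u\<^sub>3v\<^sub>3 * dart_sign K u\<^sub>3v\<^sub>4
    else if k = u\<^sub>4v\<^sub>1 then dart_sign K u\<^sub>1v\<^sub>4 * dart_sign K u\<^sub>1v\<^sub>1
    else dart_sign K u\<^sub>3v\<^sub>2 * dart_sign K u\<^sub>3v\<^sub>4)" for k
  define \<tau> where "\<tau> k = (if k \<in> G.C then dart_sign K k else if k \<in> P then val k else - val (opp H k))" for k
  have e_iff: "e / \<Delta> = 0 \<longleftrightarrow> e = 0" using \<Delta>_pos by simp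
  have PC: "k \<in> darts_of H \<and> k \<notin> G.C" if "k \<in> P" for k
    using that H.ends H.ends_diagonal e_iff unfolding same_C(1)[symmetric] H.C_def P_def
    by (auto split: if_splits)
  have opp_P: "opp H k \<notin> P" if "k \<in> P" for k
  proof (cases "e = 0")
    case True
    then show ?thesis using that H.dart_neq(1) by (auto simp: P_def)
  next
    case False
    then show ?thesis using that H.dart_neq(2) e_iff by (auto simp: P_def)
  qed
  have cover: "k \<in> G.C \<or> k \<in> P \<or> opp H k \<in> P" if k: "k \<in> darts_of H" for k
  proof (cases "k \<in> G.C")
    case False
    then consider "k \<in> H.inner" | w where "w \<in> H.corners" "k = H.first_dart w \<or> k = H.second_dart w"
      using H.touching_cases(1)[OF k] same_C(1) by auto
    then show ?thesis
    proof cases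
      case 1
      then show ?thesis using e_iff by (auto simp: H.inner_def P_def split: if_splits)
    next
      case 2
      then show ?thesis by (auto simp: H.first_dart_def H.second_dart_def P_def)
    qed
  qed simp
  obtain L where L: "orientation H L" "\<And>k. k \<in> darts_of H \<Longrightarrow> dart_sign L k = \<tau> k"
  proof (rule orientation_with_signs[of H \<tau>])
    have "val k = 1 \<or> val k = - 1" for k by (simp add: val_def dart_sign_def)
    then show "\<tau> k = 1 \<or> \<tau> k = - 1" if "k \<in> darts_of H" for k
      unfolding \<tau>_def by (metis dart_sign_cases minus_equation_iff)
    show "\<tau> (opp H k) = - \<tau> k" if k: "k \<in> darts_of H" for k
    proof (cases "k \<in> G.C")
      case True
      then have "opp H k = opp G k" "opp G k \<in> G.C" "k \<in> darts_of G"
        using C_same(1) G.C_opp same_C(2) by auto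
      then show ?thesis using True by (simp add: \<tau>_def orientation_opp[OF or])
    next
      case False
      then have "opp H k \<notin> G.C"
        using H.C_opp[of "opp H k"] same_C(1) by auto
      then show ?thesis
        using False cover[OF k] opp_P[of k] opp_P[of "opp H k"] by (auto simp: \<tau>_def)
    qed
  qed auto
  have new: "dart_sign L k = val k" if "k \<in> P" for k
    using L(2) PC[OF that] that by (simp add: \<tau>_def)
  have "matching_signs K L"
    unfolding matching_signs_def
  proof (intro conjI ballI impI)
    show "dart_sign L k = dart_sign K k" if "k \<in> G.C" for k
      using L(2)[of k] that same_C(2) by (simp add: \<tau>_def)
    have d: "distinct [u\<^sub>2v\<^sub>2, u\<^sub>2v\<^sub>3, u\<^sub>2v\<^sub>1, u\<^sub>4v\<^sub>4, u\<^sub>4v\<^sub>3, u\<^sub>4v\<^sub>1]" using H.dart_neq(1) by simp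
    show "dart_sign L u\<^sub>2v\<^sub>2 = 1" "dart_sign L u\<^sub>4v\<^sub>4 = 1"
      "dart_sign L u\<^sub>2v\<^sub>1 = dart_sign K u\<^sub>1v\<^sub>1 * dart_sign K u\<^sub>1v\<^sub>2"
      "dart_sign L u\<^sub>2v\<^sub>3 = dart_sign K u\<^sub>3v\<^sub>2 * dart_sign K u\<^sub>3v\<^sub>3"
      "dart_sign L u\<^sub>4v\<^sub>3 = dart_sign K u\<^sub>3v\<^sub>3 * dart_sign K u\<^sub>3v\<^sub>4"
      "dart_sign L u\<^sub>4v\<^sub>1 = dart_sign K u\<^sub>1v\<^sub>4 * dart_sign K u\<^sub>1v\<^sub>1"
      using d by (auto simp: new P_def val_def)
    assume "e \<noteq> 0"
    then have "distinct [u\<^sub>2v\<^sub>2, u\<^sub>2v\<^sub>3, u\<^sub>2v\<^sub>1, u\<^sub>4v\<^sub>4, u\<^sub>4v\<^sub>3, u\<^sub>4v\<^sub>1, u\<^sub>2u\<^sub>4]"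
      using H.dart_neq(2) e_iff by simp
    then show "dart_sign L u\<^sub>2u\<^sub>4 = dart_sign K u\<^sub>3v\<^sub>2 * dart_sign K u\<^sub>3v\<^sub>4"
      using \<open>e \<noteq> 0\<close> by (auto simp: new P_def val_def)
  qed
  note m = this
  have "orientations_agree G K H L"
    unfolding orientations_agree_def
  proof (intro exI[of _ "{}"] ballI)
    fix k assume "k \<in> darts_of G \<inter> darts_of H"
    then have "dart_sign L k = dart_sign K k" using m same_C(2) by (simp add: matching_signs_def)
    then show "((k \<in> L) = (k \<in> K)) = ((tail (dg G) k \<in> {}) = (head (dg G) k \<in> {}))"
      by (simp add: dart_sign_def split: if_splits)
  qed
  then show ?thesis
    using kasteleyn_spider[OF K L(1) m] charpoly_spider[OF K L(1) m] by blast
qed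

end

text \<open>A rotation by a half turn preserves the shape of the disk.\<close>

lemma (in torus_graph) spider_disk_rotate:
  assumes "spider_disk G (x, y, x', y') (u, u') (a, b, c, d, e) (X, Y, X', Y') t"
  shows "spider_disk G (x', y', x, y) (u', u) (c, d, a, b, e) (X', Y', X, Y) t"
  using assms unfolding spider_disk_def case_prod_conv
proof (elim exE conjE, goal_cases)
  case (1 ux uy uy' u'x' u'y u'y' uu')
  note disk = 1
  have diagonal: "e \<noteq> 0 \<longrightarrow> link G (opp G uu') u' u e"
    using disk(9) by (auto simp: link_def wt_opp)
  have exchanged: "ccw G u ([ux, uy] @ (if e = 0 then [] else [opp G (opp G uu')]) @ [uy'])"
    using disk(10) by (cases "e = 0") simp_all
  show ?case
  proof (intro conjI)
    show "distinct [x', y', x, y, u', u]" using disk(1) by auto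
    show "\<forall>k\<in>darts_of G. tail (dg G) k \<in> {u', u} \<longrightarrow>
        crossing G k = t (head (dg G) k) - t (tail (dg G) k)"
      using disk(2) by blast
    show "\<exists>ux uy uy' u'x' u'y u'y' uu'.
       link G ux u' x' 1 \<and> link G uy u' y' d \<and> link G uy' u' y c \<and>
       link G u'x' u x 1 \<and> link G u'y u y' a \<and> link G u'y' u y b \<and>
       (e \<noteq> 0 \<longrightarrow> link G uu' u' u e) \<and>
       ccw G u' ([ux, uy] @ (if e = 0 then [] else [uu']) @ [uy']) \<and>
       ccw G u ([u'x', u'y'] @ (if e = 0 then [] else [opp G uu']) @ [u'y]) \<and>
       ccw G x' (opp G ux # X') \<and> ccw G y' (opp G u'y # opp G uy # Y') \<and>
       ccw G x (opp G u'x' # X) \<and> ccw G y (opp G uy' # opp G u'y' # Y)"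
      by (rule exI[of _ u'x'], rule exI[of _ u'y'], rule exI[of _ u'y], rule exI[of _ ux],
          rule exI[of _ uy'], rule exI[of _ uy], rule exI[of _ "opp G uu'"],
          intro conjI; (rule disk diagonal exchanged))
  qed
qed

lemma spider_disk_imp_spider_graph:
  assumes "torus_graph G"
    and "spider_disk G (x, y, x', y') (u, u') (a, b, c, d, e) (X, Y, X', Y') t"
  obtains ux uy uy' u'x' u'y u'y' uu' where
    "spider_graph G x y x' y' u u' a b c d e X Y X' Y' t ux uy uy' u'x' u'y u'y' uu'"
proof -
  show thesis
    using assms(2) unfolding spider_disk_def case_prod_conv
  proof (elim exE conjE, goal_cases)
    case (1 ux uy uy' u'x' u'y u'y' uu')
    have "spider_graph_axioms G x y x' y' u u' a b c d e X Y X' Y' t ux uy uy' u'x' u'y u'y' uu'"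
      by (rule spider_graph_axioms.intro; (rule 1 | use 1 in blast))
    then show thesis
      using that assms(1) by (simp add: spider_graph_def)
  qed
qed

text \<open>The disk of \<open>G\<close> is a spider disk with the corners \<open>v\<^sub>2, v\<^sub>3, v\<^sub>4, v\<^sub>1\<close>, and \<open>H\<close> has the disk that
  the move prescribes for it, up to a half turn. For its weights, \<open>\<Delta>\<close> is replaced by
  \<open>(d/\<Delta>)(b/\<Delta>) + (a/\<Delta>)(c/\<Delta>) = 1/\<Delta>\<close>.\<close>

lemma spider_with_diagonal_inverse:
  assumes G: "torus_graph G" and H: "torus_graph H" and "spider_with_diagonal e H G"
  shows "\<exists>e. spider_with_diagonal e G H"
  using assms(3)[unfolded spider_with_diagonal_def Let_def]
proof (elim exE conjE, goal_cases)
  case (1 v\<^sub>1 v\<^sub>2 v\<^sub>3 v\<^sub>4 u\<^sub>1 u\<^sub>2 u\<^sub>3 u\<^sub>4 a b c d D\<^sub>1 D\<^sub>2 D\<^sub>3 D\<^sub>4 t)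
  define \<Delta> where "\<Delta> = a * c + b * d"
  from spider_disk_imp_spider_graph[OF H 1(7)] obtain h1 h2 h3 h4 h5 h6 h7 where
    "spider_graph H v\<^sub>1 v\<^sub>2 v\<^sub>3 v\<^sub>4 u\<^sub>1 u\<^sub>3 a b c d e D\<^sub>1 D\<^sub>2 D\<^sub>3 D\<^sub>4 t h1 h2 h3 h4 h5 h6 h7" .
  from spider_graph.weights_pos[OF this] have \<Delta>: "\<Delta> > 0"
    by (simp add: \<Delta>_def add_pos_pos)
  have "d / \<Delta> * (b / \<Delta>) + a / \<Delta> * (c / \<Delta>) = \<Delta> / (\<Delta> * \<Delta>)"
    by (simp add: \<Delta>_def add_divide_distrib mult_ac)
  then have inverse_\<Delta>: "d / \<Delta> * (b / \<Delta>) + a / \<Delta> * (c / \<Delta>) = 1 / \<Delta>"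
    using \<Delta> by simp
  have disk_H: "spider_disk H (v\<^sub>3, v\<^sub>4, v\<^sub>1, v\<^sub>2) (u\<^sub>3, u\<^sub>1) (c, d, a, b, e) (D\<^sub>3, D\<^sub>4, D\<^sub>1, D\<^sub>2) t"
    by (rule torus_graph.spider_disk_rotate[OF H 1(7)])
  have weights: "c / \<Delta> / (1 / \<Delta>) = c" "d / \<Delta> / (1 / \<Delta>) = d" "a / \<Delta> / (1 / \<Delta>) = a"
    "b / \<Delta> / (1 / \<Delta>) = b" "e / \<Delta> / (1 / \<Delta>) = e"
    using \<Delta> by simp_all
  have same: "same_outside G H {v\<^sub>2, v\<^sub>3, v\<^sub>4, v\<^sub>1}"
    using 1(6) unfolding same_outside_def by (simp add: Int_commute insert_commute)
  have disjoint: "{u\<^sub>2, u\<^sub>4} \<inter> verts_of H = {}" "{u\<^sub>3, u\<^sub>1} \<inter> verts_of G = {}"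
    "verts_of G - {u\<^sub>2, u\<^sub>4} = verts_of H - {u\<^sub>3, u\<^sub>1}"
    unfolding insert_commute[of u\<^sub>3 u\<^sub>1] by (rule 1(2), rule 1(1), rule 1(3)[symmetric])
  have common: "darts_of G \<inter> darts_of H =
      {k \<in> darts_of G. tail (dg G) k \<notin> {u\<^sub>2, u\<^sub>4} \<and> head (dg G) k \<notin> {u\<^sub>2, u\<^sub>4}}"
    by (rule trans[OF Int_commute 1(5)])
  have common': "darts_of G \<inter> darts_of H =
      {k \<in> darts_of H. tail (dg H) k \<notin> {u\<^sub>3, u\<^sub>1} \<and> head (dg H) k \<notin> {u\<^sub>3, u\<^sub>1}}"
    unfolding insert_commute[of u\<^sub>3 u\<^sub>1] by (rule trans[OF Int_commute 1(4)])
  have "spider_with_diagonal (e / \<Delta>) G H"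
    unfolding spider_with_diagonal_def Let_def
  proof (rule exI[of _ v\<^sub>2], rule exI[of _ v\<^sub>3], rule exI[of _ v\<^sub>4], rule
      exI[of _ v\<^sub>1], rule exI[of _ u\<^sub>2], rule exI[of _ u\<^sub>3], rule exI[of _
      u\<^sub>4], rule exI[of _ u\<^sub>1], rule exI[of _ "d / \<Delta>"], rule exI[of _ "a /
      \<Delta>"], rule exI[of _ "b / \<Delta>"], rule exI[of _ "c / \<Delta>"], rule exI[of _
      D\<^sub>2], rule exI[of _ D\<^sub>3], rule exI[of _ D\<^sub>4], rule exI[of _ D\<^sub>1], rule
      exI[of _ t], intro conjI)
    show "spider_disk G (v\<^sub>2, v\<^sub>3, v\<^sub>4, v\<^sub>1) (u\<^sub>2, u\<^sub>4) (d / \<Delta>, a / \<Delta>, b / \<Delta>, c / \<Delta>, e / \<Delta>)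
        (D\<^sub>2, D\<^sub>3, D\<^sub>4, D\<^sub>1) t"
      using 1(8) by (simp only: \<Delta>_def)
    show "spider_disk H (v\<^sub>3, v\<^sub>4, v\<^sub>1, v\<^sub>2) (u\<^sub>3, u\<^sub>1)
      (c / \<Delta> / (d / \<Delta> * (b / \<Delta>) + a / \<Delta> * (c / \<Delta>)),
       d / \<Delta> / (d / \<Delta> * (b / \<Delta>) + a / \<Delta> * (c / \<Delta>)),
       a / \<Delta> / (d / \<Delta> * (b / \<Delta>) + a / \<Delta> * (c / \<Delta>)),
       b / \<Delta> / (d / \<Delta> * (b / \<Delta>) + a / \<Delta> * (c / \<Delta>)),
       e / \<Delta> / (d / \<Delta> * (b / \<Delta>) + a / \<Delta> * (c / \<Delta>))) (D\<^sub>3, D\<^sub>4, D\<^sub>1, D\<^sub>2) t"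
      unfolding inverse_\<Delta> weights by (rule disk_H)
  qed (fact same disjoint common common')+
  then show ?case by blast
qed

lemma transfer_spider_with_diagonal:
  assumes G: "torus_graph G" and H: "torus_graph H" and K: "kasteleyn G K"
    and move: "spider_with_diagonal e G H \<or> spider_with_diagonal e H G"
  shows "\<exists>L. kasteleyn H L \<and> orientations_agree G K H L \<and>
    (\<exists>c\<^sub>0. c\<^sub>0 \<noteq> 0 \<and> charpoly G K = const c\<^sub>0 * charpoly H L)"
proof -
  have forward: ?thesis if "spider_with_diagonal e G H" for e
  proof -
    from that[unfolded spider_with_diagonal_def Let_def]
    show ?thesis
    proof (elim exE conjE, goal_cases)
      case (1 v\<^sub>1 v\<^sub>2 v\<^sub>3 v\<^sub>4 u\<^sub>1 u\<^sub>2 u\<^sub>3 u\<^sub>4 a b c d D\<^sub>1 D\<^sub>2 D\<^sub>3 D\<^sub>4 t)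
      from spider_disk_imp_spider_graph[OF G 1(7)] obtain g1 g2 g3 g4 g5 g6 g7 where
        sG: "spider_graph G v\<^sub>1 v\<^sub>2 v\<^sub>3 v\<^sub>4 u\<^sub>1 u\<^sub>3 a b c d e D\<^sub>1 D\<^sub>2 D\<^sub>3 D\<^sub>4 t g1 g2 g3 g4 g5 g6 g7" .
      from spider_disk_imp_spider_graph[OF H 1(8)] obtain h1 h2 h3 h4 h5 h6 h7 where
        sH: "spider_graph H v\<^sub>2 v\<^sub>3 v\<^sub>4 v\<^sub>1 u\<^sub>2 u\<^sub>4 (d / (a * c + b * d)) (a / (a * c + b * d))
          (b / (a * c + b * d)) (c / (a * c + b * d)) (e / (a * c + b * d)) D\<^sub>2 D\<^sub>3 D\<^sub>4 D\<^sub>1 t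
          h1 h2 h3 h4 h5 h6 h7" .
      interpret spider_pair G H v\<^sub>1 v\<^sub>2 v\<^sub>3 v\<^sub>4 u\<^sub>1 u\<^sub>2 u\<^sub>3 u\<^sub>4 a b c d e D\<^sub>1 D\<^sub>2 D\<^sub>3 D\<^sub>4 t
        g1 g2 g3 g4 g5 g6 g7 h1 h2 h3 h4 h5 h6 h7
        by (intro spider_pair.intro sG sH spider_pair_axioms.intro; rule 1)
      have "\<Delta>\<^sup>2 \<noteq> 0" using \<Delta>_pos by simp
      then show ?thesis using transfer_spider[OF K] by blast
    qed
  qed
  show ?thesis
    using move
  proof
    assume "spider_with_diagonal e H G"
    from spider_with_diagonal_inverse[OF G H this] show ?thesis using forward by blast
  qed (rule forward)
qed

section \<open>Invariance of the characteristic polynomial\<close>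

theorem proposition42:
  fixes G\<^sub>1 G\<^sub>2 :: "('v, 'd) emb_graph" and K\<^sub>1 :: "'d set"
  assumes "torus_graph G\<^sub>1" and "torus_graph G\<^sub>2"
    and "elementary_move G\<^sub>1 G\<^sub>2 \<or> elementary_move G\<^sub>2 G\<^sub>1"
    and "kasteleyn G\<^sub>1 K\<^sub>1"
  shows "\<exists>K\<^sub>2. kasteleyn G\<^sub>2 K\<^sub>2 \<and> orientations_agree G\<^sub>1 K\<^sub>1 G\<^sub>2 K\<^sub>2 \<and>
    (\<exists>c\<^sub>0. c\<^sub>0 \<noteq> 0 \<and> charpoly G\<^sub>1 K\<^sub>1 = Poly_Mapping.single 0 c\<^sub>0 * charpoly G\<^sub>2 K\<^sub>2)"
proof -
  have equal: ?thesis if "\<exists>K\<^sub>2. kasteleyn G\<^sub>2 K\<^sub>2 \<and> orientations_agree G\<^sub>1 K\<^sub>1 G\<^sub>2 K\<^sub>2 \<and>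
    charpoly G\<^sub>1 K\<^sub>1 = charpoly G\<^sub>2 K\<^sub>2"
    using that by (metis mult_1 single_one zero_neq_one)
  consider "expansion G\<^sub>1 G\<^sub>2" | "expansion G\<^sub>2 G\<^sub>1" | "lambda_move G\<^sub>1 G\<^sub>2" | "lambda_move G\<^sub>2 G\<^sub>1"
    | e where "spider_with_diagonal e G\<^sub>1 G\<^sub>2 \<or> spider_with_diagonal e G\<^sub>2 G\<^sub>1"
    using assms(3) unfolding elementary_move_def spider_move_def diagonal_spider_move_def by blast
  then show ?thesis
  proof cases
    case 1
    then obtain v v\<^sub>1 v\<^sub>2 v\<^sub>3 p q xs ys t where "vertex_expansion G\<^sub>1 G\<^sub>2 v v\<^sub>1 v\<^sub>2 v\<^sub>3 p q xs ys t"
      by (rule expansion_imp_vertex_expansion[OF assms(1,2)])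
    from vertex_expansion.transfer_to_expanded[OF this assms(4)] show ?thesis
      by (intro equal) metis
  next
    case 2
    then obtain v v\<^sub>1 v\<^sub>2 v\<^sub>3 p q xs ys t where "vertex_expansion G\<^sub>2 G\<^sub>1 v v\<^sub>1 v\<^sub>2 v\<^sub>3 p q xs ys t"
      by (rule expansion_imp_vertex_expansion[OF assms(2,1)])
    from vertex_expansion.transfer_to_contracted[OF this assms(4)] show ?thesis
      by (rule equal)
  next
    case 3
    then obtain u v\<^sub>1 v\<^sub>2 v\<^sub>3 a b c d uv\<^sub>1 uv\<^sub>2 uv\<^sub>3 m n D\<^sub>1 D\<^sub>2 D\<^sub>3
      where "lambda_graphs G\<^sub>1 G\<^sub>2 u v\<^sub>1 v\<^sub>2 v\<^sub>3 a b c d uv\<^sub>1 uv\<^sub>2 uv\<^sub>3 m n D\<^sub>1 D\<^sub>2 D\<^sub>3"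
      by (rule lambda_move_imp_lambda_graphs[OF assms(1,2)])
    from lambda_graphs.transfer_lambda[OF this assms(4)] show ?thesis
      by (rule equal)
  next
    case 4
    then obtain u v\<^sub>1 v\<^sub>2 v\<^sub>3 a b c d uv\<^sub>1 uv\<^sub>2 uv\<^sub>3 m n D\<^sub>1 D\<^sub>2 D\<^sub>3
      where "lambda_graphs G\<^sub>2 G\<^sub>1 u v\<^sub>1 v\<^sub>2 v\<^sub>3 a b c d uv\<^sub>1 uv\<^sub>2 uv\<^sub>3 m n D\<^sub>1 D\<^sub>2 D\<^sub>3"
      by (rule lambda_move_imp_lambda_graphs[OF assms(2,1)])
    from lambda_graphs.transfer_lambda_inverse[OF this assms(4)] show ?thesis
      by (intro equal) metis
  next
    case 5
    then show ?thesis
      using transfer_spider_with_diagonal[OF assms(1,2,4)] unfolding const_def by blast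
  qed
qed

end
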